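(* For any dihedral group $G=I_2(N)$ with constant multiplicity $m\in\mathbb Z_{\ge0}$, the linear map $$\pi_m|_{H_m}:H_m\to H_m,\qquad \pi_m(q)=\mathcal L_q(w_m),$$ is an isomorphism.
   Context: $G=I_2(N)$, $N\ge2$, is the dihedral group of order $2N$ acting on the Euclidean plane with coordinates $(x_1,x_2)$, generated by the reflections in the lines $(\alpha^j,x)=0$, $\alpha^j=(-\sin\frac{\pi j}{N},\cos\frac{\pi j}{N})$, $j=0,\ldots,N-1$; $A=\{\alpha^0,\ldots,\alpha^{N-1}\}$. All multiplicities equal $m\in\mathbb Z_{\ge0}$. Put $z=x_1+ix_2$, $\bar z=x_1-ix_2$. Polynomials have complex coefficients. The ring $S^G$ of $G$-invariant polynomials is freely generated by $\sigma_1=z\bar z$, $\sigma_2=z^N+\bar z^N$. $Q_m$ is the ring of $m$-quasiinvariants: polynomials $q(x_1,x_2)$ such that for each $\alpha\in A$ the derivatives $\partial_\alpha^{s}q$, $s=1,3,\ldots,2m-1$, vanish on the line $(\alpha,x)=0$, where $\partial_\alpha=(\alpha,\partial/\partial x)$. $\mathcal L=\Delta-2m\sum_{\alpha\in A}\frac{1}{(\alpha,x)}\partial_\alpha$. There is a (known) algebra homomorphism $\chi_m$ from $Q_m$ to a commutative algebra of differential operators with rational coefficients, $q\mapsto\mathcal L_q=\chi_m(q)$, given for homogeneous $q$ of degree $d$ by $\mathcal L_q=\frac{1}{2^dd!}(\mathrm{ad}_{\mathcal L})^d\hat q$, where $\mathrm{ad}_{\mathcal L}B=\mathcal LB-B\mathcal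 L$ and $\hat q$ is multiplication by $q$, extended linearly. $\mathcal L_1=\chi_m(\sigma_1)=\mathcal L$, $\mathcal L_2=\chi_m(\sigma_2)$, and $H_m$ is the space of $m$-harmonic polynomials, i.e. polynomials in $\ker\mathcal L_1\cap\ker\mathcal L_2$; one has $H_m\subset Q_m$. Finally $w_m=\prod_{\alpha\in A}(\alpha,x)^{2m+1}$. *)

theory Defs
  imports
    "HOL-Analysis.Analysis"
    "HOL-Computational_Algebra.Computational_Algebra"
begin

(* C[x1,x2] is modelled by poly2: the outer variable is x2 and the coefficients are
   polynomials in x1.  Rational functions form its fraction field rat2.  Differential
   operators with rational coefficients are represented by their (faithful) action on
   rat2, so the product of operators is composition. *)

type_synonym poly2 = "complex poly poly"
type_synonym rat2 = "complex poly poly fract"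
type_synonym rat_op = "rat2 \<Rightarrow> rat2"

definition const2 :: "complex \<Rightarrow> poly2" where
  "const2 c = [:[:c:]:]"

definition X1 :: poly2 where "X1 = [:[:0, 1:]:]"

definition X2 :: poly2 where "X2 = [:0, 1:]"

definition eval2 :: "poly2 \<Rightarrow> real \<times> real \<Rightarrow> complex" where
  "eval2 p x = poly (poly p [:complex_of_real (snd x):]) (complex_of_real (fst x))"

definition pd1 :: "poly2 \<Rightarrow> poly2" where
  "pd1 = map_poly pderiv"

definition pd2 :: "poly2 \<Rightarrow> poly2" where
  "pd2 = pderiv"

lemma coeff_pd1: "coeff (pd1 p) n = pderiv (coeff p n)"
  by (simp add: pd1_def coeff_map_poly)

lemma pd1_mult: "pd1 (p * q) = p * pd1 q + pd1 p * q"
proof (rule poly_eqI)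
  fix n
  have "pderiv (\<Sum>i\<le>n. coeff p i * coeff q (n - i)) =
      (\<Sum>i\<le>n. coeff p i * pderiv (coeff q (n - i)) + pderiv (coeff p i) * coeff q (n - i))"
    unfolding higher_pderiv_sum[of 1, simplified]
    by (intro sum.cong) (simp_all add: pderiv_mult mult.commute)
  then show "coeff (pd1 (p * q)) n = coeff (p * pd1 q + pd1 p * q) n"
    by (simp add: coeff_pd1 coeff_mult sum.distrib)
qed

lemma pd2_mult: "pd2 (p * q) = p * pd2 q + pd2 p * q"
  by (simp add: pd2_def pderiv_mult mult.commute)

lemma quotient_rule_respects:
  fixes D :: "'a::comm_ring_1 \<Rightarrow> 'a"
  assumes D: "\<And>p q. D (p * q) = p * D q + D p * q" and eq: "a * b' = a' * b"
  shows "(D a * b - a * D b) * (b' * b') = (D a' * b' - a' * D b') * (b * b)"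
proof -
  have "a * D b' + D a * b' = a' * D b + D a' * b"
    using arg_cong[OF eq, of D] by (simp add: D)
  then have Da: "D a * b' = a' * D b + D a' * b - a * D b'"
    by (simp add: algebra_simps)
  have "(D a * b - a * D b) * (b' * b') = (D a * b') * (b * b') - (a * b') * (D b * b')"
    by (simp add: algebra_simps)
  also have "\<dots> = (a' * D b + D a' * b - a * D b') * (b * b') - (a' * b) * (D b * b')"
    by (simp only: eq Da)
  also have "\<dots> = (D a' * b) * (b * b') - (a * b') * (b * D b')"
    by (simp add: algebra_simps)
  also have "\<dots> = (D a' * b) * (b * b') - (a' * b) * (b * D b')"
    by (simp only: eq)
  also have "\<dots> = (D a' * b' - a' * D b') * (b * b)"
    by (simp add: algebra_simps)
  finally show ?thesis .
qed

(* the extension of a derivation D to the fraction field by the quotient rule *)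
definition fract_deriv :: "('a::idom \<Rightarrow> 'a) \<Rightarrow> 'a fract \<Rightarrow> 'a fract" where
  "fract_deriv D f =
     (THE g. \<forall>a b. b \<noteq> 0 \<longrightarrow> f = Fract a b \<longrightarrow> g = Fract (D a * b - a * D b) (b * b))"

lemma fract_deriv_Fract:
  assumes D: "\<And>p q. D (p * q) = p * D q + D p * q" and b: "b \<noteq> 0"
  shows "fract_deriv D (Fract a b) = Fract (D a * b - a * D b) (b * b)"
  unfolding fract_deriv_def
proof (rule the_equality, intro allI impI)
  fix a' b' assume b': "b' \<noteq> 0" and "Fract a b = Fract a' b'"
  then have "a * b' = a' * b" using b by (simp add: eq_fract)
  from quotient_rule_respects[of D, OF D this]
  show "Fract (D a * b - a * D b) (b * b) = Fract (D a' * b' - a' * D b') (b' * b')"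
    using b b' by (simp add: eq_fract)
next
  fix g assume "\<forall>a' b'. b' \<noteq> 0 \<longrightarrow> Fract a b = Fract a' b' \<longrightarrow>
    g = Fract (D a' * b' - a' * D b') (b' * b')"
  then show "g = Fract (D a * b - a * D b) (b * b)" using b by blast
qed

definition dx1 :: rat_op where "dx1 = fract_deriv pd1"

definition dx2 :: rat_op where "dx2 = fract_deriv pd2"

lemma dx1_Fract: "b \<noteq> 0 \<Longrightarrow> dx1 (Fract a b) = Fract (pd1 a * b - a * pd1 b) (b * b)"
  unfolding dx1_def by (rule fract_deriv_Fract[of pd1, OF pd1_mult])

lemma dx2_Fract: "b \<noteq> 0 \<Longrightarrow> dx2 (Fract a b) = Fract (pd2 a * b - a * pd2 b) (b * b)"
  unfolding dx2_def by (rule fract_deriv_Fract[of pd2, OF pd2_mult])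

abbreviation scale_poly2 :: "complex \<Rightarrow> poly2 \<Rightarrow> poly2" where
  "scale_poly2 c p \<equiv> const2 c * p"

abbreviation scale_rat2 :: "complex \<Rightarrow> rat2 \<Rightarrow> rat2" where
  "scale_rat2 c f \<equiv> to_fract (const2 c) * f"

global_interpretation poly2: vector_space scale_poly2
proof
  fix a b :: complex and x y :: poly2
  have *: "const2 (a + b) = const2 a + const2 b" "const2 (a * b) = const2 a * const2 b"
    by (simp_all add: const2_def)
  have **: "const2 1 = 1" by (simp add: const2_def flip: one_pCons)
  show "scale_poly2 a (x + y) = scale_poly2 a x + scale_poly2 a y" by (simp add: algebra_simps)
  show "scale_poly2 (a + b) x = scale_poly2 a x + scale_poly2 b x" by (simp add: * algebra_simps)
  show "scale_poly2 a (scale_poly2 b x) = scale_poly2 (a * b) x" by (simp add: * algebra_simps)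
  show "scale_poly2 1 x = x" by (simp add: **)
qed

global_interpretation rat2: vector_space scale_rat2
proof
  fix a b :: complex and x y :: rat2
  have *: "const2 (a + b) = const2 a + const2 b" "const2 (a * b) = const2 a * const2 b"
    by (simp_all add: const2_def)
  have **: "const2 1 = 1" by (simp add: const2_def flip: one_pCons)
  show "scale_rat2 a (x + y) = scale_rat2 a x + scale_rat2 a y" by (simp add: algebra_simps)
  show "scale_rat2 (a + b) x = scale_rat2 a x + scale_rat2 b x" by (simp add: * algebra_simps)
  show "scale_rat2 a (scale_rat2 b x) = scale_rat2 (a * b) x" by (simp add: * algebra_simps)
  show "scale_rat2 1 x = x" by (simp add: **)
qed

definition linear_iso_between ::
  "(complex \<Rightarrow> 'a::ab_group_add \<Rightarrow> 'a) \<Rightarrow> (complex \<Rightarrow> 'b::ab_group_add \<Rightarrow> 'b) \<Rightarrow>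
   ('a \<Rightarrow> 'b) \<Rightarrow> 'a set \<Rightarrow> 'b set \<Rightarrow> bool" where
  "linear_iso_between s t f V W \<longleftrightarrow>
     module.subspace s V \<and> module.subspace t W \<and>
     (\<forall>u\<in>V. \<forall>v\<in>V. f (u + v) = f u + f v) \<and>
     (\<forall>c. \<forall>v\<in>V. f (s c v) = t c (f v)) \<and>
     bij_betw f V W"

definition alpha :: "nat \<Rightarrow> nat \<Rightarrow> real \<times> real" where
  "alpha N j = (- sin (pi * real j / real N), cos (pi * real j / real N))"

definition roots :: "nat \<Rightarrow> (real \<times> real) set" where
  "roots N = alpha N ` {..<N}"

definition lin_form :: "real \<times> real \<Rightarrow> poly2" where
  "lin_form \<alpha> = const2 (complex_of_real (fst \<alpha>)) * X1 + const2 (complex_of_real (snd \<alpha>)) * X2"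

definition dir_pd :: "real \<times> real \<Rightarrow> poly2 \<Rightarrow> poly2" where
  "dir_pd \<alpha> p = const2 (complex_of_real (fst \<alpha>)) * pd1 p + const2 (complex_of_real (snd \<alpha>)) * pd2 p"

definition dir_dx :: "real \<times> real \<Rightarrow> rat_op" where
  "dir_dx \<alpha> f = scale_rat2 (complex_of_real (fst \<alpha>)) (dx1 f)
     + scale_rat2 (complex_of_real (snd \<alpha>)) (dx2 f)"

definition quasiinvariants :: "nat \<Rightarrow> nat \<Rightarrow> poly2 set" where
  "quasiinvariants N m =
     {q. \<forall>\<alpha>\<in>roots N. \<forall>s. odd s \<and> s < 2 * m \<longrightarrow>
           (\<forall>x. \<alpha> \<bullet> x = 0 \<longrightarrow> eval2 ((dir_pd \<alpha> ^^ s) q) x = 0)}"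

definition calL :: "nat \<Rightarrow> nat \<Rightarrow> rat_op" where
  "calL N m f = dx1 (dx1 f) + dx2 (dx2 f)
     - 2 * of_nat m * (\<Sum>\<alpha>\<in>roots N. (1 / to_fract (lin_form \<alpha>)) * dir_dx \<alpha> f)"

definition ad :: "rat_op \<Rightarrow> rat_op \<Rightarrow> rat_op" where
  "ad A B = (\<lambda>f. A (B f) - B (A f))"

definition mult_op :: "poly2 \<Rightarrow> rat_op" where
  "mult_op q = (\<lambda>f. to_fract q * f)"

definition hom_part :: "nat \<Rightarrow> poly2 \<Rightarrow> poly2" where
  "hom_part d q = (\<Sum>j\<le>d. const2 (coeff (coeff q j) (d - j)) * X1 ^ (d - j) * X2 ^ j)"

lemma hom_part_monom: "const2 c * X1 ^ i * X2 ^ j = monom (monom c i) j"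
proof -
  have 1: "X1 = [:monom 1 1:]" by (simp add: X1_def monom_Suc one_pCons)
  have 2: "X1 ^ i = [:monom 1 i:]"
  proof (induction i)
    case 0
    show ?case by (simp add: one_pCons monom_0)
  next
    case (Suc i)
    then show ?case by (simp add: 1 mult_monom)
  qed
  have 3: "X2 = monom 1 1" by (simp add: X2_def monom_Suc monom_0 one_pCons)
  show ?thesis
    unfolding 2 3 by (simp add: const2_def monom_power smult_monom)
qed

lemma coeff_hom_part:
  "coeff (coeff (hom_part d q) j) i = (if i + j = d then coeff (coeff q j) i else 0)"
proof -
  have "coeff (coeff (hom_part d q) j) i =
      (\<Sum>k\<le>d. if k = j then (if d - j = i then coeff (coeff q j) i else 0) else 0)"
    unfolding hom_part_def coeff_sum hom_part_monom
    by (intro sum.cong refl) auto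
  also have "\<dots> = (if i + j = d then coeff (coeff q j) i else 0)"
    by (subst sum.delta) auto
  finally show ?thesis .
qed

lemma finite_hom_parts: "finite {d. hom_part d q \<noteq> 0}"
proof (rule finite_subset)
  show "{d. hom_part d q \<noteq> 0} \<subseteq> (\<Union>j\<le>degree q. (\<lambda>i. i + j) ` {..degree (coeff q j)})"
  proof
    fix d assume "d \<in> {d. hom_part d q \<noteq> 0}"
    then obtain i j where "coeff (coeff (hom_part d q) j) i \<noteq> 0"
      by (metis (mono_tags, lifting) coeff_0 mem_Collect_eq poly_eqI)
    then have d: "d = i + j" and nz: "coeff (coeff q j) i \<noteq> 0"
      by (auto simp: coeff_hom_part split: if_splits)
    from nz have "i \<le> degree (coeff q j)" by (rule le_degree)
    moreover from nz have "j \<le> degree q" by (intro le_degree) auto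
    ultimately show "d \<in> (\<Union>j\<le>degree q. (\<lambda>i. i + j) ` {..degree (coeff q j)})"
      using d by blast
  qed
qed auto

lemma sum_hom_parts: "(\<Sum>d | hom_part d q \<noteq> 0. hom_part d q) = q"
proof (intro poly_eqI)
  fix j i
  have "coeff (coeff (\<Sum>d | hom_part d q \<noteq> 0. hom_part d q) j) i =
      (\<Sum>d | hom_part d q \<noteq> 0. if d = i + j then coeff (coeff q j) i else 0)"
    unfolding coeff_sum coeff_hom_part by (intro sum.cong) auto
  also have "\<dots> = (if hom_part (i + j) q \<noteq> 0 then coeff (coeff q j) i else 0)"
    using finite_hom_parts by (subst sum.delta) auto
  also have "\<dots> = coeff (coeff q j) i"
    using coeff_hom_part[of "i + j" q j i] by auto
  finally show "coeff (coeff (\<Sum>d | hom_part d q \<noteq> 0. hom_part d q) j) i = coeff (coeff q j) i" .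
qed

(* The homogeneous formula, summed over the homogeneous components.  It makes sense for
   every polynomial q; it is the homomorphism chi_m on the ring quasiinvariants N m, to
   which the invariants sigma1, sigma2 and all m-harmonic polynomials belong. *)
definition chi :: "nat \<Rightarrow> nat \<Rightarrow> poly2 \<Rightarrow> rat_op" where
  "chi N m q = (\<lambda>f. \<Sum>d | hom_part d q \<noteq> 0.
     scale_rat2 (1 / (2 ^ d * fact d)) ((ad (calL N m) ^^ d) (mult_op (hom_part d q)) f))"

definition sigma1 :: poly2 where
  "sigma1 = (X1 + const2 \<i> * X2) * (X1 - const2 \<i> * X2)"

definition sigma2 :: "nat \<Rightarrow> poly2" where
  "sigma2 N = (X1 + const2 \<i> * X2) ^ N + (X1 - const2 \<i> * X2) ^ N"

definition harmonics :: "nat \<Rightarrow> nat \<Rightarrow> poly2 set" where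
  "harmonics N m =
     {q. chi N m sigma1 (to_fract q) = 0 \<and> chi N m (sigma2 N) (to_fract q) = 0}"

definition w_poly :: "nat \<Rightarrow> nat \<Rightarrow> poly2" where
  "w_poly N m = (\<Prod>\<alpha>\<in>roots N. lin_form \<alpha> ^ (2 * m + 1))"

(* A priori only a rational function: that the values are again m-harmonic polynomials has
   to be expressed by the target to_fract ` harmonics N m. *)
definition pi_map :: "nat \<Rightarrow> nat \<Rightarrow> poly2 \<Rightarrow> rat2" where
  "pi_map N m q = chi N m q (to_fract (w_poly N m))"

end

theory Submission
  imports Defs
begin

text \<open>
  In the coordinates \<open>z\<close> and its conjugate \<open>zb\<close> the operator \<open>\<L>\<close> equals
  \<open>4 (\<partial> \<partial>b + mN (zb\<^bsup>N-1\<^esup> \<partial> - z\<^bsup>N-1\<^esup> \<partial>b) / P)\<close> with \<open>P = z\<^sup>N - zb\<^sup>N\<close>, and \<open>w\<^sub>m\<close> is a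
  multiple of \<open>P\<^bsup>2m+1\<^esup>\<close>.  On \<open>ker \<L>\<close> the iterated commutator
  \<open>(ad \<L>)\<^sup>d q\<close> acts as \<open>f \<mapsto> \<L>\<^sup>d (q f)\<close>; hence \<open>\<pi>\<^sub>m(q)\<close> is a multiple of
  \<open>\<L>\<^sup>d (q w\<^sub>m)\<close>, and \<open>\<L>\<^sub>2\<close> acts on \<open>ker \<L>\<close> in degree \<open>n\<close> as a multiple of the
  translation in \<open>z\<^sup>N\<close>, \<open>zb\<^sup>N\<close>, which is zero exactly for \<open>mN < n < mN + N\<close>.  Two-term recursions
  for the coefficients then show that the \<open>m\<close>-harmonic polynomials have the basis \<open>1\<close>, \<open>P\<^bsup>2m+1\<^esup>\<close>,
  \<open>q\<^sub>j\<close> and the conjugates of \<open>q\<^sub>j\<close> (\<open>0 < j < N\<close>), where \<open>q\<^sub>j\<close> has degree \<open>mN + j\<close>.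

  The operator \<open>\<L>\<close> preserves quasi-invariance, and \<open>\<L>\<^bsup>mN+j+1\<^esup>(q\<^sub>j P\<^bsup>2m+1\<^esup>)\<close> can contain only
  \<open>m\<close> monomials, so the \<open>m\<close> odd moments annihilate it by a Vandermonde argument.  Therefore
  \<open>\<pi>\<^sub>m(q\<^sub>j)\<close> is a multiple of the conjugate of \<open>q\<^bsub>N-j\<^esub>\<close>.  It is not zero: \<open>\<L>\<close> is symmetric, up to total
  derivatives, for the pairing \<open>f g / P\<^bsup>2m\<^esup>\<close> on the circle, so otherwise \<open>q\<^sub>j q\<^bsub>N-j\<^esub> P\<close> would have no
  constant term on the circle, which contradicts the moment conditions.  For \<open>w\<^sub>m\<close> itself the same
  argument uses, when \<open>m > 0\<close>, a generalized eigenfunction in place of the constant \<open>1\<close>, whose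
  eigenvalue is resonant.
\<close>


text \<open>Since \<open>w_poly\<close> has degree (2m+1)N, the map sends degree d to degree (2m+1)N
  - d. Degree mN + j therefore goes to degree mN + (N - j), and the rotation character picks one of
  the two basis elements there. So the map permutes the basis up to scalars, and the work lies in
  showing that no scalar is zero. Pairing with an eigenfunction of the angular part of the operator,
  of degree n', turns an i-th application of \<open>calL\<close> into a factor
  \<open>lam n_i - lam n'\<close>, where n_i is the current degree and
  \<open>lam n = n(n - 2mN)\<close>. The quadratic \<open>lam\<close> takes each value at two
  degrees whose sum is 2mN. For the pairing with 1 this gives a zero factor as soon as m > 0: the
  iterates of P^(4m+2) pass through degree 2mN. The partner of 1 in a Jordan block replaces that
  factor by a nonzero constant. The pairing has the denominator P^(2m), so exactness first lives in
  a localized ring. The factor P^(2m+1) carried by q w absorbs the pole and brings exactness back to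
  polynomials, where a nonzero coefficient of some (z zb)^a refutes it.\<close>

declare poly2.scale_scale [simp del] rat2.scale_scale [simp del]

subsection \<open>Derivations\<close>

text \<open>The fields met below (\<open>dz\<close>, \<open>Dz\<close>, \<open>EE\<close>,
  \<open>TT N\<close>, \<open>delta\<close>) act on polynomials or on the fraction field; the power
  and Leibniz rules are proved once for all of them.\<close>

locale derivation =
  fixes D :: "'a::comm_ring_1 \<Rightarrow> 'a"
  assumes add: "D (x + y) = D x + D y"
    and mult: "D (x * y) = x * D y + D x * y"
begin

lemma zero [simp]: "D 0 = 0"
  using add[of 0 0] by simp

lemma one [simp]: "D 1 = 0"
  using mult[of 1 1] by simp

lemma minus [simp]: "D (- x) = - D x"
  using add[of x "- x"] by (simp add: eq_neg_iff_add_eq_0 add.commute)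

lemma diff: "D (x - y) = D x - D y"
  using add[of x "- y"] by simp

lemma of_nat [simp]: "D (of_nat n) = 0"
  by (induction n) (simp_all add: add)

lemma numeral [simp]: "D (numeral n) = 0"
  using of_nat[of "numeral n"] by simp

lemma sum: "D (sum f A) = (\<Sum>i\<in>A. D (f i))"
  by (induction A rule: infinite_finite_induct) (simp_all add: add)

lemma power: "D (x ^ n) = of_nat n * x ^ (n - 1) * D x"
proof (induction n)
  case (Suc n)
  have "D (x ^ Suc n) = x * (of_nat n * x ^ (n - 1) * D x) + D x * x ^ n"
    by (simp add: mult Suc)
  also have "\<dots> = of_nat (Suc n) * x ^ n * D x"
    by (cases n) (simp_all add: algebra_simps)
  finally show ?case by simp
qed simp

lemma funpow_add: "(D ^^ n) (x + y) = (D ^^ n) x + (D ^^ n) y"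
  by (induction n) (simp_all add: add)

lemma funpow_0 [simp]: "(D ^^ n) 0 = 0"
  by (induction n) simp_all

lemma leibniz:
  "(D ^^ n) (x * y) = (\<Sum>k\<le>n. of_nat (n choose k) * (D ^^ k) x * (D ^^ (n - k)) y)"
proof (induction n)
  case (Suc n)
  let ?t = "\<lambda>i j. (D ^^ i) x * (D ^^ j) y"
  have "(D ^^ Suc n) (x * y) = D (\<Sum>k\<le>n. of_nat (n choose k) * (D ^^ k) x * (D ^^ (n - k)) y)"
    using Suc by simp
  also have "\<dots> = (\<Sum>k\<le>n. of_nat (n choose k) * ?t k (Suc (n - k)))
      + (\<Sum>k\<le>n. of_nat (n choose k) * ?t (Suc k) (n - k))"
    by (simp add: sum mult algebra_simps sum.distrib)
  also have "(\<Sum>k\<le>n. of_nat (n choose k) * ?t k (Suc (n - k)))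
      = (\<Sum>k\<le>n. of_nat (n choose k) * ?t k (Suc n - k))"
    by (intro sum.cong refl) (simp add: Suc_diff_le)
  also have "\<dots> = (\<Sum>k\<le>Suc n. of_nat (n choose k) * ?t k (Suc n - k))"
    by (simp add: binomial_eq_0)
  also have "\<dots> = ?t 0 (Suc n) + (\<Sum>k\<le>n. of_nat (n choose Suc k) * ?t (Suc k) (n - k))"
    by (subst sum.atMost_Suc_shift) (simp add: binomial_eq_0)
  also have "\<dots> + (\<Sum>k\<le>n. of_nat (n choose k) * ?t (Suc k) (n - k))
      = ?t 0 (Suc n) + (\<Sum>k\<le>n. of_nat (Suc n choose Suc k) * ?t (Suc k) (n - k))"
    by (simp add: sum.distrib algebra_simps)
  also have "\<dots> = (\<Sum>k\<le>Suc n. of_nat (Suc n choose k) * ?t k (Suc n - k))"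
    by (subst sum.atMost_Suc_shift[of _ n]) simp
  finally show ?case by (simp only: mult.assoc)
qed simp

end

subsection \<open>Complex coordinates on the polynomial ring\<close>

lemma const2_0 [simp]: "const2 0 = 0" by (simp add: const2_def)
lemma const2_1 [simp]: "const2 1 = 1" by (simp add: const2_def flip: one_pCons)
lemma const2_add: "const2 (a + b) = const2 a + const2 b" by (simp add: const2_def)
lemma const2_mult: "const2 (a * b) = const2 a * const2 b" by (simp add: const2_def)
lemma const2_minus: "const2 (- a) = - const2 a" by (simp add: const2_def)
lemma const2_diff: "const2 (a - b) = const2 a - const2 b" by (simp add: const2_def)
lemma const2_power: "const2 (a ^ n) = const2 a ^ n"
  by (induction n) (simp_all add: const2_mult)
lemma const2_of_nat: "const2 (of_nat n) = of_nat n"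
  by (induction n) (simp_all add: const2_add)
lemma const2_numeral: "const2 (numeral n) = numeral n"
  using const2_of_nat[of "numeral n"] by simp
lemma const2_eq_0_iff [simp]: "const2 a = 0 \<longleftrightarrow> a = 0"
  by (simp add: const2_def)
lemma const2_sum: "const2 (sum f A) = (\<Sum>i\<in>A. const2 (f i))"
  by (induction A rule: infinite_finite_induct) (simp_all add: const2_add)
lemma const2_prod: "const2 (prod f A) = (\<Prod>i\<in>A. const2 (f i))"
  by (induction A rule: infinite_finite_induct) (simp_all add: const2_mult)

lemma pd1_add: "pd1 (p + q) = pd1 p + pd1 q"
  by (rule poly_eqI) (simp add: coeff_pd1 pderiv_add)

lemma pd1_const2 [simp]: "pd1 (const2 c) = 0"
  by (rule poly_eqI) (simp add: coeff_pd1 const2_def coeff_pCons split: nat.splits)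

lemma pd2_const2 [simp]: "pd2 (const2 c) = 0"
  by (simp add: pd2_def const2_def)

interpretation pd1: derivation pd1
  by unfold_locales (simp_all add: pd1_add pd1_mult)

interpretation pd2: derivation pd2
  by unfold_locales (simp_all add: pd2_def pderiv_add pderiv_mult mult.commute)

lemma pd1_pd2_commute: "pd1 (pd2 f) = pd2 (pd1 f)"
  by (rule poly_eqI)
    (simp add: coeff_pd1 pd2_def coeff_pderiv pderiv_mult pderiv_of_nat del: of_nat_Suc)

lemma pd_X [simp]: "pd1 X1 = 1" "pd1 X2 = 0" "pd2 X1 = 0" "pd2 X2 = 1"
proof -
  show "pd1 X1 = 1"
    by (rule poly_eqI) (simp add: coeff_pd1 X1_def one_pCons coeff_pCons pderiv_pCons split: nat.splits)
  show "pd1 X2 = 0"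
    by (rule poly_eqI) (simp add: coeff_pd1 X2_def coeff_pCons split: nat.splits)
qed (simp_all add: pd2_def X1_def X2_def pderiv_pCons)

definition zc :: poly2 where "zc = X1 + const2 \<i> * X2"
definition zb :: poly2 where "zb = X1 - const2 \<i> * X2"

definition dz :: "poly2 \<Rightarrow> poly2" where
  "dz f = const2 (1/2) * (pd1 f - const2 \<i> * pd2 f)"
definition dzb :: "poly2 \<Rightarrow> poly2" where
  "dzb f = const2 (1/2) * (pd1 f + const2 \<i> * pd2 f)"

interpretation dz: derivation dz
  by unfold_locales (simp_all add: dz_def pd1.add pd2.add pd1.mult pd2.mult algebra_simps)

interpretation dzb: derivation dzb
  by unfold_locales (simp_all add: dzb_def pd1.add pd2.add pd1.mult pd2.mult algebra_simps)

lemma const2_i_i: "const2 \<i> * const2 \<i> = -1" "const2 \<i> * (const2 \<i> * f) = - f"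
  by (simp_all flip: const2_mult mult.assoc add: const2_minus)

lemma const2_half: "const2 (1/2) * 2 = 1" "const2 (1/2) + const2 (1/2) = 1"
  by (simp_all flip: const2_add const2_numeral const2_mult)

lemma dz_const2 [simp]: "dz (const2 c) = 0" "dzb (const2 c) = 0"
  by (simp_all add: dz_def dzb_def)

lemma dz_scale: "dz (const2 c * f) = const2 c * dz f" "dzb (const2 c * f) = const2 c * dzb f"
  by (simp_all add: dz.mult dzb.mult)

lemma dz_z [simp]: "dz zc = 1" "dz zb = 0" "dzb zc = 0" "dzb zb = 1"
  using const2_half
  by (simp_all add: zc_def zb_def dz_def dzb_def pd1.add pd2.add pd1.diff pd2.diff pd1.mult pd2.mult
      const2_i_i)

lemma dz_dzb_commute: "dz (dzb f) = dzb (dz f)"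
  by (simp add: dz_def dzb_def pd1.add pd2.add pd1.diff pd2.diff pd1.mult pd2.mult pd1_pd2_commute
      algebra_simps)

lemma dz_power [simp]: "dz (zc ^ n) = of_nat n * zc ^ (n - 1)" "dz (zb ^ n) = 0"
  "dzb (zb ^ n) = of_nat n * zb ^ (n - 1)" "dzb (zc ^ n) = 0"
  by (simp_all add: dz.power dzb.power)

lemma X1_eq: "X1 = const2 (1/2) * (zc + zb)"
proof -
  have "const2 (1/2) * (zc + zb) = (const2 (1/2) * 2) * X1" by (simp add: zc_def zb_def algebra_simps)
  then show ?thesis by (simp only: const2_half) simp
qed

lemma X2_eq: "X2 = const2 (1/(2*\<i>)) * (zc - zb)"
proof -
  have "const2 (1/(2*\<i>)) * (zc - zb) = (const2 (1/(2*\<i>)) * const2 (2 * \<i>)) * X2"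
    by (simp add: zc_def zb_def algebra_simps const2_mult const2_numeral)
  also have "\<dots> = X2" by (simp flip: const2_mult)
  finally show ?thesis by simp
qed

text \<open>Evaluation at the complex point with \<open>zc = s\<close> and \<open>zb = t\<close>.\<close>

definition evs :: "complex \<Rightarrow> complex \<Rightarrow> poly2 \<Rightarrow> complex" where
  "evs s t f = poly (poly f [:(s - t) / (2 * \<i>):]) ((s + t) / 2)"

lemma evs_simps [simp]:
  "evs s t (f + g) = evs s t f + evs s t g" "evs s t (f - g) = evs s t f - evs s t g"
  "evs s t (f * g) = evs s t f * evs s t g" "evs s t (- f) = - evs s t f"
  "evs s t (const2 c) = c" "evs s t 0 = 0" "evs s t 1 = 1" "evs s t (f ^ n) = evs s t f ^ n"
  by (simp_all add: evs_def const2_def)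

lemma evs_of_nat [simp]: "evs s t (of_nat n) = of_nat n"
  by (metis const2_of_nat evs_simps(5))

lemma evs_numeral [simp]: "evs s t (numeral n) = numeral n"
  by (metis const2_numeral evs_simps(5))

lemma evs_sum: "evs s t (sum f A) = (\<Sum>i\<in>A. evs s t (f i))"
  by (induction A rule: infinite_finite_induct) simp_all

lemma evs_z [simp]: "evs s t zc = s" "evs s t zb = t"
  by (simp_all add: zc_def zb_def) (simp_all add: evs_def X1_def X2_def const2_def field_simps)

subsection \<open>Coefficients with respect to the monomials in complex coordinates\<close>

text \<open>Taylor coefficient at the origin in the coordinates \<open>zc\<close>,
  \<open>zb\<close>. Using derivatives avoids an explicit isomorphism of \<open>poly2\<close> with a
  polynomial ring in these two variables.\<close>

definition cf :: "nat \<Rightarrow> nat \<Rightarrow> poly2 \<Rightarrow> complex" where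
  "cf a b f = evs 0 0 ((dz ^^ a) ((dzb ^^ b) f)) / (fact a * fact b)"

lemma dzb_funpow_dz: "(dzb ^^ b) (dz f) = dz ((dzb ^^ b) f)"
  by (induction b) (simp_all add: dz_dzb_commute)

lemma funpow_scale:
  "(dz ^^ a) (const2 c * f) = const2 c * (dz ^^ a) f"
  "(dzb ^^ a) (const2 c * f) = const2 c * (dzb ^^ a) f"
  by (induction a) (simp_all add: dz_scale)

lemma cf_add: "cf a b (f + g) = cf a b f + cf a b g"
  by (simp add: cf_def dz.funpow_add dzb.funpow_add add_divide_distrib)

lemma cf_0 [simp]: "cf a b 0 = 0"
  by (simp add: cf_def)

lemma cf_scale: "cf a b (const2 c * f) = c * cf a b f"
  by (simp add: cf_def funpow_scale)

lemma cf_minus: "cf a b (- f) = - cf a b f"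
  using cf_scale[of a b "-1" f] by (simp add: const2_minus)

lemma cf_diff: "cf a b (f - g) = cf a b f - cf a b g"
  using cf_add[of a b f "-g"] by (simp add: cf_minus)

lemma cf_sum: "cf a b (sum f A) = (\<Sum>i\<in>A. cf a b (f i))"
  by (induction A rule: infinite_finite_induct) (simp_all add: cf_add)

lemma cf_of_nat: "cf a b (of_nat n * f) = of_nat n * cf a b f"
  using cf_scale[of a b "of_nat n" f] by (simp add: const2_of_nat)

lemma cf_dz: "cf a b (dz f) = of_nat (Suc a) * cf (Suc a) b f"
proof -
  have "(dz ^^ a) ((dzb ^^ b) (dz f)) = (dz ^^ Suc a) ((dzb ^^ b) f)"
    by (simp add: dzb_funpow_dz funpow_swap1)
  then show ?thesis by (simp add: cf_def field_simps del: of_nat_Suc)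
qed

lemma cf_dzb: "cf a b (dzb f) = of_nat (Suc b) * cf a (Suc b) f"
proof -
  have "(dz ^^ a) ((dzb ^^ b) (dzb f)) = (dz ^^ a) ((dzb ^^ Suc b) f)"
    by (simp add: funpow_swap1)
  then show ?thesis by (simp add: cf_def field_simps del: of_nat_Suc)
qed

lemma cf_mono: "cf a b (zc ^ p * zb ^ q) = (if a = p \<and> b = q then 1 else 0)"
proof (induction a arbitrary: p)
  case 0
  show ?case
  proof (induction b arbitrary: q)
    case 0
    show ?case by (auto simp: cf_def power_0_left)
  next
    case (Suc b)
    have "of_nat (Suc b) * cf 0 (Suc b) (zc ^ p * zb ^ q) = cf 0 b (of_nat q * (zc ^ p * zb ^ (q - 1)))"
      by (simp only: cf_dzb[symmetric] dzb.mult) (simp add: algebra_simps)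
    also have "\<dots> = of_nat q * (if 0 = p \<and> b = q - 1 then 1 else 0)"
      by (simp only: cf_of_nat Suc)
    also have "\<dots> = of_nat (Suc b) * (if 0 = p \<and> Suc b = q then 1 else 0)"
      by (cases q) auto
    finally show ?case by (simp only: mult_cancel_left of_nat_eq_0_iff) simp
  qed
next
  case (Suc a)
  have "of_nat (Suc a) * cf (Suc a) b (zc ^ p * zb ^ q) = cf a b (of_nat p * (zc ^ (p - 1) * zb ^ q))"
    by (simp only: cf_dz[symmetric] dz.mult) (simp add: algebra_simps)
  also have "\<dots> = of_nat p * (if a = p - 1 \<and> b = q then 1 else 0)"
    by (simp only: cf_of_nat Suc)
  also have "\<dots> = of_nat (Suc a) * (if Suc a = p \<and> b = q then 1 else 0)"
    by (cases p) auto
  finally show ?case by (simp only: mult_cancel_left of_nat_eq_0_iff) simp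
qed

subsection \<open>Graded pieces\<close>

text \<open>The polynomials of degree \<open>n\<close> on which rotations by \<open>2\<pi>/N\<close> act by the character
  determined by \<open>r\<close>; the degree is an integer, so that the pieces of negative degree vanish.\<close>

definition Sect :: "nat \<Rightarrow> int \<Rightarrow> int \<Rightarrow> poly2 set" where
  "Sect N n r = poly2.span {zc ^ a * zb ^ b | a b. int a + int b = n \<and> int N dvd int b - r}"

abbreviation HP :: "int \<Rightarrow> poly2 set" where "HP n \<equiv> Sect (Suc 0) n 0"

lemma Sect_mono [intro]: "int a + int b = n \<Longrightarrow> int N dvd int b - r \<Longrightarrow> zc ^ a * zb ^ b \<in> Sect N n r"
  unfolding Sect_def by (rule poly2.span_base) auto

lemma Sect_0 [simp]: "0 \<in> Sect N n r"
  unfolding Sect_def by (rule poly2.span_zero)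
lemma Sect_add: "f \<in> Sect N n r \<Longrightarrow> g \<in> Sect N n r \<Longrightarrow> f + g \<in> Sect N n r"
  unfolding Sect_def by (rule poly2.span_add)
lemma Sect_diff: "f \<in> Sect N n r \<Longrightarrow> g \<in> Sect N n r \<Longrightarrow> f - g \<in> Sect N n r"
  unfolding Sect_def by (rule poly2.span_diff)
lemma Sect_scale: "f \<in> Sect N n r \<Longrightarrow> const2 c * f \<in> Sect N n r"
  unfolding Sect_def by (rule poly2.span_scale)
lemma Sect_sum: "(\<And>i. i \<in> A \<Longrightarrow> f i \<in> Sect N n r) \<Longrightarrow> sum f A \<in> Sect N n r"
  unfolding Sect_def by (rule poly2.span_sum)
lemma Sect_of_nat: "f \<in> Sect N n r \<Longrightarrow> of_nat c * f \<in> Sect N n r"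
  by (metis Sect_scale const2_of_nat)
lemma Sect_minus: "f \<in> Sect N n r \<Longrightarrow> - f \<in> Sect N n r"
  using Sect_diff[OF Sect_0] by fastforce

lemma Sect_induct [consumes 1, case_names zero add mono]:
  assumes "f \<in> Sect N n r" and "Q 0"
    and "\<And>c f g. Q f \<Longrightarrow> Q g \<Longrightarrow> Q (const2 c * f + g)"
    and "\<And>a b. int a + int b = n \<Longrightarrow> int N dvd int b - r \<Longrightarrow> Q (zc ^ a * zb ^ b)"
  shows "Q f"
  using assms(1) unfolding Sect_def
  by (induction rule: poly2.span_induct_alt) (use assms in auto)

lemma Sect_cong:
  assumes "int N dvd r - r'" "f \<in> Sect N n r"
  shows "f \<in> Sect N n r'"
  using assms(2)
proof (induction rule: Sect_induct)
  case (mono a b)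
  have "int b - r' = (int b - r) + (r - r')" by simp
  with mono assms(1) show ?case by (metis Sect_mono dvd_add)
qed (auto intro: Sect_add Sect_scale)

lemma Sect_HP: "f \<in> Sect N n r \<Longrightarrow> f \<in> HP n"
  by (induction rule: Sect_induct) (auto intro: Sect_add Sect_scale)

lemma Sect_mult:
  assumes "f \<in> Sect N n r" "g \<in> Sect N k s"
  shows "f * g \<in> Sect N (n + k) (r + s)"
  using assms(1)
proof (induction rule: Sect_induct)
  case (add c f f')
  then have "const2 c * (f * g) + f' * g \<in> Sect N (n + k) (r + s)" by (intro Sect_add Sect_scale)
  then show ?case by (simp add: algebra_simps)
next
  case (mono a b)
  show ?case using assms(2)
  proof (induction rule: Sect_induct)
    case (add c f f')
    then have "const2 c * ((zc ^ a * zb ^ b) * f) + (zc ^ a * zb ^ b) * f' \<in> Sect N (n + k) (r + s)"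
      by (intro Sect_add Sect_scale)
    then show ?case by (simp add: algebra_simps)
  next
    case mono2: (mono a' b')
    have "zc ^ (a + a') * zb ^ (b + b') \<in> Sect N (n + k) (r + s)"
    proof (rule Sect_mono)
      show "int (a + a') + int (b + b') = n + k" using mono mono2 by simp
      have "int (b + b') - (r + s) = (int b - r) + (int b' - s)" by simp
      with mono mono2 show "int N dvd int (b + b') - (r + s)" by (metis dvd_add)
    qed
    then show ?case by (simp add: power_add algebra_simps)
  qed simp
qed simp

lemma Sect_z: "zc \<in> Sect N 1 0" "zb \<in> Sect N 1 1" "1 \<in> Sect N 0 0" "const2 c \<in> Sect N 0 0"
  using Sect_mono[of 1 0 1 N 0] Sect_mono[of 0 1 1 N 1] Sect_mono[of 0 0 0 N 0]
    Sect_scale[OF Sect_mono[of 0 0 0 N 0], of c] by simp_all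

lemma HP_mult: "f \<in> HP n \<Longrightarrow> g \<in> HP k \<Longrightarrow> f * g \<in> HP (n + k)"
  using Sect_mult[of f 1 n 0 g k 0] by simp

lemma Sect_power: "f \<in> Sect N n r \<Longrightarrow> f ^ k \<in> Sect N (int k * n) (int k * r)"
proof (induction k)
  case (Suc k)
  then have "f * f ^ k \<in> Sect N (n + int k * n) (r + int k * r)" by (intro Sect_mult) auto
  then show ?case by (simp add: algebra_simps)
qed (simp add: Sect_z)

lemma Sect_expand:
  assumes "f \<in> Sect N n r"
  shows "f = (\<Sum>b | int b \<le> n \<and> int N dvd int b - r.
    const2 (cf (nat (n - int b)) b f) * (zc ^ nat (n - int b) * zb ^ b))"
proof -
  let ?B = "{b. int b \<le> n \<and> int N dvd int b - r}"
  have fin: "finite ?B" by (rule finite_subset[of _ "{..nat n}"]) auto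
  show ?thesis using assms
  proof (induction rule: Sect_induct)
    case (add c f g)
    let ?S = "\<lambda>f. \<Sum>b\<in>?B. const2 (cf (nat (n - int b)) b f) * (zc ^ nat (n - int b) * zb ^ b)"
    have "?S (const2 c * f + g) = const2 c * ?S f + ?S g"
      unfolding cf_add cf_scale const2_add const2_mult sum_distrib_left distrib_right sum.distrib
        mult.assoc ..
    with add show ?case by simp
  next
    case (mono p q)
    have "(\<Sum>b\<in>?B. const2 (cf (nat (n - int b)) b (zc ^ p * zb ^ q)) * (zc ^ nat (n - int b) * zb ^ b))
        = (\<Sum>b\<in>?B. if b = q then zc ^ p * zb ^ q else 0)"
      using mono by (intro sum.cong refl) (auto simp: cf_mono)
    also have "\<dots> = zc ^ p * zb ^ q" using mono fin by (subst sum.delta) auto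
    finally show ?case by simp
  qed simp
qed

lemma Sect_cf: "f \<in> Sect N n r \<Longrightarrow> cf a b f \<noteq> 0 \<Longrightarrow> int a + int b = n \<and> int N dvd int b - r"
proof (induction rule: Sect_induct)
  case (add c f g)
  then have "cf a b f \<noteq> 0 \<or> cf a b g \<noteq> 0" by (auto simp: cf_add cf_scale)
  with add show ?case by blast
qed (auto simp: cf_mono split: if_splits)

lemma Sect_eqI:
  assumes "f \<in> Sect N n r" and "\<And>a b. cf a b f = 0"
  shows "f = 0"
  by (subst Sect_expand[OF assms(1)]) (simp add: assms(2))

lemma hom_part_HP: "hom_part k f \<in> HP (int k)"
proof -
  have X: "X1 \<in> HP 1" "X2 \<in> HP 1"
    unfolding X1_eq X2_eq
    by (intro Sect_scale Sect_add Sect_diff Sect_z Sect_HP[OF Sect_z(2)])+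
  have "const2 c * X1 ^ (k - j) * X2 ^ j \<in> HP (int k)" if "j \<le> k" for c j
    using HP_mult[OF Sect_power[OF X(1), of "k - j", simplified] Sect_power[OF X(2), of j, simplified]] that
    by (auto simp: mult.assoc of_nat_diff intro!: Sect_scale)
  then show ?thesis unfolding hom_part_def by (intro Sect_sum) auto
qed

lemma cf_hom_part: "cf a b (hom_part k f) = (if k = a + b then cf a b f else 0)"
proof -
  have *: "cf a b (hom_part j f) = 0" if "j \<noteq> a + b" for j
    using Sect_cf[OF hom_part_HP[of j f], of a b] that by auto
  have "cf a b f = cf a b (\<Sum>d | hom_part d f \<noteq> 0. hom_part d f)"
    by (simp add: sum_hom_parts)
  also have "\<dots> = (\<Sum>d | hom_part d f \<noteq> 0. if d = a + b then cf a b (hom_part d f) else 0)"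
    unfolding cf_sum by (intro sum.cong refl) (simp add: *)
  also have "\<dots> = cf a b (hom_part (a + b) f)"
    using finite_hom_parts[of f] by (subst sum.delta) auto
  finally show ?thesis using * by auto
qed

lemma cf_eqI:
  assumes "\<And>a b. cf a b f = cf a b g"
  shows "f = g"
proof -
  have "hom_part k (f - g) = 0" for k
    using hom_part_HP by (rule Sect_eqI) (simp add: cf_hom_part cf_diff assms)
  then have "f - g = 0" by (subst sum_hom_parts[of "f - g", symmetric]) simp
  then show ?thesis by simp
qed

lemma Sect_iff:
  assumes "\<And>a b. cf a b f \<noteq> 0 \<Longrightarrow> int a + int b = n \<and> int N dvd int b - r"
  shows "f \<in> Sect N n r"
proof (cases "n < 0")
  case True
  then have "f = 0" using assms by (intro cf_eqI) fastforce
  then show ?thesis by simp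
next
  case False
  then have n: "n = int (nat n)" by simp
  have "hom_part (nat n) f = f"
    using assms False by (intro cf_eqI) (fastforce simp: cf_hom_part)
  then have "f \<in> HP n" using hom_part_HP[of "nat n" f] n by simp
  then have f: "f = (\<Sum>b | int b \<le> n \<and> int (Suc 0) dvd int b - 0.
    const2 (cf (nat (n - int b)) b f) * (zc ^ nat (n - int b) * zb ^ b))"
    by (rule Sect_expand)
  show ?thesis
  proof (subst f, rule Sect_sum)
    fix b assume "b \<in> {b. int b \<le> n \<and> int (Suc 0) dvd int b - 0}"
    then show "const2 (cf (nat (n - int b)) b f) * (zc ^ nat (n - int b) * zb ^ b) \<in> Sect N n r"
      using assms[of "nat (n - int b)" b] by (cases "cf (nat (n - int b)) b f = 0") (auto intro!: Sect_scale)
  qed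
qed

lemma hom_part_eq: "f \<in> HP (int n) \<Longrightarrow> hom_part k f = (if k = n then f else 0)"
  by (rule cf_eqI) (use Sect_cf in \<open>fastforce simp: cf_hom_part\<close>)

lemma cf_sum_distinct_deg:
  assumes "finite A" and "\<And>k. k \<in> A \<Longrightarrow> f k \<in> HP (int k + c)" and "(\<Sum>k\<in>A. f k) = 0" and "j \<in> A"
  shows "f j = 0"
proof (rule cf_eqI)
  fix a b
  show "cf a b (f j) = cf a b 0"
  proof (rule ccontr)
    assume nz: "cf a b (f j) \<noteq> cf a b 0"
    then have ab: "int a + int b = int j + c" using Sect_cf[OF assms(2)[OF assms(4)]] by simp
    have "0 = (\<Sum>k\<in>A. cf a b (f k))" using assms(3) by (metis cf_0 cf_sum)
    also have "\<dots> = (\<Sum>k\<in>A. if k = j then cf a b (f j) else 0)"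
      using Sect_cf[OF assms(2)] ab by (intro sum.cong) fastforce+
    also have "\<dots> = cf a b (f j)" using assms by simp
    finally show False using nz by simp
  qed
qed


subsection \<open>Derivations of the field of rational functions\<close>

lemma fract_deriv_to_fract:
  assumes "derivation D"
  shows "fract_deriv D (to_fract p) = to_fract (D p)"
proof -
  interpret derivation D by fact
  show ?thesis using fract_deriv_Fract[of D 1 p] mult
    by (simp add: to_fract_def mult.commute)
qed

lemma derivation_fract_deriv:
  fixes D :: "'a::idom \<Rightarrow> 'a"
  assumes "derivation D"
  shows "derivation (fract_deriv D)"
proof -
  interpret derivation D by fact
  have DF: "b \<noteq> 0 \<Longrightarrow> fract_deriv D (Fract a b) = Fract (D a * b - a * D b) (b * b)" for a b
    by (rule fract_deriv_Fract) (rule mult)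
  show ?thesis
  proof
    fix x y :: "'a fract"
    obtain a b where x: "x = Fract a b" "b \<noteq> 0" by (cases x)
    obtain c d where y: "y = Fract c d" "d \<noteq> 0" by (cases y)
    show "fract_deriv D (x + y) = fract_deriv D x + fract_deriv D y"
      using x y by (simp add: DF eq_fract add mult algebra_simps)
    show "fract_deriv D (x * y) = x * fract_deriv D y + fract_deriv D x * y"
      using x y by (simp add: DF eq_fract mult algebra_simps)
  qed
qed

lemma derivation_divide:
  fixes D :: "'a::field \<Rightarrow> 'a"
  assumes "derivation D" "y \<noteq> 0"
  shows "D (x / y) = (D x * y - x * D y) / (y * y)"
proof -
  interpret derivation D by fact
  have "D (x / y * y) = (x / y) * D y + D (x / y) * y" by (rule mult)
  then have "D x = x / y * D y + D (x / y) * y" using assms by simp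
  then show ?thesis using assms(2) by (simp add: field_simps)
qed

lemma derivation_commutator:
  assumes "derivation D" "derivation E"
  shows "derivation (\<lambda>x. D (E x) - E (D x))"
proof -
  interpret D: derivation D by fact
  interpret E: derivation E by fact
  show ?thesis by unfold_locales (simp_all add: D.add E.add D.mult E.mult algebra_simps)
qed

lemma derivation_fract_eq_0:
  fixes D :: "'a::idom fract \<Rightarrow> 'a fract"
  assumes "derivation D" "\<And>p. D (to_fract p) = 0"
  shows "D x = 0"
proof (cases x)
  case (Fract a b)
  then show ?thesis
    using derivation_divide[OF assms(1), of "to_fract b" "to_fract a"] assms(2)
    by (simp add: Fract_conv_to_fract)
qed

interpretation dx1: derivation dx1
  unfolding dx1_def by (rule derivation_fract_deriv) unfold_locales

interpretation dx2: derivation dx2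
  unfolding dx2_def by (rule derivation_fract_deriv) unfold_locales

lemma dx_to_fract [simp]: "dx1 (to_fract p) = to_fract (pd1 p)" "dx2 (to_fract p) = to_fract (pd2 p)"
  unfolding dx1_def dx2_def by (rule fract_deriv_to_fract, unfold_locales)+

abbreviation K :: "complex \<Rightarrow> rat2" where "K c \<equiv> to_fract (const2 c)"

definition Dz :: rat_op where "Dz f = K (1/2) * (dx1 f - K \<i> * dx2 f)"
definition Dzb :: rat_op where "Dzb f = K (1/2) * (dx1 f + K \<i> * dx2 f)"

lemma Dz_to_fract [simp]: "Dz (to_fract p) = to_fract (dz p)" "Dzb (to_fract p) = to_fract (dzb p)"
  by (simp_all add: Dz_def Dzb_def dz_def dzb_def)

interpretation Dz: derivation Dz
  by unfold_locales (simp_all add: Dz_def dx1.add dx2.add dx1.mult dx2.mult algebra_simps)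

interpretation Dzb: derivation Dzb
  by unfold_locales (simp_all add: Dzb_def dx1.add dx2.add dx1.mult dx2.mult algebra_simps)

text \<open>The commutator of two derivations is a derivation, and a derivation that kills
  polynomials kills their quotients.\<close>

lemma Dz_Dzb_commute: "Dz (Dzb f) = Dzb (Dz f)"
proof -
  have "(\<lambda>f. Dz (Dzb f) - Dzb (Dz f)) f = 0"
    by (rule derivation_fract_eq_0, rule derivation_commutator, unfold_locales)
      (simp add: dz_dzb_commute)
  then show ?thesis by simp
qed

lemma K_simps: "K (a + b) = K a + K b" "K (a * b) = K a * K b" "K (a - b) = K a - K b" "K (- a) = - K a"
  "K 0 = 0" "K 1 = 1" "K (a ^ n) = K a ^ n"
  by (simp_all add: const2_add const2_mult const2_diff const2_minus const2_power)
     (induction n, simp_all)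

lemma to_fract_power [simp]: "to_fract (x ^ n) = to_fract x ^ n"
  by (induction n) simp_all

lemma to_fract_of_nat [simp]: "to_fract (of_nat n) = of_nat n"
  by (induction n) simp_all

lemma to_fract_numeral [simp]: "to_fract (numeral n) = numeral n"
  by (metis of_nat_numeral to_fract_of_nat)

lemma K_nat: "K (of_nat n) = of_nat n" "K (numeral k) = numeral k"
  by (simp_all add: const2_of_nat const2_numeral)

lemma K_sum: "K (sum f A) = (\<Sum>i\<in>A. K (f i))"
  by (simp add: const2_sum)

lemma K_i_i: "K \<i> * (K \<i> * x) = - x"
proof -
  have "K \<i> * K \<i> = -1" by (metis const2_i_i(1) to_fract_mult to_fract_uminus to_fract_1)
  then show ?thesis by (simp flip: mult.assoc)
qed

lemma dx_eq: "dx1 f = Dz f + Dzb f" "dx2 f = K \<i> * (Dz f - Dzb f)"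
proof -
  have h: "K (1/2) * x + K (1/2) * x = x" for x
    using K_simps(1)[of "1/2" "1/2"] by (simp add: flip: distrib_right)
  have "Dz f + Dzb f = K (1/2) * dx1 f + K (1/2) * dx1 f"
    by (simp add: Dz_def Dzb_def algebra_simps)
  then show "dx1 f = Dz f + Dzb f" by (simp only: h)
  have "K \<i> * (Dz f - Dzb f) = - (K (1/2) * (K \<i> * (K \<i> * dx2 f)) + K (1/2) * (K \<i> * (K \<i> * dx2 f)))"
    by (simp add: Dz_def Dzb_def algebra_simps)
  then show "dx2 f = K \<i> * (Dz f - Dzb f)" by (simp only: h K_i_i) simp
qed

lemma laplace_eq: "dx1 (dx1 f) + dx2 (dx2 f) = 4 * Dz (Dzb f)"
proof -
  have Kc: "Dz (K c * g) = K c * Dz g" "Dzb (K c * g) = K c * Dzb g" for c g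
    by (simp_all add: Dz.mult Dzb.mult)
  have "dx2 (dx2 f) = K \<i> * (K \<i> * (Dz (Dz f - Dzb f) - Dzb (Dz f - Dzb f)))"
    by (simp only: dx_eq(2) Kc) (simp only: right_diff_distrib)
  then show ?thesis
    by (simp only: K_i_i dx_eq(1)) (simp add: Dz.add Dzb.add Dz.diff Dzb.diff Dz_Dzb_commute)
qed

subsection \<open>The operator \<open>\<L>\<close> in complex coordinates\<close>

lemma const2_eq_iff: "const2 a = const2 b \<longleftrightarrow> a = b"
  by (simp add: const2_def)

definition PP :: "nat \<Rightarrow> poly2" where "PP N = zc ^ N - zb ^ N"
definition QQ :: "nat \<Rightarrow> poly2" where "QQ N = zc ^ N + zb ^ N"

abbreviation Z :: rat2 where "Z \<equiv> to_fract zc"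
abbreviation B :: rat2 where "B \<equiv> to_fract zb"

lemma z_nz [simp]: "zc \<noteq> 0" "zb \<noteq> 0"
  using evs_z[of 1 1] by (auto simp del: evs_z)

lemma PP_nz [simp]: "N > 0 \<Longrightarrow> PP N \<noteq> 0"
proof
  assume "N > 0" "PP N = 0"
  then have "evs 1 0 (PP N) = 0" by simp
  with \<open>N > 0\<close> show False by (simp add: PP_def power_0_left)
qed

definition rt :: "nat \<Rightarrow> nat \<Rightarrow> complex" where "rt N j = cis (2 * pi * real j / real N)"

lemma rt_power: "rt N j ^ k = rt N (j * k)"
  unfolding rt_def Complex.DeMoivre by (simp add: field_simps)

lemma rt_N: "N > 0 \<Longrightarrow> rt N j ^ N = 1"
  using cis_multiple_2pi[of "real j"] unfolding rt_power by (simp add: rt_def mult_ac)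

lemma inj_rt: "N > 0 \<Longrightarrow> inj_on (rt N) {..<N}"
  using bij_betw_imp_inj_on[OF Complex.bij_betw_roots_unity[of N]] unfolding rt_def .

lemma sum_rt_power:
  assumes "N > 0" "k < N"
  shows "(\<Sum>j<N. rt N j ^ k) = (if k = 0 then of_nat N else 0)"
proof (cases "k = 0")
  case False
  have "rt N k \<noteq> rt N 0" using inj_rt[OF assms(1)] assms False by (auto dest: inj_onD)
  then have "rt N k \<noteq> 1" by (simp add: rt_def)
  moreover have "(\<Sum>j<N. rt N j ^ k) = (\<Sum>j<N. rt N k ^ j)"
    by (simp add: rt_power mult.commute)
  ultimately show ?thesis
    using rt_N[OF assms(1), of k] False by (simp add: sum_gp_strict)
qed simp

text \<open>For e = 0 this is the logarithmic derivative of P = \<Prod>(z - \<zeta> zb) in z, for e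
  = 1 minus the one in zb. Writing each summand over the common denominator P leaves geometric sums,
  and orthogonality of the N-th roots of unity retains one monomial.\<close>

lemma sum_inverse_linear:
  assumes "N > 0" "e \<le> 1"
  shows "(\<Sum>j<N. K (rt N j) ^ e / (Z - K (rt N j) * B))
    = (if e = 0 then of_nat N * Z ^ (N - 1) else of_nat N * B ^ (N - 1)) / to_fract (PP N)"
proof -
  define P where "P = to_fract (PP N)"
  have P: "P \<noteq> 0" using assms by (simp add: P_def)
  have P': "P = Z ^ N - B ^ N" by (simp add: P_def PP_def)
  have fac: "P = (Z - K (rt N j) * B) * (\<Sum>i<N. Z ^ i * (K (rt N j) * B) ^ (N - 1 - i))" for j
  proof -
    obtain n where n: "N = Suc n" using assms by (cases N) auto
    have "K (rt N j) ^ N = 1" using rt_N[OF assms(1), of j] by (metis K_simps(6,7))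
    then have "P = Z ^ N - (K (rt N j) * B) ^ N" by (simp add: P' power_mult_distrib)
    then show ?thesis unfolding n diff_power_eq_sum by simp
  qed
  have "(\<Sum>j<N. K (rt N j) ^ e / (Z - K (rt N j) * B))
      = (\<Sum>j<N. (\<Sum>i<N. K (rt N j) ^ (e + (N - 1 - i)) * (Z ^ i * B ^ (N - 1 - i))) / P)"
  proof (rule sum.cong[OF refl])
    fix j
    have nz: "Z - K (rt N j) * B \<noteq> 0" using fac[of j] P by auto
    have "K (rt N j) ^ e / (Z - K (rt N j) * B)
        = K (rt N j) ^ e * (\<Sum>i<N. Z ^ i * (K (rt N j) * B) ^ (N - 1 - i)) / P"
      by (subst fac[of j]) (use nz P fac[of j] in \<open>auto simp: field_simps\<close>)
    then show "K (rt N j) ^ e / (Z - K (rt N j) * B)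
        = (\<Sum>i<N. K (rt N j) ^ (e + (N - 1 - i)) * (Z ^ i * B ^ (N - 1 - i))) / P"
      by (simp only: sum_distrib_left power_mult_distrib power_add mult_ac)
  qed
  also have "\<dots> = (\<Sum>i<N. K (\<Sum>j<N. rt N j ^ (e + (N - 1 - i))) * (Z ^ i * B ^ (N - 1 - i))) / P"
    unfolding K_sum K_simps sum_distrib_right sum_divide_distrib
    by (subst sum.swap) simp
  also have "(\<Sum>i<N. K (\<Sum>j<N. rt N j ^ (e + (N - 1 - i))) * (Z ^ i * B ^ (N - 1 - i)))
      = (\<Sum>i<N. if i = (if e = 0 then N - 1 else 0) then of_nat N * (Z ^ i * B ^ (N - 1 - i)) else 0)"
  proof (rule sum.cong[OF refl])
    fix i assume i: "i \<in> {..<N}"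
    consider "e = 0" | "e = 1" "i = 0" | "e = 1" "i > 0" using assms by linarith
    then show "K (\<Sum>j<N. rt N j ^ (e + (N - 1 - i))) * (Z ^ i * B ^ (N - 1 - i))
        = (if i = (if e = 0 then N - 1 else 0) then of_nat N * (Z ^ i * B ^ (N - 1 - i)) else 0)"
    proof cases
      case 1 then show ?thesis using i by (auto simp: sum_rt_power[OF assms(1)] K_nat)
    next
      case 2
      \<comment> \<open>The exponent N lies outside the range of \<open>sum_rt_power\<close>, but
        every N-th power is 1, so this monomial survives too.\<close>
      then have "e + (N - 1 - i) = N" using assms by simp
      then show ?thesis using 2 by (simp only: rt_N[OF assms(1)]) (simp add: K_nat)
    next
      case 3
      then have "e + (N - 1 - i) = N - i" using i by simp
      then show ?thesis using 3 i by (simp only:) (simp add: sum_rt_power[OF assms(1)])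
    qed
  qed
  also have "\<dots> = (if e = 0 then of_nat N * Z ^ (N - 1) else of_nat N * B ^ (N - 1))"
    using assms by (subst sum.delta) auto
  finally show ?thesis by (simp add: P_def)
qed

lemma inj_alpha: "N > 0 \<Longrightarrow> inj_on (alpha N) {..<N}"
proof
  fix x y assume N: "N > 0" and xy: "x \<in> {..<N}" "y \<in> {..<N}" "alpha N x = alpha N y"
  have "pi * real x / real N = pi * real y / real N"
    by (rule cos_inj_pi) (use N xy in \<open>auto simp: alpha_def field_simps\<close>)
  then show "x = y" using N by simp
qed

text \<open>With \<theta> = \<pi> j/N the form (\<alpha>^j, x) is the imaginary part of
  e^(-i\<theta>) z; \<open>rc N j\<close> is the coefficient of \<open>zc\<close> in it.\<close>

definition rc :: "nat \<Rightarrow> nat \<Rightarrow> complex" where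
  "rc N j = cis (- (pi * real j / real N)) / (2 * \<i>)"

lemma rc_nz [simp]: "rc N j \<noteq> 0" by (simp add: rc_def)

lemma rc_rt: "rc N j * rt N j = cis (pi * real j / real N) / (2 * \<i>)"
proof -
  have "cis (- (pi * real j / real N)) * rt N j = cis (pi * real j / real N)"
    by (simp add: rt_def cis_mult algebra_simps)
  then show ?thesis by (simp add: rc_def)
qed

lemma alpha_rc:
  "complex_of_real (fst (alpha N j)) = rc N j - rc N j * rt N j"
  "complex_of_real (snd (alpha N j)) = \<i> * (rc N j + rc N j * rt N j)"
  unfolding rc_rt by (auto simp: rc_def alpha_def complex_eq_iff cis.code)

lemma lin_form_eq: "lin_form (alpha N j) = const2 (rc N j) * (zc - const2 (rt N j) * zb)"
proof -
  have "const2 (rc N j) * (zc - const2 (rt N j) * zb)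
     = const2 (rc N j - rc N j * rt N j) * X1 + const2 (\<i> * (rc N j + rc N j * rt N j)) * X2"
    unfolding zc_def zb_def by (simp add: const2_add const2_diff const2_mult algebra_simps)
  then show ?thesis unfolding lin_form_def alpha_rc by simp
qed

lemma dir_dx_eq:
  "dir_dx (alpha N j) f = -2 * K (rc N j) * (K (rt N j) * Dz f - Dzb f)"
proof -
  let ?r = "rc N j" let ?e = "rt N j"
  have "dir_dx (alpha N j) f = K (?r - ?r * ?e) * (Dz f + Dzb f) + K (\<i> * (?r + ?r * ?e) * \<i>) * (Dz f - Dzb f)"
    unfolding dir_dx_def alpha_rc dx_eq by (simp add: const2_mult mult.assoc)
  also have "\<i> * (?r + ?r * ?e) * \<i> = - (?r + ?r * ?e)" by (simp add: algebra_simps)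
  finally show ?thesis
    by (simp only: K_simps) (simp add: algebra_simps)
qed

theorem calL_eq:
  assumes "N > 0"
  shows "calL N m f = 4 * Dz (Dzb f) + 4 * of_nat (m * N) *
    (B ^ (N - 1) * Dz f - Z ^ (N - 1) * Dzb f) / to_fract (PP N)"
proof -
  have "(\<Sum>\<alpha>\<in>roots N. (1 / to_fract (lin_form \<alpha>)) * dir_dx \<alpha> f)
      = (\<Sum>j<N. (1 / to_fract (lin_form (alpha N j))) * dir_dx (alpha N j) f)"
    unfolding roots_def using inj_alpha[OF assms] by (simp add: sum.reindex)
  also have "\<dots> = (\<Sum>j<N. -2 * (Dz f * (K (rt N j) ^ 1 / (Z - K (rt N j) * B))
      - Dzb f * (K (rt N j) ^ 0 / (Z - K (rt N j) * B))))"
  proof (rule sum.cong[OF refl])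
    fix j
    have *: "(1 / (a * b)) * (- 2 * a * (k * x - y)) = -2 * (x * (k / b) - y * (1 / b))"
      if "a \<noteq> 0" for a b k x y :: rat2
      using that by (cases "b = 0") (simp_all add: field_simps)
    have "K (rc N j) \<noteq> 0" by simp
    then show "(1 / to_fract (lin_form (alpha N j))) * dir_dx (alpha N j) f
      = -2 * (Dz f * (K (rt N j) ^ 1 / (Z - K (rt N j) * B))
      - Dzb f * (K (rt N j) ^ 0 / (Z - K (rt N j) * B)))"
      unfolding lin_form_eq dir_dx_eq using *[of "K (rc N j)"] by simp
  qed
  also have "\<dots> = -2 * (Dz f * (of_nat N * B ^ (N - 1) / to_fract (PP N))
      - Dzb f * (of_nat N * Z ^ (N - 1) / to_fract (PP N)))"
    unfolding sum_distrib_left[symmetric] sum_subtractf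
    using sum_inverse_linear[OF assms, of 1] sum_inverse_linear[OF assms, of 0] by simp
  finally have *: "(\<Sum>\<alpha>\<in>roots N. (1 / to_fract (lin_form \<alpha>)) * dir_dx \<alpha> f) = \<dots>" .
  show ?thesis
    unfolding calL_def laplace_eq * by (simp add: algebra_simps diff_divide_distrib)
qed

text \<open>Replace \<open>zc\<close> by a free variable over \<open>poly2\<close>. Both sides
  become monic of degree N, so their difference has smaller degree, yet it vanishes at the N
  distinct points \<zeta> zb.\<close>

lemma prod_linear:
  assumes "N > 0"
  shows "(\<Prod>j<N. zc - const2 (rt N j) * zb) = PP N"
proof -
  define F where "F = (\<Prod>j<N. [:- (const2 (rt N j) * zb), 1:])"
  define G where "G = monom 1 N + [:- (zb ^ N):]"
  have dF: "degree F = N" unfolding F_def by (subst degree_prod_eq_sum_degree) auto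
  have lF: "coeff F N = 1" using lead_coeff_prod[of "\<lambda>j. [:- (const2 (rt N j) * zb), 1:]" "{..<N}"]
    by (simp add: dF flip: F_def)
  have dG: "degree G \<le> N" unfolding G_def by (rule degree_add_le) (auto simp: degree_monom_le)
  have lG: "coeff G N = 1" using assms by (cases N) (auto simp: G_def)
  have "F - G = 0"
  proof (rule ccontr)
    assume nz: "F - G \<noteq> 0"
    have "degree (F - G) \<le> N" using dF dG by (intro degree_diff_le) auto
    moreover have "degree (F - G) \<noteq> N"
    proof
      assume "degree (F - G) = N"
      moreover have "coeff (F - G) N = 0" using lF lG by simp
      ultimately show False using nz by (metis leading_coeff_0_iff)
    qed
    ultimately have lt: "degree (F - G) < N" by simp
    have "(\<lambda>j. const2 (rt N j) * zb) ` {..<N} \<subseteq> {x. poly (F - G) x = 0}"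
    proof
      fix x assume "x \<in> (\<lambda>j. const2 (rt N j) * zb) ` {..<N}"
      then obtain j where j: "j < N" "x = const2 (rt N j) * zb" by auto
      have "poly F x = 0" unfolding F_def poly_prod using j by (auto intro!: bexI[of _ j])
      moreover have "poly G x = 0" using j rt_N[OF assms, of j]
        by (simp add: G_def poly_monom power_mult_distrib flip: const2_power)
      ultimately show "x \<in> {x. poly (F - G) x = 0}" by simp
    qed
    moreover have "inj_on (\<lambda>j. const2 (rt N j) * zb) {..<N}"
      using inj_rt[OF assms] by (auto simp: inj_on_def const2_eq_iff)
    ultimately have "N \<le> card {x. poly (F - G) x = 0}"
      by (metis card_image card_lessThan card_mono nz poly_roots_finite)
    also have "\<dots> \<le> degree (F - G)" using nz by (rule card_poly_roots_bound)
    finally show False using lt by simp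
  qed
  then have "poly F zc = poly G zc" by simp
  then show ?thesis by (simp add: F_def G_def poly_prod poly_monom PP_def algebra_simps)
qed

lemma w_poly_eq:
  assumes "N > 0"
  obtains c where "c \<noteq> 0" "w_poly N m = const2 c * PP N ^ (2 * m + 1)"
proof
  let ?c = "(\<Prod>j<N. rc N j) ^ (2 * m + 1)"
  show "?c \<noteq> 0" by simp
  have "w_poly N m = (\<Prod>j<N. lin_form (alpha N j)) ^ (2 * m + 1)"
    unfolding w_poly_def roots_def
    by (simp only: prod.reindex[OF inj_alpha[OF assms]] comp_def prod_power_distrib)
  also have "(\<Prod>j<N. lin_form (alpha N j)) = const2 (\<Prod>j<N. rc N j) * PP N"
    unfolding lin_form_eq prod.distrib prod_linear[OF assms] const2_prod ..
  finally show "w_poly N m = const2 ?c * PP N ^ (2 * m + 1)"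
    by (simp only: power_mult_distrib const2_power)
qed


lemma rat2_nz [simp]: "(numeral k :: rat2) \<noteq> 0" "of_nat n = (0 :: rat2) \<longleftrightarrow> n = 0"
  using to_fract_numeral[of k, where 'a = "complex poly poly"]
    to_fract_of_nat[of n, where 'a = "complex poly poly"]
  by (metis to_fract_eq_0_iff zero_neq_numeral, metis to_fract_eq_0_iff of_nat_eq_0_iff)

subsection \<open>Basic identities for \<open>\<L>\<close>\<close>

lemma calL_add: "calL N m (f + g) = calL N m f + calL N m g"
  unfolding calL_def dir_dx_def
  by (simp add: dx1.add dx2.add distrib_left sum.distrib add_divide_distrib)

lemma calL_scale: "calL N m (K c * f) = K c * calL N m f"
proof -
  have K: "dx1 (K c * f) = K c * dx1 f" "dx2 (K c * f) = K c * dx2 f" for f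
    by (simp_all add: dx1.mult dx2.mult)
  show ?thesis
    unfolding calL_def dir_dx_def K
    by (simp add: sum_distrib_left algebra_simps)
qed

lemma calL_0 [simp]: "calL N m 0 = 0"
  using calL_scale[of N m 0 0] by simp

lemma calL_pow_add: "(calL N m ^^ k) (f + g) = (calL N m ^^ k) f + (calL N m ^^ k) g"
  by (induction k) (simp_all add: calL_add)

lemma calL_pow_scale: "(calL N m ^^ k) (K c * f) = K c * (calL N m ^^ k) f"
  by (induction k) (simp_all add: calL_scale)

lemma calL_pow_0 [simp]: "(calL N m ^^ k) 0 = 0"
  by (induction k) simp_all

lemma calL_pow_sum: "(calL N m ^^ k) (sum f A) = (\<Sum>i\<in>A. (calL N m ^^ k) (f i))"
  by (induction A rule: infinite_finite_induct) (simp_all add: calL_pow_add)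

lemma ad_funpow_0: "(ad (calL N m) ^^ d) (mult_op q) 0 = 0"
proof (induction d)
  case (Suc d) then show ?case by (simp add: ad_def)
qed (simp add: mult_op_def)

text \<open>In each commutator the second term is an operator applied to
  \<open>calL N m f = 0\<close>. Elements of \<open>rat_op\<close> are arbitrary functions, so that
  its value is 0 has to come from \<open>ad_funpow_0\<close>.\<close>

lemma ad_funpow_kernel:
  assumes "calL N m f = 0"
  shows "(ad (calL N m) ^^ d) (mult_op q) f = (calL N m ^^ d) (to_fract q * f)"
proof (induction d)
  case (Suc d)
  have "(ad (calL N m) ^^ Suc d) (mult_op q) f
      = calL N m ((ad (calL N m) ^^ d) (mult_op q) f) - (ad (calL N m) ^^ d) (mult_op q) (calL N m f)"
    by (simp add: ad_def)
  then show ?case by (simp add: Suc assms ad_funpow_0)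
qed (simp add: mult_op_def)

lemma ad_funpow_mult_0: "(ad (calL N m) ^^ d) (mult_op 0) f = 0"
proof (induction d arbitrary: f)
  case (Suc d) then show ?case by (simp add: ad_def)
qed (simp add: mult_op_def)

lemma chi_hom:
  assumes "q \<in> HP (int d)"
  shows "chi N m q f = K (1 / (2 ^ d * fact d)) * ((ad (calL N m) ^^ d) (mult_op q) f)"
proof (cases "q = 0")
  case True
  then show ?thesis unfolding chi_def using hom_part_eq[OF assms] by (simp add: ad_funpow_mult_0)
next
  case False
  then have "{k. hom_part k q \<noteq> 0} = {d}" using hom_part_eq[OF assms] by auto
  then show ?thesis unfolding chi_def using hom_part_eq[OF assms] by simp
qed

text \<open>The index set may exceed the support of q, so that several polynomials can share one set
  when linearity of \<open>pi_map\<close> is shown.\<close>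

lemma chi_kernel:
  assumes "calL N m f = 0" "finite S" "{d. hom_part d q \<noteq> 0} \<subseteq> S"
  shows "chi N m q f = (\<Sum>d\<in>S. K (1 / (2 ^ d * fact d)) *
    (calL N m ^^ d) (to_fract (hom_part d q) * f))"
  unfolding chi_def using assms
  by (intro sum.mono_neutral_cong_left) (auto simp: ad_funpow_kernel)

section \<open>The Euler field and its relations with \<open>calL\<close> and
  \<open>sg\<close>\<close>

definition EE :: rat_op where "EE f = Z * Dz f + B * Dzb f"

interpretation EE: derivation EE
  by unfold_locales (simp_all add: EE_def Dz.add Dzb.add Dz.mult Dzb.mult algebra_simps)

abbreviation sg :: rat2 where "sg \<equiv> Z * B"

lemma Dz_power: "Dz (Z ^ n) = of_nat n * Z ^ (n - 1)" "Dzb (B ^ n) = of_nat n * B ^ (n - 1)"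
  "Dz (B ^ n) = 0" "Dzb (Z ^ n) = 0"
  by (simp_all add: Dz.power Dzb.power)

lemma nz [simp]: "N > 0 \<Longrightarrow> to_fract (PP N) \<noteq> 0" "Z \<noteq> 0" "B \<noteq> 0"
  by simp_all

lemma to_fract_PP: "to_fract (PP N) = Z ^ N - B ^ N"
  by (simp add: PP_def)

lemma power_pred: "N > 0 \<Longrightarrow> x * x ^ (N - 1) = x ^ N" for x :: "'a::comm_monoid_mult"
  by (cases N) simp_all

lemma power_pred': "N > 0 \<Longrightarrow> x * (y * x ^ (N - 1)) = y * x ^ N" for x :: "'a::comm_monoid_mult"
  by (cases N) (simp_all add: mult_ac)

text \<open>The relation [L, z zb] = 4(E + 1 - mN). The shift by mN comes from the first-order part,
  where differentiating z zb produces z^N - zb^N and cancels the denominator. With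
  \<open>calL_EE\<close> this makes L, E and z zb span an sl2, up to normalisation.\<close>

lemma calL_sg:
  assumes N: "N > 0"
  shows "calL N m (sg * f) = sg * calL N m f + 4 * (EE f + f) - 4 * of_nat (m * N) * f"
proof -
  have a: "Dz (Dzb (sg * f)) = f + EE f + sg * Dz (Dzb f)"
    by (simp add: Dzb.mult Dz.mult Dz.add EE_def algebra_simps)
  have b: "B ^ (N - 1) * Dz (sg * f) - Z ^ (N - 1) * Dzb (sg * f)
      = sg * (B ^ (N - 1) * Dz f - Z ^ (N - 1) * Dzb f) - to_fract (PP N) * f"
  proof -
    have "B ^ (N - 1) * Dz (sg * f) - Z ^ (N - 1) * Dzb (sg * f)
        = sg * (B ^ (N - 1) * Dz f - Z ^ (N - 1) * Dzb f) - (Z * Z ^ (N - 1) - B * B ^ (N - 1)) * f"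
      by (simp add: Dzb.mult Dz.mult algebra_simps)
    then show ?thesis by (simp only: power_pred[OF N] to_fract_PP)
  qed
  show ?thesis
    unfolding calL_eq[OF N] a b using N by (simp add: field_simps)
qed

lemma EE_Dz: "EE (Dz f) = Dz (EE f) - Dz f" "EE (Dzb f) = Dzb (EE f) - Dzb f"
  by (simp_all add: EE_def Dz.add Dzb.add Dz.mult Dzb.mult Dz_Dzb_commute algebra_simps)

lemma EE_power: "N > 0 \<Longrightarrow> EE (Z ^ N) = of_nat N * Z ^ N" "N > 0 \<Longrightarrow> EE (B ^ N) = of_nat N * B ^ N"
  by (simp_all only: EE_def Dz_power mult_zero_right add_0_right add_0 power_pred')

lemma EE_power_pred: "EE (Z ^ (N - 1)) = of_nat (N - 1) * Z ^ (N - 1)" "EE (B ^ (N - 1)) = of_nat (N - 1) * B ^ (N - 1)"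
  using EE_power[of "N - 1"] by (cases "N - 1 = 0"; simp)+

lemma EE_PP: "N > 0 \<Longrightarrow> EE (to_fract (PP N)) = of_nat N * to_fract (PP N)"
  by (simp add: to_fract_PP EE.diff EE_power algebra_simps)

lemma calL_EE:
  assumes N: "N > 0"
  shows "calL N m (EE f) = EE (calL N m f) + 2 * calL N m f"
proof -
  let ?M = "\<lambda>f. B ^ (N - 1) * Dz f - Z ^ (N - 1) * Dzb f"
  let ?P = "to_fract (PP N)"
  have a: "Dz (Dzb (EE f)) = EE (Dz (Dzb f)) + 2 * Dz (Dzb f)"
    using EE_Dz(1)[of "Dzb f"] EE_Dz(2)[of f] by (simp add: Dz.add Dz.diff algebra_simps)
  have NN: "of_nat N = of_nat (N - 1) + (1 :: rat2)" using N by (cases N) simp_all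
  have "EE (?M f) = of_nat (N - 1) * ?M f + ?M (EE f) - ?M f"
    by (simp only: EE.diff EE.mult EE_power_pred EE_Dz) (simp add: algebra_simps)
  then have E: "EE (?M f) = of_nat N * ?M f + ?M (EE f) - 2 * ?M f"
    by (simp add: NN algebra_simps)
  have "EE (?M f / ?P) = (EE (?M f) * ?P - ?M f * EE ?P) / (?P * ?P)"
    by (rule derivation_divide) (use N in \<open>unfold_locales, simp\<close>)
  also have "\<dots> = (?M (EE f) - 2 * ?M f) / ?P"
    unfolding EE_PP[OF N] E using N by (simp add: field_simps)
  finally have b: "?M (EE f) / ?P = EE (?M f / ?P) + 2 * (?M f / ?P)"
    by (simp add: diff_divide_distrib)
  have L: "calL N m g = 4 * Dz (Dzb g) + of_nat (4 * m * N) * (?M g / ?P)" for g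
    unfolding calL_eq[OF N] by simp
  show ?thesis
    unfolding L a b by (simp only: EE.add EE.mult EE.numeral EE.of_nat) (simp add: algebra_simps)
qed

lemma sigma1_eq: "sigma1 = zc * zb" and sigma2_eq: "sigma2 N = QQ N"
  by (simp_all add: sigma1_def sigma2_def zc_def zb_def QQ_def)

lemma sigma_HP: "sigma1 \<in> HP 2" "sigma2 N \<in> HP (int N)"
  using Sect_mono[of 1 1 2 "Suc 0" 0] Sect_mono[of N 0 "int N" "Suc 0" 0] Sect_mono[of 0 N "int N" "Suc 0" 0]
  by (auto simp: sigma1_eq sigma2_eq QQ_def intro: Sect_add)

lemma chi_sigma1:
  assumes N: "N > 0"
  shows "chi N m sigma1 f = calL N m f"
proof -
  let ?L = "calL N m"
  have C: "?L (to_fract sigma1 * g) - to_fract sigma1 * ?L g = 4 * (EE g + g) - 4 * of_nat (m * N) * g" for g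
    using calL_sg[OF N, of m g] by (simp add: sigma1_eq)
  have Lc: "?L (4 * (EE f + f) - 4 * of_nat (m * N) * f) = 4 * (?L (EE f) + ?L f) - 4 * of_nat (m * N) * ?L f"
  proof -
    have "4 * (EE f + f) - 4 * of_nat (m * N) * f = K 4 * (EE f + f) + K (- 4 * of_nat (m * N)) * f"
      by (simp only: K_simps K_nat) simp
    then have "?L (4 * (EE f + f) - 4 * of_nat (m * N) * f) = K 4 * (?L (EE f) + ?L f) + K (- 4 * of_nat (m * N)) * ?L f"
      by (simp only: calL_add calL_scale)
    then show ?thesis by (simp only: K_simps K_nat) simp
  qed
  have s: "sigma1 \<in> HP (int 2)" using sigma_HP by simp
  have "(ad ?L ^^ 2) (mult_op sigma1) f
      = ?L (?L (to_fract sigma1 * f) - to_fract sigma1 * ?L f)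
        - (?L (to_fract sigma1 * ?L f) - to_fract sigma1 * ?L (?L f))"
    by (simp add: numeral_2_eq_2 ad_def mult_op_def)
  \<comment> \<open>The factor 8 equals 2^2 * 2!, the normalisation of \<open>chi\<close> in degree
    2.\<close>
  also have "\<dots> = 8 * ?L f"
    unfolding C Lc calL_EE[OF N] by (simp add: algebra_simps)
  finally have "chi N m sigma1 f = K (1 / (2 ^ 2 * fact 2)) * (8 * ?L f)"
    using chi_hom[OF s, of N m f] by simp
  also have "\<dots> = K (1 / (2 ^ 2 * fact 2) * 8) * ?L f"
    by (simp only: K_simps(2) K_nat mult.assoc)
  finally show ?thesis by (simp add: fact_numeral)
qed

lemma harmonics_iff:
  assumes N: "N > 0"
  shows "q \<in> harmonics N m \<longleftrightarrow>
    calL N m (to_fract q) = 0 \<and> (calL N m ^^ N) (to_fract (QQ N * q)) = 0"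
proof -
  have "chi N m (sigma2 N) (to_fract q) = 0 \<longleftrightarrow> (calL N m ^^ N) (to_fract (QQ N * q)) = 0"
    if "calL N m (to_fract q) = 0"
    unfolding chi_hom[OF sigma_HP(2)] ad_funpow_kernel[OF that] by (simp add: sigma2_eq)
  then show ?thesis by (auto simp: harmonics_def chi_sigma1[OF N])
qed

subsection \<open>The action of \<open>\<L>\<^sub>2\<close> on the kernel of \<open>\<L>\<^sub>1\<close>\<close>

text \<open>In terms of \<open>z\<^sup>N\<close> and \<open>zb\<^sup>N\<close> the operator \<open>\<L>\<close> is, up to a factor, the
  Euler--Poisson--Darboux operator.  It commutes with the translations, which are generated
  by \<open>TT\<close>.\<close>

definition Ta :: "nat \<Rightarrow> rat_op" where "Ta N f = Dz f / Z ^ (N - 1)"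
definition Tb :: "nat \<Rightarrow> rat_op" where "Tb N f = Dzb f / B ^ (N - 1)"
definition TT :: "nat \<Rightarrow> rat_op" where "TT N f = Ta N f + Tb N f"

lemma derivation_Ta: "derivation (Ta N)"
  by unfold_locales (simp_all add: Ta_def Dz.add Dz.mult add_divide_distrib)
lemma derivation_Tb: "derivation (Tb N)"
  by unfold_locales (simp_all add: Tb_def Dzb.add Dzb.mult add_divide_distrib)
lemma derivation_TT: "derivation (TT N)"
proof -
  interpret Ta: derivation "Ta N" by (rule derivation_Ta)
  interpret Tb: derivation "Tb N" by (rule derivation_Tb)
  show ?thesis by unfold_locales (simp_all add: TT_def Ta.add Tb.add Ta.mult Tb.mult algebra_simps)
qed

lemma Ta_Tb: "Ta N (Tb N f) = Dz (Dzb f) / (Z ^ (N - 1) * B ^ (N - 1))"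
  "Tb N (Ta N f) = Dz (Dzb f) / (Z ^ (N - 1) * B ^ (N - 1))"
proof -
  have "Dz (Dzb f / B ^ (N - 1)) = Dz (Dzb f) / B ^ (N - 1)"
    by (subst derivation_divide[OF Dz.derivation_axioms]) (simp_all add: Dz_power)
  then show "Ta N (Tb N f) = Dz (Dzb f) / (Z ^ (N - 1) * B ^ (N - 1))"
    by (simp add: Ta_def Tb_def)
  have "Dzb (Dz f / Z ^ (N - 1)) = Dz (Dzb f) / Z ^ (N - 1)"
    by (subst derivation_divide[OF Dzb.derivation_axioms]) (simp_all add: Dz_power Dz_Dzb_commute)
  then show "Tb N (Ta N f) = Dz (Dzb f) / (Z ^ (N - 1) * B ^ (N - 1))"
    by (simp add: Ta_def Tb_def)
qed

lemma calL_T: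
  assumes N: "N > 0"
  shows "calL N m f = 4 * sg ^ (N - 1) *
    (Ta N (Tb N f) + of_nat (m * N) * ((Ta N f - Tb N f) / to_fract (PP N)))"
proof -
  have a: "sg ^ (N - 1) * Ta N (Tb N f) = Dz (Dzb f)"
    by (simp add: Ta_Tb power_mult_distrib)
  have b: "sg ^ (N - 1) * (Ta N f - Tb N f) = B ^ (N - 1) * Dz f - Z ^ (N - 1) * Dzb f"
    by (simp add: Ta_def Tb_def power_mult_distrib field_simps)
  have "4 * c * (X + n * (Y / P)) = 4 * (c * X) + 4 * n * (c * Y) / P" for c X n Y P :: rat2
    by (simp add: algebra_simps)
  then show ?thesis unfolding calL_eq[OF N] a b by (simp only: a b)
qed

text \<open>The bracket in \<open>calL_T\<close> depends on z^N and zb^N only through derivatives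
  and the difference P, which \<open>TT N\<close> kills. The factor \<open>sg ^ (N - 1)\<close>,
  which does not commute with \<open>TT N\<close>, is removed beforehand because the bracket itself
  is zero.\<close>

lemma calL_TT:
  assumes N: "N > 0" and f: "calL N m f = 0"
  shows "calL N m (TT N f) = 0"
proof -
  interpret Ta: derivation "Ta N" by (rule derivation_Ta)
  interpret Tb: derivation "Tb N" by (rule derivation_Tb)
  interpret T: derivation "TT N" by (rule derivation_TT)
  let ?P = "to_fract (PP N)"
  have TP: "TT N ?P = 0"
    by (simp add: TT_def Ta_def Tb_def to_fract_PP Dz.diff Dzb.diff Dz_power)
  have div: "TT N (x / ?P) = TT N x / ?P" for x
    using derivation_divide[OF derivation_TT, of ?P N x] N by (simp add: TP)
  define X where "X = Ta N (Tb N f) + of_nat (m * N) * ((Ta N f - Tb N f) / ?P)"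
  have X0: "X = 0" using f unfolding calL_T[OF N] X_def[symmetric] by simp
  have ab: "Ta N (Tb N g) = Tb N (Ta N g)" for g by (simp add: Ta_Tb)
  have "Ta N (Tb N (TT N f)) + of_nat (m * N) * ((Ta N (TT N f) - Tb N (TT N f)) / ?P) = TT N X"
    unfolding X_def T.add T.mult T.of_nat div T.diff
    by (simp add: TT_def Ta.add Tb.add ab algebra_simps)
  then show ?thesis unfolding calL_T[OF N] X0 by simp
qed

text \<open>The first-order part does not see the factor \<open>QQ N\<close>, since zb^(N-1)
  \<partial> and z^(N-1) \<partial>b agree on it. Only the cross terms of the mixed derivative
  remain, and they form a translation.\<close>

lemma calL_QQ:
  assumes N: "N > 0" and f: "calL N m f = 0"
  shows "calL N m (to_fract (QQ N) * f) = 4 * of_nat N * sg ^ (N - 1) * TT N f"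
proof -
  have Q: "to_fract (QQ N) = Z ^ N + B ^ N" by (simp add: QQ_def)
  have a: "Dz (Dzb (to_fract (QQ N) * f)) = of_nat N * (B ^ (N - 1) * Dz f + Z ^ (N - 1) * Dzb f) + to_fract (QQ N) * Dz (Dzb f)"
    unfolding Q by (simp add: Dz.add Dzb.add Dz.mult Dzb.mult Dz_power algebra_simps)
  have b: "B ^ (N - 1) * Dz (to_fract (QQ N) * f) - Z ^ (N - 1) * Dzb (to_fract (QQ N) * f)
     = to_fract (QQ N) * (B ^ (N - 1) * Dz f - Z ^ (N - 1) * Dzb f)"
    unfolding Q by (simp add: Dz.add Dzb.add Dz.mult Dzb.mult Dz_power algebra_simps)
  have c: "sg ^ (N - 1) * TT N f = B ^ (N - 1) * Dz f + Z ^ (N - 1) * Dzb f"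
    by (simp add: TT_def Ta_def Tb_def power_mult_distrib field_simps)
  have "calL N m (to_fract (QQ N) * f) = to_fract (QQ N) * calL N m f
      + 4 * of_nat N * (B ^ (N - 1) * Dz f + Z ^ (N - 1) * Dzb f)"
  proof -
    have "4 * (n * W + Q * X) + 4 * k * (Q * Y) / P = Q * (4 * X + 4 * k * Y / P) + 4 * n * W"
      for n W Q X k Y P :: rat2
      by (simp add: algebra_simps)
    then show ?thesis unfolding calL_eq[OF N] a b .
  qed
  then show ?thesis using f c by (simp add: mult.assoc)
qed

lemma EE_sg_power: "EE (sg ^ k) = K (of_nat (2 * k)) * sg ^ k"
proof (cases k)
  case (Suc n)
  have "EE sg = 2 * sg" by (simp add: EE_def Dz.mult Dzb.mult)
  then show ?thesis unfolding Suc K_nat by (simp only: EE.power) (simp add: algebra_simps)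
qed simp

text \<open>Repeated use of the commutator with z zb on a homogeneous kernel element of degree e.
  The possible vanishing of this scalar is the origin of the exceptional degrees.\<close>

lemma calL_sg_power:
  assumes N: "N > 0" and h: "calL N m h = 0" "EE h = K e * h"
  shows "calL N m (sg ^ Suc k * h) = K (4 * of_nat (Suc k) * (of_nat (Suc k) + e - of_nat (m * N))) * (sg ^ k * h)"
proof (induction k)
  case 0
  have "calL N m (sg ^ Suc 0 * h) = 4 * (K e * h + h) - 4 * of_nat (m * N) * h"
    using calL_sg[OF N, of m h] h by simp
  also have "\<dots> = K (4 * of_nat (Suc 0) * (of_nat (Suc 0) + e - of_nat (m * N))) * (sg ^ 0 * h)"
    by (simp only: K_simps K_nat) (simp add: algebra_simps)
  finally show ?case .
next
  case (Suc k)
  have E: "EE (sg ^ Suc k * h) = K (of_nat (2 * Suc k) + e) * (sg ^ Suc k * h)"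
    by (simp only: EE.mult h EE_sg_power K_simps) (simp only: algebra_simps)
  have "calL N m (sg ^ Suc (Suc k) * h) = calL N m (sg * (sg ^ Suc k * h))"
    by (simp only: power_Suc mult.assoc)
  also have "\<dots> = sg * (K (4 * of_nat (Suc k) * (of_nat (Suc k) + e - of_nat (m * N))) * (sg ^ k * h))
      + 4 * (K (of_nat (2 * Suc k) + e) * (sg ^ Suc k * h) + sg ^ Suc k * h) - 4 * of_nat (m * N) * (sg ^ Suc k * h)"
    by (simp only: calL_sg[OF N] Suc E)
  also have "\<dots> = (K (4 * of_nat (Suc k) * (of_nat (Suc k) + e - of_nat (m * N)))
      + 4 * (K (of_nat (2 * Suc k) + e) + 1) - 4 * of_nat (m * N)) * (sg ^ Suc k * h)"
    by (simp add: algebra_simps)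
  also have "K (4 * of_nat (Suc k) * (of_nat (Suc k) + e - of_nat (m * N)))
      + 4 * (K (of_nat (2 * Suc k) + e) + 1) - 4 * of_nat (m * N)
    = K (4 * of_nat (Suc k) * (of_nat (Suc k) + e - of_nat (m * N)) + 4 * (of_nat (2 * Suc k) + e + 1) - 4 * of_nat (m * N))"
    by (simp only: K_simps K_nat)
  also have "4 * of_nat (Suc k) * (of_nat (Suc k) + e - of_nat (m * N)) + 4 * (of_nat (2 * Suc k) + e + 1) - 4 * of_nat (m * N)
    = 4 * of_nat (Suc (Suc k)) * (of_nat (Suc (Suc k)) + e - of_nat (m * N))"
    by (simp add: algebra_simps)
  finally show ?case .
qed

lemma calL_pow_sg_power:
  assumes N: "N > 0" and h: "calL N m h = 0" "EE h = K e * h"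
  shows "(calL N m ^^ k) (sg ^ k * h) = K (\<Prod>i<k. 4 * of_nat (Suc i) * (of_nat (Suc i) + e - of_nat (m * N))) * h"
proof (induction k)
  case (Suc k)
  have "(calL N m ^^ Suc k) (sg ^ Suc k * h) = (calL N m ^^ k) (calL N m (sg ^ Suc k * h))"
    by (simp add: funpow_swap1)
  also have "\<dots> = K (4 * of_nat (Suc k) * (of_nat (Suc k) + e - of_nat (m * N))) * (calL N m ^^ k) (sg ^ k * h)"
    by (simp only: calL_sg_power[OF assms] calL_pow_scale)
  also have "\<dots> = K (\<Prod>i<Suc k. 4 * of_nat (Suc i) * (of_nat (Suc i) + e - of_nat (m * N))) * h"
    by (simp only: Suc prod.lessThan_Suc K_simps) (simp only: mult_ac)
  finally show ?case .
qed simp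

lemma EE_TT:
  assumes N: "N > 0" and "EE f = K e * f"
  shows "EE (TT N f) = K (e - of_nat N) * TT N f"
proof -
  have e: "EE (Dz f) = K (e - 1) * Dz f" "EE (Dzb f) = K (e - 1) * Dzb f"
    unfolding EE_Dz assms(2) by (simp_all add: Dz.mult Dzb.mult const2_diff algebra_simps)
  have *: "EE (x / y) = K (e - 1 - of_nat (N - 1)) * (x / y)"
    if "y \<noteq> 0" "EE x = K (e - 1) * x" "EE y = of_nat (N - 1) * y" for x y
    by (subst derivation_divide[OF EE.derivation_axioms]) (use that in \<open>simp_all add: K_simps K_nat field_simps\<close>)
  have "e - 1 - of_nat (N - 1) = e - of_nat N" using N by (simp add: of_nat_diff)
  note * = *[unfolded this]
  show ?thesis
    using *[OF _ e(1), of "Z ^ (N - 1)"] *[OF _ e(2), of "B ^ (N - 1)"] EE_power_pred[of N]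
    by (simp add: TT_def Ta_def Tb_def EE.add distrib_left)
qed

text \<open>The first application of \<open>calL\<close> yields a multiple of
  \<open>sg ^ (N - 1) * TT N f\<close>. As \<open>TT N f\<close> is again in the kernel, now in
  degree e - N, each of the N - 1 remaining applications strips one factor
  \<open>sg\<close>.\<close>

lemma calL_pow_QQ:
  assumes N: "N > 0" and f: "calL N m f = 0" "EE f = K e * f"
  shows "(calL N m ^^ N) (to_fract (QQ N) * f) = K (4 * of_nat N *
    (\<Prod>i<N - 1. 4 * of_nat (Suc i) * (of_nat (Suc i) + (e - of_nat N) - of_nat (m * N)))) * TT N f"
proof -
  have "(calL N m ^^ N) (to_fract (QQ N) * f) = (calL N m ^^ (N - 1)) (calL N m (to_fract (QQ N) * f))"
    using N by (cases N) (simp_all add: funpow_swap1)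
  also have "calL N m (to_fract (QQ N) * f) = K (4 * of_nat N) * (sg ^ (N - 1) * TT N f)"
    by (simp add: calL_QQ[OF N f(1)] const2_mult const2_numeral const2_of_nat mult.assoc)
  also have "(calL N m ^^ (N - 1)) \<dots> = K (4 * of_nat N *
    (\<Prod>i<N - 1. 4 * of_nat (Suc i) * (of_nat (Suc i) + (e - of_nat N) - of_nat (m * N)))) * TT N f"
    unfolding calL_pow_scale calL_pow_sg_power[OF N calL_TT[OF N f(1)] EE_TT[OF N f(2)]]
    by (simp only: K_simps mult.assoc)
  finally show ?thesis .
qed


subsection \<open>Homogeneous components of \<open>m\<close>-harmonic polynomials\<close>

text \<open>\<open>RR\<close> is P/4 times \<open>calL\<close>, and \<open>tt\<close> is (z
  zb)^(N-1) times \<open>TT\<close>: both equations are thereby stated for polynomials without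
  denominators.\<close>

definition RR :: "nat \<Rightarrow> nat \<Rightarrow> poly2 \<Rightarrow> poly2" where
  "RR N m f = PP N * dz (dzb f) + of_nat (m * N) * (zb ^ (N - 1) * dz f - zc ^ (N - 1) * dzb f)"

definition tt :: "nat \<Rightarrow> poly2 \<Rightarrow> poly2" where
  "tt N f = zb ^ (N - 1) * dz f + zc ^ (N - 1) * dzb f"

lemma calL_RR:
  assumes "N > 0"
  shows "calL N m (to_fract f) = 4 * to_fract (RR N m f) / to_fract (PP N)"
  using assms by (simp add: calL_eq RR_def field_simps)

lemma calL_eq_iff:
  assumes "N > 0"
  shows "calL N m (to_fract f) = to_fract h \<longleftrightarrow> PP N * h = 4 * RR N m f"
proof -
  have "calL N m (to_fract f) = to_fract h \<longleftrightarrow> to_fract (PP N * h) = to_fract (4 * RR N m f)"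
    using assms by (simp only: calL_RR) (auto simp: field_simps)
  then show ?thesis by (simp only: to_fract_eq_iff)
qed

lemma calL_eq_0_iff: "N > 0 \<Longrightarrow> calL N m (to_fract f) = 0 \<longleftrightarrow> RR N m f = 0"
  using calL_eq_iff[of N m f 0] by simp

lemma RR_add: "RR N m (f + g) = RR N m f + RR N m g"
  by (simp add: RR_def dz.add dzb.add algebra_simps)

lemma RR_scale: "RR N m (const2 c * f) = const2 c * RR N m f"
  unfolding RR_def dz_scale by (simp add: algebra_simps)

lemma RR_0 [simp]: "RR N m 0 = 0" by (simp add: RR_def)

lemma RR_diff: "RR N m (f - g) = RR N m f - RR N m g"
  by (simp add: RR_def dz.diff dzb.diff algebra_simps)

lemma RR_sum: "RR N m (sum f A) = (\<Sum>i\<in>A. RR N m (f i))"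
  by (induction A rule: infinite_finite_induct) (simp_all add: RR_add)

lemma tt_add: "tt N (f + g) = tt N f + tt N g"
  by (simp add: tt_def dz.add dzb.add algebra_simps)

lemma tt_scale: "tt N (const2 c * f) = const2 c * tt N f"
  unfolding tt_def dz_scale by (simp add: algebra_simps)

lemma tt_0 [simp]: "tt N 0 = 0" by (simp add: tt_def)

lemma RR_mono:
  assumes "N > 0"
  shows "RR N m (zc ^ a * zb ^ b) =
    const2 (of_nat b * (of_nat a - of_nat (m * N))) * (zc ^ (a + N - 1) * zb ^ (b - 1))
    - const2 (of_nat a * (of_nat b - of_nat (m * N))) * (zc ^ (a - 1) * zb ^ (b + N - 1))"
proof -
  obtain n where n: "N = Suc n" using assms by (cases N) auto
  have c: "const2 (of_nat b * (of_nat a - of_nat k)) = of_nat b * (of_nat a - of_nat k)" for a b k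
    by (simp only: const2_mult const2_diff const2_of_nat)
  have d: "dzb (zc ^ a * zb ^ b) = of_nat b * (zc ^ a * zb ^ (b - 1))"
    "dz (zc ^ a * zb ^ b) = of_nat a * (zc ^ (a - 1) * zb ^ b)"
    "dz (of_nat b * (zc ^ a * zb ^ (b - 1))) = of_nat a * of_nat b * (zc ^ (a - 1) * zb ^ (b - 1))"
    by (simp_all add: dz.mult dzb.mult)
  show ?thesis
    unfolding RR_def c d PP_def n
    by (cases a; cases b) (simp_all add: algebra_simps power_add)
qed

lemma RR_Sect:
  assumes N: "N > 0" and "f \<in> Sect N n r"
  shows "RR N m f \<in> Sect N (n + int N - 2) (r - 1)"
  using assms(2)
proof (induction rule: Sect_induct)
  case (add c f g) then show ?case by (simp add: RR_add RR_scale Sect_add Sect_scale)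
next
  case (mono a b)
  have 1: "b = 0 \<or> zc ^ (a + N - 1) * zb ^ (b - 1) \<in> Sect N (n + int N - 2) (r - 1)"
  proof (cases b)
    case (Suc k)
    then have "int (b - 1) - (r - 1) = int b - r" by simp
    then have "int N dvd int (b - 1) - (r - 1)" using mono by metis
    then show ?thesis using mono N Suc by (intro disjI2 Sect_mono) auto
  qed simp
  have 2: "a = 0 \<or> zc ^ (a - 1) * zb ^ (b + N - 1) \<in> Sect N (n + int N - 2) (r - 1)"
  proof (cases a)
    case (Suc k)
    have "int (b + N - 1) - (r - 1) = (int b - r) + int N" using N by simp
    then have "int N dvd int (b + N - 1) - (r - 1)" using mono by (metis dvd_add dvd_refl)
    then show ?thesis using mono N Suc by (auto intro!: Sect_mono)
  qed simp
  show ?case unfolding RR_mono[OF N]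
    by (rule Sect_diff) (use 1 2 in \<open>auto intro: Sect_scale\<close>)
qed simp

lemma RR_HP:
  assumes N: "N > 0" and "f \<in> HP n"
  shows "RR N m f \<in> HP (n + int N - 2)"
  using assms(2)
proof (induction rule: Sect_induct)
  case (add c f g) then show ?case by (simp add: RR_add RR_scale Sect_add Sect_scale)
next
  case (mono a b)
  then have "zc ^ a * zb ^ b \<in> Sect N n (int b)" by (intro Sect_mono) auto
  from Sect_HP[OF RR_Sect[OF N this]] show ?case .
qed simp

lemma tt_HP:
  assumes N: "N > 0" and "f \<in> HP n"
  shows "tt N f \<in> HP (n + int N - 2)"
  using assms(2)
proof (induction rule: Sect_induct)
  case (add c f g) then show ?case by (simp add: tt_add tt_scale Sect_add Sect_scale)
next
  case (mono a b)
  have t: "tt N (zc ^ a * zb ^ b) = of_nat a * (zc ^ (a - 1) * zb ^ (b + N - 1))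
      + of_nat b * (zc ^ (a + N - 1) * zb ^ (b - 1))"
    using N by (cases N) (simp_all add: tt_def dz.mult dzb.mult power_add algebra_simps)
  have 1: "b = 0 \<or> zc ^ (a + N - 1) * zb ^ (b - 1) \<in> HP (n + int N - 2)"
    using mono N by (cases b) (auto intro!: Sect_mono)
  have 2: "a = 0 \<or> zc ^ (a - 1) * zb ^ (b + N - 1) \<in> HP (n + int N - 2)"
    using mono N by (cases a) (auto intro!: Sect_mono)
  show ?case unfolding t by (rule Sect_add) (use 1 2 in \<open>auto intro: Sect_of_nat\<close>)
qed simp

lemma euler:
  assumes "f \<in> HP n"
  shows "zc * dz f + zb * dzb f = const2 (of_int n) * f"
  using assms
proof (induction rule: Sect_induct)
  case (add c f g)
  have "zc * dz (const2 c * f + g) + zb * dzb (const2 c * f + g)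
      = const2 c * (zc * dz f + zb * dzb f) + (zc * dz g + zb * dzb g)"
    unfolding dz.add dzb.add dz_scale by (simp add: algebra_simps)
  then show ?case by (simp only: add) (simp add: algebra_simps)
next
  case (mono a b)
  have "zc * dz (zc ^ a * zb ^ b) + zb * dzb (zc ^ a * zb ^ b) = (of_nat a + of_nat b) * (zc ^ a * zb ^ b)"
    unfolding dz.mult dzb.mult dz_power by (cases a; cases b) (simp_all add: algebra_simps)
  also have "of_nat a + of_nat b = const2 (of_int n)"
    using mono(1) by (simp only: mono(1)[symmetric] of_int_add of_int_of_nat_eq const2_add const2_of_nat)
  finally show ?case .
qed simp

lemma sg_TT: "sg ^ (N - 1) * TT N (to_fract f) = to_fract (tt N f)"
  by (simp add: TT_def Ta_def Tb_def tt_def power_mult_distrib field_simps)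

lemma sum_graded_eq_0_iff:
  assumes "finite A" and "\<And>k. f k \<in> HP (int k + c)"
  shows "(\<Sum>k\<in>A. f k) = 0 \<longleftrightarrow> (\<forall>k\<in>A. f k = 0)"
  using cf_sum_distinct_deg[OF assms(1), of f c] assms(2) by (auto intro: sum.neutral)

text \<open>Both operators are homogeneous, so distinct components cannot cancel. In the degrees
  where the scalar of \<open>calL_pow_QQ\<close> vanishes the second equation is void.\<close>

theorem harmonics_components:
  assumes N: "N > 0"
  shows "q \<in> harmonics N m \<longleftrightarrow> (\<forall>k. RR N m (hom_part k q) = 0 \<and>
    (m * N < k \<and> k < m * N + N \<or> tt N (hom_part k q) = 0))"
proof -
  define S where "S = {k. hom_part k q \<noteq> 0}"
  have fin: "finite S" unfolding S_def by (rule finite_hom_parts)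
  have q: "q = (\<Sum>k\<in>S. hom_part k q)" unfolding S_def by (simp add: sum_hom_parts)
  have nS: "hom_part k q = 0" if "k \<notin> S" for k using that by (simp add: S_def)
  have 1: "calL N m (to_fract q) = 0 \<longleftrightarrow> (\<forall>k. RR N m (hom_part k q) = 0)"
  proof -
    have "RR N m q = (\<Sum>k\<in>S. RR N m (hom_part k q))" by (subst q) (rule RR_sum)
    also have "(\<Sum>k\<in>S. RR N m (hom_part k q)) = 0 \<longleftrightarrow> (\<forall>k\<in>S. RR N m (hom_part k q) = 0)"
      by (rule sum_graded_eq_0_iff[OF fin, of _ "int N - 2"])
        (use RR_HP[OF N hom_part_HP] in \<open>simp add: algebra_simps\<close>)
    also have "\<dots> \<longleftrightarrow> (\<forall>k. RR N m (hom_part k q) = 0)"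
      using nS by (metis RR_0)
    finally show ?thesis unfolding calL_eq_0_iff[OF N] .
  qed
  \<comment> \<open>The i-th factor vanishes at k = mN + N - (i + 1). Since i + 1 runs through 1,
    ..., N - 1, both ends mN and mN + N of the window are excluded.\<close>
  define C where "C k = 4 * of_nat N *
    (\<Prod>i<N - 1. 4 * of_nat (Suc i) * (of_nat (Suc i) + (of_nat k - of_nat N) - of_nat (m * N) :: complex))" for k
  have C0: "C k = 0 \<longleftrightarrow> m * N < k \<and> k < m * N + N" for k
  proof -
    have e: "of_nat (Suc i) + (of_nat k - of_nat N) - of_nat (m * N) = (0 :: complex) \<longleftrightarrow> Suc i + k = N + m * N" for i
    proof -
      have "of_nat (Suc i) + (of_nat k - of_nat N) - of_nat (m * N) = (0 :: complex)
          \<longleftrightarrow> of_nat (Suc i + k) = (of_nat (N + m * N) :: complex)"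
        by (auto simp: algebra_simps)
      then show ?thesis by (simp only: of_nat_eq_iff)
    qed
    have "C k = 0 \<longleftrightarrow> (\<exists>i<N - 1. Suc i + k = N + m * N)"
    proof -
      have x: "4 * of_nat (Suc i) * x = 0 \<longleftrightarrow> x = 0" for i and x :: complex
        by (simp del: of_nat_Suc)
      have y: "4 * of_nat N * x = 0 \<longleftrightarrow> x = 0" for x :: complex using N by simp
      show ?thesis unfolding C_def y prod_zero_iff[OF finite_lessThan] x e by blast
    qed
    also have "\<dots> \<longleftrightarrow> m * N < k \<and> k < m * N + N"
    proof
      assume "m * N < k \<and> k < m * N + N"
      then show "\<exists>i<N - 1. Suc i + k = N + m * N"
        by (intro exI[of _ "N + m * N - k - 1"]) auto
    qed auto
    finally show ?thesis .
  qed
  have 2: "(calL N m ^^ N) (to_fract (QQ N * q)) = 0 \<longleftrightarrow> (\<forall>k. C k = 0 \<or> tt N (hom_part k q) = 0)"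
    if L: "\<forall>k. RR N m (hom_part k q) = 0"
  proof -
    have "(calL N m ^^ N) (to_fract (QQ N * hom_part k q)) = K (C k) * TT N (to_fract (hom_part k q))" for k
    proof -
      have h: "calL N m (to_fract (hom_part k q)) = 0" using L by (simp add: calL_eq_0_iff[OF N])
      have e: "EE (to_fract (hom_part k q)) = K (of_nat k) * to_fract (hom_part k q)"
        using arg_cong[OF euler[OF hom_part_HP[of k q]], of to_fract] by (simp add: EE_def)
      show ?thesis using calL_pow_QQ[OF N h e] by (simp add: C_def)
    qed
    note * = this
    have "to_fract (QQ N * q) = (\<Sum>k\<in>S. to_fract (QQ N * hom_part k q))"
      by (subst q) (simp add: sum_distrib_left)
    then have "sg ^ (N - 1) * (calL N m ^^ N) (to_fract (QQ N * q))
        = (\<Sum>k\<in>S. K (C k) * (sg ^ (N - 1) * TT N (to_fract (hom_part k q))))"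
      by (simp only: calL_pow_sum * sum_distrib_left mult_ac)
    also have "\<dots> = to_fract (\<Sum>k\<in>S. const2 (C k) * tt N (hom_part k q))"
      by (simp only: sg_TT to_fract_sum to_fract_mult)
    finally have "(calL N m ^^ N) (to_fract (QQ N * q)) = 0 \<longleftrightarrow> (\<Sum>k\<in>S. const2 (C k) * tt N (hom_part k q)) = 0"
      by (metis (no_types, lifting) mult_eq_0_iff nz(2,3) power_not_zero to_fract_eq_0_iff)
    also have "(\<Sum>k\<in>S. const2 (C k) * tt N (hom_part k q)) = 0 \<longleftrightarrow> (\<forall>k\<in>S. const2 (C k) * tt N (hom_part k q) = 0)"
      by (rule sum_graded_eq_0_iff[OF fin, of _ "int N - 2"])
        (use Sect_scale[OF tt_HP[OF N hom_part_HP]] in \<open>simp add: algebra_simps\<close>)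
    also have "\<dots> \<longleftrightarrow> (\<forall>k. C k = 0 \<or> tt N (hom_part k q) = 0)"
    proof (intro iffI allI ballI)
      fix k assume *: "\<forall>k\<in>S. const2 (C k) * tt N (hom_part k q) = 0"
      show "C k = 0 \<or> tt N (hom_part k q) = 0"
        using * nS[of k] by (cases "k \<in> S") auto
    qed auto
    finally show ?thesis .
  qed
  show ?thesis unfolding harmonics_iff[OF N] 1 using 2 C0 by blast
qed


subsection \<open>Coefficient recursions\<close>

lemma poly2_induct [case_names zero add mono]:
  assumes "Q 0" and "\<And>c f g. Q f \<Longrightarrow> Q g \<Longrightarrow> Q (const2 c * f + g)" and "\<And>a b. Q (zc ^ a * zb ^ b)"
  shows "Q f"
proof -
  have HP: "Q h" if "h \<in> HP n" for h n
    using that by (induction rule: Sect_induct) (use assms in auto)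
  have "Q (\<Sum>d\<in>S. hom_part d f)" if "finite S" for S
    using that
  proof (induction S rule: finite_induct)
    case (insert d S)
    have "Q (const2 1 * hom_part d f + (\<Sum>d\<in>S. hom_part d f))"
      by (rule assms(2)) (use insert HP[OF hom_part_HP] in auto)
    with insert show ?case by simp
  qed (use assms in simp)
  from this[OF finite_hom_parts[of f]] show ?thesis by (simp add: sum_hom_parts)
qed

lemma cf_zpow:
  "cf a b (zc ^ k * f) = (if k \<le> a then cf (a - k) b f else 0)"
  "cf a b (zb ^ k * f) = (if k \<le> b then cf a (b - k) f else 0)"
proof (induction f rule: poly2_induct)
  case (add c f g)
  have *: "h * (const2 c * f + g) = const2 c * (h * f) + h * g" for h by (simp add: algebra_simps)
  { case 1 show ?case using add by (auto simp: * cf_add cf_scale) }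
  { case 2 show ?case using add by (auto simp: * cf_add cf_scale) }
next
  case (mono p q)
  have *: "zc ^ k * (zc ^ p * zb ^ q) = zc ^ (k + p) * zb ^ q" "zb ^ k * (zc ^ p * zb ^ q) = zc ^ p * zb ^ (k + q)"
    by (simp_all add: power_add mult_ac)
  { case 1 show ?case unfolding * cf_mono by auto }
  { case 2 show ?case unfolding * cf_mono by auto }
qed auto

text \<open>By \<open>RR_mono\<close> a monomial has two images, which differ by a shift of (N, -N)
  in the exponents; so each coefficient of \<open>RR N m f\<close> sees at most two coefficients of
  f.\<close>

lemma cf_RR:
  assumes N: "N > 0" and y: "y > 0"
  shows "cf (x + N - 1) (y - 1) (RR N m f) = of_nat y * (of_nat x - of_nat (m * N)) * cf x y f
    - (if N \<le> y then of_nat (x + N) * (of_nat (y - N) - of_nat (m * N)) * cf (x + N) (y - N) f else 0)"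
proof (induction f rule: poly2_induct)
  case (add c f g)
  show ?case unfolding RR_add RR_scale cf_add cf_scale add
    by (cases "N \<le> y") (simp_all add: algebra_simps)
next
  case (mono a b)
  have 1: "of_nat b * (of_nat a - of_nat (m * N)) * (if x + N - 1 = a + N - 1 \<and> y - 1 = b - 1 then 1 else 0)
     = of_nat y * (of_nat x - of_nat (m * N)) * (if x = a \<and> y = b then 1 else (0::complex))"
    using N y by (cases b) auto
  have 2: "of_nat a * (of_nat b - of_nat (m * N)) * (if x + N - 1 = a - 1 \<and> y - 1 = b + N - 1 then 1 else 0)
     = (if N \<le> y then of_nat (x + N) * (of_nat (y - N) - of_nat (m * N)) * (if x + N = a \<and> y - N = b then 1 else 0) else (0::complex))"
    using N y by (cases a) (auto simp del: of_nat_add of_nat_Suc)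
  show ?case unfolding RR_mono[OF N] cf_diff cf_scale cf_mono 1 2 ..
qed simp

lemma RR_rec:
  assumes "N > 0" "y > 0" "RR N m f = 0"
  shows "of_nat y * (of_nat x - of_nat (m * N)) * cf x y f
    = (if N \<le> y then of_nat (x + N) * (of_nat (y - N) - of_nat (m * N)) * cf (x + N) (y - N) f else 0)"
  using cf_RR[OF assms(1,2), of x m f] assms(3) by simp

lemma tt_mono:
  assumes "N > 0"
  shows "tt N (zc ^ a * zb ^ b) = const2 (of_nat a) * (zc ^ (a - 1) * zb ^ (b + N - 1))
      + const2 (of_nat b) * (zc ^ (a + N - 1) * zb ^ (b - 1))"
  using assms by (cases N) (simp_all add: tt_def dz.mult dzb.mult power_add const2_of_nat algebra_simps)

lemma cf_tt1:
  assumes N: "N > 0" and y: "y > 0"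
  shows "cf (x + N - 1) (y - 1) (tt N f) = of_nat y * cf x y f
      + (if N \<le> y then of_nat (x + N) * cf (x + N) (y - N) f else 0)"
proof (induction f rule: poly2_induct)
  case (add c f g)
  then show ?case unfolding tt_add tt_scale cf_add cf_scale by (simp add: algebra_simps)
next
  case (mono a b)
  have 1: "of_nat b * (if x + N - 1 = a + N - 1 \<and> y - 1 = b - 1 then 1 else 0)
    = of_nat y * (if x = a \<and> y = b then 1 else (0::complex))"
    using N y by (cases b) auto
  have 2: "of_nat a * (if x + N - 1 = a - 1 \<and> y - 1 = b + N - 1 then 1 else 0)
    = (if N \<le> y then of_nat (x + N) * (if x + N = a \<and> y - N = b then 1 else 0) else (0::complex))"
    using N y by (cases a) (auto simp del: of_nat_add of_nat_Suc)
  show ?case unfolding tt_mono[OF N] cf_add cf_scale cf_mono 1 2 by (rule add.commute)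
qed simp

lemma cf_tt2:
  assumes N: "N > 0" and x: "x > 0"
  shows "cf (x - 1) (y + N - 1) (tt N f) = of_nat x * cf x y f
      + (if N \<le> x then of_nat (y + N) * cf (x - N) (y + N) f else 0)"
proof (induction f rule: poly2_induct)
  case (add c f g)
  then show ?case unfolding tt_add tt_scale cf_add cf_scale by (simp add: algebra_simps)
next
  case (mono a b)
  have 1: "of_nat a * (if x - 1 = a - 1 \<and> y + N - 1 = b + N - 1 then 1 else 0)
    = of_nat x * (if x = a \<and> y = b then 1 else (0::complex))"
    using N x by (cases a) auto
  have 2: "of_nat b * (if x - 1 = a + N - 1 \<and> y + N - 1 = b - 1 then 1 else 0)
    = (if N \<le> x then of_nat (y + N) * (if x - N = a \<and> y + N = b then 1 else 0) else (0::complex))"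
    using N x by (cases b) (auto simp del: of_nat_add of_nat_Suc)
  show ?case unfolding tt_mono[OF N] cf_add cf_scale cf_mono 1 2 ..
qed simp

section \<open>The joint kernel of \<open>RR\<close> and \<open>tt\<close> outside the exceptional
  degrees\<close>

lemma HP_eqI:
  assumes "f \<in> HP (int n)" and "\<And>a b. a + b = n \<Longrightarrow> cf a b f = 0"
  shows "f = 0"
proof (rule Sect_eqI[OF assms(1)])
  fix a b show "cf a b f = 0"
    using Sect_cf[OF assms(1), of a b] assms(2)[of a b] by (metis of_nat_add of_nat_eq_iff)
qed

text \<open>Both recursions express the coefficient at (x, y) by the one at (x + N, y - N).
  Eliminating the latter leaves y (n - (2m+1)N) times the former. The remaining coefficient, at y =
  0, is then handled by the other family of coefficients of \<open>tt\<close>.\<close>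

lemma kernel_generic:
  assumes N: "N > 0" and f: "f \<in> HP (int n)" "RR N m f = 0" "tt N f = 0"
    and n: "n \<noteq> 0" "n \<noteq> (2 * m + 1) * N"
  shows "f = 0"
proof -
  have pos: "cf x y f = 0" if "x + y = n" "y > 0" for x y
  proof -
    define c where "c = (if N \<le> y then of_nat (x + N) * cf (x + N) (y - N) f else 0)"
    have 1: "of_nat y * cf x y f = - c"
      using cf_tt1[OF N that(2), of x f] f(3) by (simp add: c_def eq_neg_iff_add_eq_0)
    have 2: "of_nat y * (of_nat x - of_nat (m * N)) * cf x y f = (of_nat y - of_nat N - of_nat (m * N)) * c"
      using RR_rec[OF N that(2) f(2), of x] by (auto simp: c_def of_nat_diff)
    have "(of_nat y * cf x y f) * (of_nat (x + y) - of_nat ((2 * m + 1) * N)) = 0"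
      using 1 2 by (simp add: algebra_simps)
    moreover have "of_nat (x + y) - of_nat ((2 * m + 1) * N) \<noteq> (0 :: complex)"
      using n(2) that(1) by (metis of_nat_eq_iff right_minus_eq)
    ultimately show ?thesis using that(2) by simp
  qed
  show ?thesis
  proof (rule HP_eqI[OF f(1)])
    fix x y assume xy: "x + y = n"
    show "cf x y f = 0"
    proof (cases "y = 0")
      case True
      have "of_nat x * cf x y f + (if N \<le> x then of_nat (y + N) * cf (x - N) (y + N) f else 0) = 0"
        using cf_tt2[OF N, of x y f] f(3) xy n True by simp
      moreover have "cf (x - N) (y + N) f = 0" if "N \<le> x"
        using pos[of "x - N" "y + N"] that N xy by simp
      ultimately show ?thesis using xy n True by (auto split: if_splits)
    qed (use pos xy in auto)
  qed
qed

lemma cf_PP_power: "N > 0 \<Longrightarrow> cf (k * N) 0 (PP N ^ k) = 1"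
proof (induction k)
  case 0 show ?case using cf_mono[of 0 0 0 0] by simp
next
  case (Suc k)
  have "PP N ^ Suc k = zc ^ N * PP N ^ k - zb ^ N * PP N ^ k" by (simp add: PP_def algebra_simps)
  then show ?case using Suc by (simp add: cf_diff cf_zpow)
qed

lemma dz_PP: "dz (PP N) = of_nat N * zc ^ (N - 1)" "dzb (PP N) = - (of_nat N * zb ^ (N - 1))"
  by (simp_all add: PP_def dz.diff dzb.diff)

lemma PP_Sect: "PP N \<in> Sect N (int N) 0" "QQ N \<in> Sect N (int N) 0"
  using Sect_mono[of N 0 "int N" N 0] Sect_mono[of 0 N "int N" N 0]
  by (auto simp: PP_def QQ_def intro: Sect_diff Sect_add)

lemma PP_power_Sect: "PP N ^ k \<in> Sect N (int (k * N)) 0"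
  using Sect_power[OF PP_Sect(1)[of N], of k] by simp

lemma tt_PP_power: "tt N (PP N ^ k) = 0"
  by (simp add: tt_def dz.power dzb.power dz_PP algebra_simps)

text \<open>On P^s the mixed derivative contributes -s(s - 1) and the first-order part 2ms, up to a
  common factor; they cancel at s = 2m + 1.\<close>

lemma RR_PP_power: "N > 0 \<Longrightarrow> RR N m (PP N ^ (2 * m + 1)) = 0"
proof (cases "m = 0")
  case True
  then show ?thesis by (simp add: RR_def dz_PP dz.mult)
next
  case False
  assume N: "N > 0"
  then obtain M where m: "2 * m = Suc M" using False by (cases "2 * m") auto
  have d: "dzb (PP N ^ (2 * m + 1)) = - (of_nat ((2 * m + 1) * N) * (zb ^ (N - 1) * PP N ^ (2 * m)))"
    "dz (PP N ^ (2 * m + 1)) = of_nat ((2 * m + 1) * N) * (zc ^ (N - 1) * PP N ^ (2 * m))"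
    unfolding dz.power dzb.power dz_PP by (simp_all add: algebra_simps)
  have "dz (zb ^ (N - 1) * PP N ^ (2 * m)) = of_nat (2 * m * N) * (zc ^ (N - 1) * zb ^ (N - 1) * PP N ^ M)"
    unfolding m dz.mult dz.power dz_power dz_PP by (simp add: algebra_simps)
  then have dd: "dz (dzb (PP N ^ (2 * m + 1)))
      = - (of_nat ((2 * m + 1) * N * (2 * m * N)) * (zc ^ (N - 1) * zb ^ (N - 1) * PP N ^ M))"
    by (simp only: d dz.minus dz.mult[of "of_nat _"] dz.of_nat mult_zero_left add_0_right of_nat_mult mult.assoc)
  have P: "PP N ^ (2 * m) = PP N * PP N ^ M" by (simp add: m)
  have "PP N * dz (dzb (PP N ^ (2 * m + 1)))
      = - (of_nat ((2 * m + 1) * N * (2 * m * N)) * (zc ^ (N - 1) * zb ^ (N - 1) * PP N ^ (2 * m)))"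
    unfolding dd P by (simp only: mult_minus_right mult_ac)
  then show ?thesis unfolding RR_def d by (simp add: algebra_simps)
qed

lemma tt_diff: "tt N (f - g) = tt N f - tt N g"
  by (simp add: tt_def dz.diff dzb.diff algebra_simps)

text \<open>Translation invariance: the recursion from \<open>tt\<close> determines every
  coefficient from that of z^(kN), and P^k is one solution.\<close>

lemma kernel_top:
  assumes N: "N > 0" and f: "f \<in> HP (int (k * N))" "tt N f = 0" and k: "k > 0"
  shows "f = const2 (cf (k * N) 0 f) * PP N ^ k"
proof -
  define g where "g = f - const2 (cf (k * N) 0 f) * PP N ^ k"
  have g: "g \<in> HP (int (k * N))"
    unfolding g_def using f(1) Sect_HP[OF PP_power_Sect] by (intro Sect_diff Sect_scale)
  have t: "tt N g = 0" by (simp add: g_def tt_diff tt_scale tt_PP_power f(2))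
  have g0: "cf (k * N) 0 g = 0" by (simp add: g_def cf_diff cf_scale cf_PP_power[OF N])
  have "cf x y g = 0" if "x + y = k * N" for x y
    using that
  proof (induction y arbitrary: x rule: less_induct)
    case (less y)
    show ?case
    proof (cases "y = 0")
      case True then show ?thesis using g0 less by simp
    next
      case False
      then have "of_nat y * cf x y g + (if N \<le> y then of_nat (x + N) * cf (x + N) (y - N) g else 0) = 0"
        using cf_tt1[OF N, of y x g] t by simp
      moreover have "cf (x + N) (y - N) g = 0" if "N \<le> y"
        using less(1)[of "y - N" "x + N"] less(2) that N by simp
      ultimately show ?thesis using False by (auto split: if_splits)
    qed
  qed
  then have "g = 0" by (intro HP_eqI[OF g])
  then show ?thesis by (simp add: g_def)
qed

lemma HP_0: "f \<in> HP 0 \<Longrightarrow> f = const2 (cf 0 0 f)"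
proof -
  assume f: "f \<in> HP 0"
  have "f - const2 (cf 0 0 f) * 1 = 0"
    by (rule HP_eqI[of _ 0]) (use f cf_mono[of 0 0 0 0] in \<open>auto intro!: Sect_diff Sect_scale Sect_z simp: cf_diff cf_scale simp del: mult_1_right\<close>)
  then show ?thesis by simp
qed

subsection \<open>The reflection exchanging \<open>z\<close> and its conjugate\<close>

text \<open>The reflection x2 -> -x2 in the mirror of \<alpha>^0, as a substitution for the outer
  variable.\<close>

definition tau :: "poly2 \<Rightarrow> poly2" where "tau f = pcompose f [:0, -1:]"

lemma tau_simps [simp]: "tau (f + g) = tau f + tau g" "tau (f - g) = tau f - tau g" "tau (- f) = - tau f"
  "tau (f * g) = tau f * tau g" "tau 0 = 0" "tau 1 = 1" "tau (const2 c) = const2 c"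
  by (simp_all add: tau_def pcompose_add pcompose_diff pcompose_mult pcompose_uminus pcompose_1 const2_def)

lemma tau_power [simp]: "tau (f ^ n) = tau f ^ n"
  by (induction n) simp_all

lemma tau_of_nat [simp]: "tau (of_nat n) = of_nat n"
  by (induction n) simp_all

lemma tau_z [simp]: "tau zc = zb" "tau zb = zc"
proof -
  have "tau X1 = X1" "tau X2 = - X2" by (simp_all add: tau_def X1_def X2_def pcompose_pCons)
  then show "tau zc = zb" "tau zb = zc" by (simp_all add: zc_def zb_def)
qed

lemma tau_tau [simp]: "tau (tau f) = f"
  by (induction f rule: poly2_induct) simp_all

lemma dz_tau: "dz (tau f) = tau (dzb f)" "dzb (tau f) = tau (dz f)"
proof (induction f rule: poly2_induct)
  case (add c f g)
  { case 1 show ?case using add by (simp add: dz.add dzb.add dz_scale) }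
  { case 2 show ?case using add by (simp add: dz.add dzb.add dz_scale) }
next
  case (mono a b)
  { case 1 show ?case by (simp add: dz.mult dzb.mult) }
  { case 2 show ?case by (simp add: dz.mult dzb.mult) }
qed simp_all

lemma tau_PP [simp]: "tau (PP N) = - PP N" by (simp add: PP_def)

lemma RR_tau: "RR N m (tau f) = - tau (RR N m f)"
  by (simp add: RR_def dz_tau dz_dzb_commute algebra_simps)

lemma cf_tau: "cf a b (tau f) = cf b a f"
  by (induction f rule: poly2_induct) (auto simp: cf_add cf_scale cf_mono mult.commute[of "zb ^ _"])

lemma tau_Sect:
  assumes "f \<in> Sect N n r" shows "tau f \<in> Sect N n (n - r)"
proof (rule Sect_iff)
  fix a b assume "cf a b (tau f) \<noteq> 0"
  then have *: "int b + int a = n" "int N dvd int a - r" using Sect_cf[OF assms, of b a] by (auto simp: cf_tau)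
  have "int b - (n - r) = - (int a - r)" using *(1) by simp
  with * show "int a + int b = n \<and> int N dvd int b - (n - r)" by (metis add.commute dvd_minus_iff)
qed

lemma tau_HP: "f \<in> HP n \<Longrightarrow> tau f \<in> HP n"
  by (rule Sect_HP[OF tau_Sect])

subsection \<open>The \<open>m\<close>-harmonic polynomials of degree \<open>mN + j\<close>\<close>

text \<open>The solution of \<open>RR_rec\<close> started with 1 at z^(mN+j); index k belongs to
  z^(mN+j-kN) zb^(kN). The numerator factor i - m ends the series at k = m, and a denominator
  vanishes only if j is a positive multiple of N.\<close>

definition ac :: "nat \<Rightarrow> nat \<Rightarrow> nat \<Rightarrow> nat \<Rightarrow> complex" where
  "ac N m j k = (\<Prod>i<k. (of_nat (m * N) + of_nat j - of_nat (i * N)) * (of_nat i - of_nat m)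
     / (of_nat (Suc i) * (of_nat j - of_nat (Suc i * N))))"

lemma ac_0 [simp]: "ac N m j 0 = 1" by (simp add: ac_def)

lemma ac_Suc:
  assumes "Suc k * N \<noteq> j"
  shows "ac N m j (Suc k) * (of_nat (Suc k) * (of_nat j - of_nat (Suc k * N)))
    = ac N m j k * ((of_nat (m * N) + of_nat j - of_nat (k * N)) * (of_nat k - of_nat m))"
proof -
  have "of_nat j - of_nat (Suc k * N) \<noteq> (0::complex)"
    using assms by (metis of_nat_eq_iff right_minus_eq)
  moreover have "of_nat (Suc k) \<noteq> (0::complex)" by (simp del: of_nat_Suc)
  ultimately show ?thesis unfolding ac_def prod.lessThan_Suc by (simp del: of_nat_Suc of_nat_mult)
qed

lemma ac_nz:
  assumes "\<And>i. i < k \<Longrightarrow> Suc i * N \<noteq> j" "k \<le> m" "j > 0"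
  shows "ac N m j k \<noteq> 0"
proof -
  have "(of_nat (m * N) + of_nat j - of_nat (i * N)) * (of_nat i - of_nat m)
     / (of_nat (Suc i) * (of_nat j - of_nat (Suc i * N))) \<noteq> (0 :: complex)" if i: "i < k" for i
  proof -
    have "i * N \<le> m * N" using i assms(2) by (intro mult_le_mono1) simp
    then have "m * N + j \<noteq> i * N" using assms(3) by linarith
    then have "of_nat (m * N) + of_nat j - of_nat (i * N) \<noteq> (0::complex)"
      by (metis of_nat_add of_nat_eq_iff right_minus_eq)
    moreover have "of_nat j - of_nat (Suc i * N) \<noteq> (0::complex)"
      using assms(1)[OF i] by (metis of_nat_eq_iff right_minus_eq)
    moreover have "of_nat i - of_nat m \<noteq> (0::complex)" "of_nat (Suc i) \<noteq> (0::complex)"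
      using i assms(2) by (simp_all del: of_nat_Suc)
    ultimately show ?thesis by (simp del: of_nat_Suc of_nat_mult)
  qed
  then show ?thesis unfolding ac_def by (subst prod_zero_iff) auto
qed

definition qs :: "nat \<Rightarrow> nat \<Rightarrow> nat \<Rightarrow> nat \<Rightarrow> poly2" where
  "qs N m j l = (\<Sum>k\<le>l. const2 (ac N m j k) * (zc ^ (m * N + j - k * N) * zb ^ (k * N)))"

lemma RR_qs:
  assumes N: "N > 0" and j: "j > 0" and l: "l \<le> m" and nj: "\<And>i. i < l \<Longrightarrow> Suc i * N \<noteq> j"
  shows "RR N m (qs N m j l) = - const2 ((of_nat (m * N) + of_nat j - of_nat (l * N)) *
      (of_nat l - of_nat m) * of_nat N * ac N m j l) * (zc ^ (m * N + j - l * N - 1) * zb ^ (l * N + N - 1))"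
  using l nj
proof (induction l)
  case 0
  have q: "qs N m j 0 = zc ^ (m * N + j) * zb ^ 0" by (simp add: qs_def)
  have e: "of_nat (m * N + j) * (of_nat 0 - of_nat (m * N)) =
      (of_nat (m * N) + of_nat j - of_nat (0 * N)) * (of_nat 0 - of_nat m) * of_nat N * ac N m j 0"
    by (simp add: algebra_simps)
  show ?case unfolding q RR_mono[OF N] e by simp
next
  case (Suc l)
  have le: "Suc l * N \<le> m * N" using Suc(2) by (intro mult_le_mono1)
  let ?a = "m * N + j - Suc l * N" let ?b = "Suc l * N"
  have ab: "?a + N - 1 = m * N + j - l * N - 1" "?b - 1 = l * N + N - 1"
    using le N by auto
  have ca: "of_nat ?a = (of_nat (m * N) + of_nat j - of_nat ?b :: complex)"
    using le by (simp only: of_nat_diff of_nat_add)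
  have IH: "RR N m (qs N m j l) = - const2 ((of_nat (m * N) + of_nat j - of_nat (l * N)) *
      (of_nat l - of_nat m) * of_nat N * ac N m j l) * (zc ^ (m * N + j - l * N - 1) * zb ^ (l * N + N - 1))"
    by (rule Suc(1)) (use Suc(2,3) in auto)
  have "RR N m (qs N m j (Suc l)) = RR N m (qs N m j l) + const2 (ac N m j (Suc l)) * RR N m (zc ^ ?a * zb ^ ?b)"
    by (simp add: qs_def RR_add RR_scale)
  also have "\<dots> = - const2 ((of_nat (m * N) + of_nat j - of_nat (l * N)) *
      (of_nat l - of_nat m) * of_nat N * ac N m j l) * (zc ^ (?a + N - 1) * zb ^ (?b - 1))
      + const2 (ac N m j (Suc l) * (of_nat ?b * (of_nat ?a - of_nat (m * N)))) * (zc ^ (?a + N - 1) * zb ^ (?b - 1))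
      - const2 (ac N m j (Suc l) * (of_nat ?a * (of_nat ?b - of_nat (m * N)))) * (zc ^ (?a - 1) * zb ^ (?b + N - 1))"
    unfolding IH RR_mono[OF N] ab
    by (simp only: const2_mult[of "ac N m j (Suc l)"] right_diff_distrib[of "const2 (ac N m j (Suc l))"]
        mult.assoc[of "const2 (ac N m j (Suc l))"] add_diff_eq)
  also have "ac N m j (Suc l) * (of_nat ?b * (of_nat ?a - of_nat (m * N)))
      = (ac N m j (Suc l) * (of_nat (Suc l) * (of_nat j - of_nat (Suc l * N)))) * of_nat N"
    unfolding ca of_nat_mult[of "Suc l" N] by (simp add: algebra_simps)
  also have "\<dots> = (of_nat (m * N) + of_nat j - of_nat (l * N)) * (of_nat l - of_nat m) * of_nat N * ac N m j l"
    unfolding ac_Suc[OF Suc(3)[OF lessI]] by (simp only: mult_ac)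
  also have "ac N m j (Suc l) * (of_nat ?a * (of_nat ?b - of_nat (m * N)))
      = (of_nat (m * N) + of_nat j - of_nat ?b) * (of_nat (Suc l) - of_nat m) * of_nat N * ac N m j (Suc l)"
    unfolding ca by (simp only: of_nat_mult) (simp add: algebra_simps)
  finally show ?case by (simp add: const2_minus)
qed

lemma qs_Sect:
  assumes "l \<le> m" shows "qs N m j l \<in> Sect N (int (m * N + j)) 0"
  unfolding qs_def
proof (intro Sect_sum Sect_scale Sect_mono)
  fix k assume "k \<in> {..l}"
  then have "k * N \<le> m * N" using assms by (intro mult_le_mono1) simp
  then show "int (m * N + j - k * N) + int (k * N) = int (m * N + j)" by linarith
qed simp

lemma cf_qs:
  assumes "N > 0" "k \<le> m" "l \<le> m"
  shows "cf (m * N + j - k * N) (k * N) (qs N m j l) = (if k \<le> l then ac N m j k else 0)"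
proof -
  have "cf (m * N + j - k * N) (k * N) (qs N m j l) = (\<Sum>i\<le>l. if i = k then ac N m j i else 0)"
    unfolding qs_def cf_sum cf_scale cf_mono using assms by (intro sum.cong) auto
  then show ?thesis by simp
qed

definition qj :: "nat \<Rightarrow> nat \<Rightarrow> nat \<Rightarrow> poly2" where "qj N m j = qs N m j m"

lemma mult_neq_between: "0 < j \<Longrightarrow> j < N \<Longrightarrow> Suc i * N \<noteq> j" for j N i :: nat
  by (metis le_add1 mult_Suc not_less)

lemma RR_qj: "0 < j \<Longrightarrow> j < N \<Longrightarrow> RR N m (qj N m j) = 0"
  unfolding qj_def using RR_qs[of N j m m] mult_neq_between[of j N] by simp

lemma qj_Sect: "qj N m j \<in> Sect N (int (m * N + j)) 0"
  unfolding qj_def by (rule qs_Sect) simp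

lemma cf_qj:
  assumes "0 < j" "j < N"
  shows "cf (m * N + j) 0 (qj N m j) = 1" "cf j (m * N) (qj N m j) \<noteq> 0"
    "cf (m * N) j (qj N m j) = 0" "cf 0 (m * N + j) (qj N m j) = 0"
proof -
  show "cf (m * N + j) 0 (qj N m j) = 1"
    using cf_qs[of N 0 m m j] assms by (simp add: qj_def)
  show "cf j (m * N) (qj N m j) \<noteq> 0"
    using cf_qs[of N m m m j] ac_nz[of m N j m] mult_neq_between[of j N] assms by (simp add: qj_def)
  have nd: "\<not> N dvd j" using assms by (auto dest: dvd_imp_le)
  show "cf (m * N) j (qj N m j) = 0" "cf 0 (m * N + j) (qj N m j) = 0"
    using Sect_cf[OF qj_Sect[of N m j], of "m * N" j] Sect_cf[OF qj_Sect[of N m j], of 0 "m * N + j"] nd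
    by (auto simp: int_dvd_int_iff simp flip: of_nat_mult of_nat_add)
qed

text \<open>The factor y (x - mN) in \<open>RR_rec\<close> vanishes just at y = 0 and, in this
  degree, at y = j. A solution is therefore determined by its coefficients at z^(mN+j) and z^(mN)
  zb^j.\<close>

lemma kernel_mid:
  assumes j: "0 < j" "j < N" and f: "f \<in> HP (int (m * N + j))" "RR N m f = 0"
  obtains \<alpha> \<beta> where "f = const2 \<alpha> * qj N m j + const2 \<beta> * tau (qj N m j)"
proof -
  \<comment> \<open>At z^(mN) zb^j the polynomial \<open>qj N m j\<close> has coefficient 0 and
    \<open>tau (qj N m j)\<close> has the nonzero coefficient in the denominator; at z^(mN+j) the
    two coefficients are 1 and 0.\<close>
  define \<beta> where "\<beta> = cf (m * N) j f / cf j (m * N) (qj N m j)"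
  define g where "g = f - const2 (cf (m * N + j) 0 f) * qj N m j - const2 \<beta> * tau (qj N m j)"
  have N: "N > 0" using j by simp
  have g: "g \<in> HP (int (m * N + j))"
    unfolding g_def using f(1) Sect_HP[OF qj_Sect[of N m j]] tau_HP[OF Sect_HP[OF qj_Sect[of N m j]]]
    by (intro Sect_diff Sect_scale)
  have R: "RR N m g = 0" by (simp add: g_def RR_diff RR_scale RR_tau RR_qj j f)
  have g0: "cf (m * N + j) 0 g = 0" "cf (m * N) j g = 0"
    using cf_qj[OF j, of m] by (simp_all add: g_def cf_diff cf_scale cf_tau \<beta>_def)
  have "cf x y g = 0" if "x + y = m * N + j" for x y
    using that
  proof (induction y arbitrary: x rule: less_induct)
    case (less y)
    show ?case
    proof (cases "y = 0 \<or> y = j")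
      case True then show ?thesis using g0 less by auto
    next
      case False
      then have "of_nat y * (of_nat x - of_nat (m * N)) * cf x y g
        = (if N \<le> y then of_nat (x + N) * (of_nat (y - N) - of_nat (m * N)) * cf (x + N) (y - N) g else 0)"
        by (intro RR_rec[OF N _ R]) simp
      also have "\<dots> = 0" using less(1)[of "y - N" "x + N"] less(2) N by auto
      finally show ?thesis using False less(2) by (auto simp del: of_nat_mult)
    qed
  qed
  then have "g = 0" by (intro HP_eqI[OF g])
  then have "f = const2 (cf (m * N + j) 0 f) * qj N m j + const2 \<beta> * tau (qj N m j)"
    by (simp add: g_def algebra_simps)
  then show ?thesis by (rule that)
qed


subsection \<open>Moments at the point with both coordinates 1\<close>

text \<open>-i times the derivative in the polar angle; it is diagonal on monomials and kills z
  zb.\<close>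

definition delta :: "poly2 \<Rightarrow> poly2" where "delta f = zc * dz f - zb * dzb f"

interpretation delta: derivation delta
  by unfold_locales (simp_all add: delta_def dz.add dzb.add dz.mult dzb.mult algebra_simps)

lemma delta_scale: "delta (const2 c * f) = const2 c * delta f"
  unfolding delta_def dz_scale by (simp add: algebra_simps)

lemma delta_funpow_scale: "(delta ^^ s) (const2 c * f) = const2 c * (delta ^^ s) f"
  by (induction s) (simp_all add: delta_scale)

lemma delta_mono: "delta (zc ^ a * zb ^ b) = const2 (of_nat a - of_nat b) * (zc ^ a * zb ^ b)"
  unfolding delta_def dz.mult dzb.mult dz_power const2_diff const2_of_nat
  by (cases a; cases b) (simp_all add: algebra_simps)

lemma delta_PQ: "N > 0 \<Longrightarrow> delta (PP N) = of_nat N * QQ N" "N > 0 \<Longrightarrow> delta (QQ N) = of_nat N * PP N"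
  using delta_mono[of N 0] delta_mono[of 0 N]
  by (simp_all add: PP_def QQ_def delta.add delta.diff const2_minus const2_of_nat algebra_simps)

lemma delta_sigma: "delta (zc * zb) = 0" "delta ((zc * zb) ^ k) = 0"
proof -
  show "delta (zc * zb) = 0" using delta_mono[of 1 1] by simp
  then show "delta ((zc * zb) ^ k) = 0" by (simp add: delta.power)
qed

text \<open>Angular derivatives at x = (1, 0), a point of the mirror of \<alpha>^0. On z^a zb^b they
  are the powers of a - b, hence moments of the coefficients.\<close>

definition MM :: "nat \<Rightarrow> poly2 \<Rightarrow> complex" where "MM s f = evs 1 1 ((delta ^^ s) f)"

lemma MM_add: "MM s (f + g) = MM s f + MM s g"
  by (simp add: MM_def delta.funpow_add)
lemma MM_scale: "MM s (const2 c * f) = c * MM s f"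
  by (simp add: MM_def delta_funpow_scale)
lemma MM_0 [simp]: "MM s 0 = 0" by (simp add: MM_def)
lemma MM_minus: "MM s (- f) = - MM s f"
  using MM_scale[of s "-1" f] by (simp add: const2_minus)
lemma MM_diff: "MM s (f - g) = MM s f - MM s g"
  using MM_add[of s f "-g"] by (simp add: MM_minus)
lemma MM_of_nat: "MM s (of_nat n * f) = of_nat n * MM s f"
  using MM_scale[of s "of_nat n" f] by (simp add: const2_of_nat)
lemma MM_sum: "MM s (sum f A) = (\<Sum>i\<in>A. MM s (f i))"
  by (induction A rule: infinite_finite_induct) (simp_all add: MM_add)
lemma MM_delta: "MM s (delta f) = MM (Suc s) f"
  by (simp add: MM_def funpow_swap1)
lemma MM_mult: "MM s (f * g) = (\<Sum>k\<le>s. of_nat (s choose k) * MM k f * MM (s - k) g)"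
  by (simp add: MM_def delta.leibniz evs_sum)

lemma MM_mono: "MM s (zc ^ a * zb ^ b) = (of_nat a - of_nat b) ^ s"
proof (induction s)
  case (Suc s)
  show ?case unfolding MM_delta[symmetric] delta_mono MM_scale Suc by simp
qed (simp add: MM_def)

lemma MM_PQ: "MM s (PP N) = (if odd s then 2 * of_nat N ^ s else 0)"
  "MM s (QQ N) = (if odd s then 0 else 2 * of_nat N ^ s)"
  using MM_mono[of s N 0] MM_mono[of s 0 N]
  by (simp_all add: PP_def QQ_def MM_diff MM_add)

lemma MM_sigma: "MM s (zc * zb * h) = MM s h"
proof -
  have "(delta ^^ s) (zc * zb * h) = zc * zb * (delta ^^ s) h"
    by (induction s) (simp_all add: delta.mult[of "zc * zb"] delta_sigma)
  then show ?thesis by (simp add: MM_def)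
qed

text \<open>What separation of variables attaches to degree n. It is symmetric about n = mN, so
  degrees 0 and 2mN share the value 0.\<close>

definition lam :: "nat \<Rightarrow> nat \<Rightarrow> int \<Rightarrow> complex" where
  "lam N m n = of_int (n * (n - 2 * int m * int N))"

text \<open>The polar form of the operator: 4 z zb \<partial> \<partial>b is E^2 -
  \<open>delta\<close>^2, and twice z zb times the first-order part is Q \<open>delta\<close> - P E,
  with E the Euler field.\<close>

lemma RR_delta:
  assumes N: "N > 0" and f: "f \<in> HP n"
  shows "zc * zb * (4 * RR N m f) = PP N * (const2 (lam N m n) * f - delta (delta f))
    + of_nat (2 * m * N) * (QQ N * delta f)"
proof -
  define E where "E f = zc * dz f + zb * dzb f" for f
  have Ef: "E f = const2 (of_int n) * f" unfolding E_def by (rule euler[OF f])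
  have "E (const2 c * f) = const2 c * E f" for c
    unfolding E_def dz_scale by (simp add: algebra_simps)
  then have "E (E f) = const2 (of_int n) * (const2 (of_int n) * f)" by (simp only: Ef)
  then have EE: "E (E f) = const2 (of_int (n * n)) * f" by (simp add: const2_mult mult.assoc)
  have 1: "4 * (zc * zb * dz (dzb f)) = E (E f) - delta (delta f)"
    by (simp add: E_def delta_def dz.add dzb.add dz.diff dzb.diff dz.mult dzb.mult dz_dzb_commute algebra_simps)
  have "2 * (zc * zb * (zb ^ (N - 1) * dz f - zc ^ (N - 1) * dzb f))
      = 2 * ((zb * zb ^ (N - 1)) * (zc * dz f) - (zc * zc ^ (N - 1)) * (zb * dzb f))"
    by (simp add: algebra_simps)
  also have "\<dots> = QQ N * delta f - PP N * E f"
    unfolding power_pred[OF N] by (simp add: QQ_def PP_def E_def delta_def algebra_simps)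
  finally have 2: "2 * (zc * zb * (zb ^ (N - 1) * dz f - zc ^ (N - 1) * dzb f)) = QQ N * delta f - PP N * E f" .
  have "zc * zb * (4 * RR N m f) = PP N * (4 * (zc * zb * dz (dzb f)))
     + of_nat (2 * m * N) * (2 * (zc * zb * (zb ^ (N - 1) * dz f - zc ^ (N - 1) * dzb f)))"
    by (simp add: RR_def algebra_simps)
  also have "\<dots> = PP N * (const2 (of_int (n * n)) * f - of_nat (2 * m * N) * (const2 (of_int n) * f) - delta (delta f))
     + of_nat (2 * m * N) * (QQ N * delta f)"
    unfolding 1 2 unfolding EE unfolding Ef by (simp add: algebra_simps)
  also have "const2 (of_int (n * n)) * f - of_nat (2 * m * N) * (const2 (of_int n) * f) = const2 (lam N m n) * f"
  proof -
    have "lam N m n = of_int (n * n) - of_nat (2 * m * N) * of_int n"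
      by (simp add: lam_def algebra_simps)
    then show ?thesis by (simp only: const2_diff const2_mult const2_of_nat) (simp only: algebra_simps)
  qed
  finally show ?thesis .
qed

text \<open>Take the s-th moment in \<open>RR_delta\<close>. P has only odd and Q only even moments,
  so by the assumed vanishing only the lowest moment of P and that of Q contribute. The factor 4m -
  2s is where the multiplicity enters.\<close>

lemma moment_identity:
  assumes N: "N > 0" and f: "f \<in> HP n" and h: "PP N * h = 4 * RR N m f"
    and s: "even s" and Mf: "\<And>i. odd i \<Longrightarrow> i < s \<Longrightarrow> MM i f = 0"
    and Mh: "\<And>i. odd i \<Longrightarrow> Suc i < s \<Longrightarrow> MM i h = 0"
  shows "of_nat (2 * s * N) * MM (s - 1) h = (of_nat (4 * m) - of_nat (2 * s)) * of_nat N * MM (Suc s) f"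
proof -
  have eq: "PP N * (zc * zb * h) = PP N * (const2 (lam N m n) * f - delta (delta f))
    + of_nat (2 * m * N) * (QQ N * delta f)"
    using RR_delta[OF N f, of m] h by (simp add: mult_ac)
  have single: "(\<Sum>k\<le>s. g k) = (if j \<le> s then g j else 0)" if "\<And>k. k \<le> s \<Longrightarrow> k \<noteq> j \<Longrightarrow> g k = 0"
    for g :: "nat \<Rightarrow> complex" and j
  proof -
    have "(\<Sum>k\<le>s. g k) = (\<Sum>k\<le>s. if k = j then g k else 0)"
      using that by (intro sum.cong) auto
    then show ?thesis by simp
  qed
  have A: "MM s (PP N * (zc * zb * h)) = of_nat (2 * s * N) * MM (s - 1) h"
  proof -
    have "MM s (PP N * (zc * zb * h)) = (if 1 \<le> s then of_nat (s choose 1) * MM 1 (PP N) * MM (s - 1) h else 0)"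
      unfolding MM_mult[of _ "PP N"] MM_sigma
    proof (rule single)
      fix k assume "k \<le> s" "k \<noteq> 1"
      then show "of_nat (s choose k) * MM k (PP N) * MM (s - k) h = 0"
        using s Mh[of "s - k"] by (cases "odd k") (auto simp: MM_PQ elim!: oddE)
    qed
    then show ?thesis by (auto simp: MM_PQ)
  qed
  have B: "MM s (PP N * (const2 (lam N m n) * f - delta (delta f))) = - (of_nat (2 * s * N) * MM (Suc s) f)"
  proof -
    have "MM s (PP N * (const2 (lam N m n) * f - delta (delta f)))
       = (if 1 \<le> s then of_nat (s choose 1) * MM 1 (PP N) * (lam N m n * MM (s - 1) f - MM (Suc (Suc (s - 1))) f) else 0)"
      unfolding MM_mult[of _ "PP N"] MM_diff MM_scale MM_delta
    proof (rule single)
      fix k assume k: "k \<le> s" "k \<noteq> 1"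
      show "of_nat (s choose k) * MM k (PP N) * (lam N m n * MM (s - k) f - MM (Suc (Suc (s - k))) f) = 0"
      proof (cases "odd k")
        case True
        then have "odd (s - k)" "s - k < s" "Suc (Suc (s - k)) < s"
          using k s by (auto elim!: oddE evenE)
        then show ?thesis using Mf[of "s - k"] Mf[of "Suc (Suc (s - k))"] by simp
      qed (simp add: MM_PQ)
    qed
    note * = this
    have "MM (s - 1) f = 0" if "s \<ge> 1" using s that by (intro Mf) auto
    then show ?thesis unfolding * using s by (cases s) (auto simp: MM_PQ algebra_simps)
  qed
  have C: "MM s (QQ N * delta f) = 2 * MM (Suc s) f"
  proof -
    have "MM s (QQ N * delta f) = (if 0 \<le> s then of_nat (s choose 0) * MM 0 (QQ N) * MM (Suc (s - 0)) f else 0)"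
      unfolding MM_mult[of _ "QQ N"] MM_delta
    proof (rule single)
      fix k assume k: "k \<le> s" "k \<noteq> 0"
      show "of_nat (s choose k) * MM k (QQ N) * MM (Suc (s - k)) f = 0"
      proof (cases "odd k")
        case False
        then have "odd (Suc (s - k))" "Suc (s - k) < s" using k s by (auto elim!: evenE)
        then show ?thesis using Mf[of "Suc (s - k)"] by simp
      qed (simp add: MM_PQ)
    qed
    then show ?thesis by (simp add: MM_PQ)
  qed
  have "of_nat (2 * s * N) * MM (s - 1) h = - (of_nat (2 * s * N) * MM (Suc s) f) + of_nat (2 * m * N) * (2 * MM (Suc s) f)"
    using arg_cong[OF eq, of "MM s"] unfolding A MM_add B MM_of_nat C .
  then show ?thesis by (simp add: algebra_simps)
qed

subsection \<open>Quasi-invariance at one mirror\<close>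

text \<open>On \<open>Sect N n r\<close> the condition at one mirror implies the conditions at all of them, which
  are its rotations.\<close>

definition QI :: "nat \<Rightarrow> poly2 \<Rightarrow> bool" where
  "QI m f \<longleftrightarrow> (\<forall>s. odd s \<and> s < 2 * m \<longrightarrow> MM s f = 0)"

lemma QI_D: "QI m f \<Longrightarrow> odd s \<Longrightarrow> s < 2 * m \<Longrightarrow> MM s f = 0"
  by (simp add: QI_def)

lemma QI_step:
  assumes N: "N > 0" and f: "f \<in> HP n" "QI m f" and h: "PP N * h = 4 * RR N m f"
  shows "QI m h"
proof -
  have "odd t \<Longrightarrow> t < 2 * m \<Longrightarrow> MM t h = 0" for t
  proof (induction t rule: less_induct)
    case (less t)
    have "of_nat (2 * Suc t * N) * MM (Suc t - 1) h
        = (of_nat (4 * m) - of_nat (2 * Suc t)) * of_nat N * MM (Suc (Suc t)) f"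
      by (rule moment_identity[OF N f(1) h]) (use less f(2) in \<open>auto simp: QI_def\<close>)
    also have "(of_nat (4 * m) - of_nat (2 * Suc t)) * of_nat N * MM (Suc (Suc t)) f = 0"
    proof (cases "Suc t = 2 * m")
      \<comment> \<open>At s = 2m the factor 4m - 2s is zero, so the uncontrolled moment
        \<open>MM (2 * m + 1) f\<close> does no harm.\<close>
      case True
      then have "2 * Suc t = 4 * m" by simp
      then show ?thesis by (simp only: diff_self mult_zero_left)
    next
      case False
      then have "Suc (Suc t) < 2 * m" using less(2,3) by presburger
      then show ?thesis using f(2) less(2) by (simp add: QI_def)
    qed
    finally have "of_nat (2 * Suc t * N) * MM t h = 0" by simp
    moreover have "of_nat (2 * Suc t * N) \<noteq> (0 :: complex)" using N by (simp only: of_nat_eq_0_iff) simp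
    ultimately show ?case by simp
  qed
  then show ?thesis by (simp add: QI_def)
qed

text \<open>Now h = 0 in \<open>moment_identity\<close>, and 4m - 2s is nonzero for s < 2m, so the
  odd moments of f vanish one after the other.\<close>

lemma QI_kernel:
  assumes N: "N > 0" and f: "f \<in> HP n" "RR N m f = 0"
  shows "QI m f"
proof -
  have "odd t \<Longrightarrow> t < 2 * m \<Longrightarrow> MM t f = 0" for t
  proof (induction t rule: less_induct)
    case (less t)
    then obtain s where s: "t = Suc s" "even s" by (cases t) auto
    have "of_nat (2 * s * N) * MM (s - 1) 0
        = (of_nat (4 * m) - of_nat (2 * s)) * of_nat N * MM (Suc s) f"
      by (rule moment_identity[OF N f(1)]) (use less s f(2) in auto)
    moreover have "of_nat (4 * m) - of_nat (2 * s) \<noteq> (0 :: complex)"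
      using less(3) s by (metis of_nat_eq_iff right_minus_eq mult_Suc_right Suc_lessD less_irrefl mult_less_mono1 numeral_Bit0 mult_2 mult.assoc distrib_right add_less_mono)
    ultimately show ?case using N s by auto
  qed
  then show ?thesis by (simp add: QI_def)
qed

lemma QI_mult: "QI m f \<Longrightarrow> QI m g \<Longrightarrow> QI m (f * g)"
  unfolding QI_def
proof (intro allI impI)
  fix s assume f: "\<forall>s. odd s \<and> s < 2 * m \<longrightarrow> MM s f = 0" and g: "\<forall>s. odd s \<and> s < 2 * m \<longrightarrow> MM s g = 0"
    and s: "odd s \<and> s < 2 * m"
  show "MM s (f * g) = 0"
    unfolding MM_mult
  proof (intro sum.neutral ballI)
    fix k assume "k \<in> {..s}"
    then have "odd k \<and> k < 2 * m \<or> odd (s - k) \<and> s - k < 2 * m" using s by auto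
    then show "of_nat (s choose k) * MM k f * MM (s - k) g = 0" using f g by auto
  qed
qed

lemma MM_PP_power: "s < k \<Longrightarrow> MM s (PP N ^ k * g) = 0"
proof (induction k arbitrary: s)
  case (Suc k)
  have "MM s (PP N * (PP N ^ k * g)) = 0"
    unfolding MM_mult[of _ "PP N"]
  proof (intro sum.neutral ballI)
    fix i assume "i \<in> {..s}"
    then show "of_nat (s choose i) * MM i (PP N) * MM (s - i) (PP N ^ k * g) = 0"
      using Suc by (cases "i = 0") (auto simp: MM_PQ)
  qed
  then show ?case by (simp add: mult.assoc)
qed simp

lemma QI_PP_power: "QI m (PP N ^ (2 * m + 1) * g)"
  unfolding QI_def using MM_PP_power[of _ "2 * m + 1" N g] by simp

section \<open>Divisibility by \<open>PP\<close> and polynomial iterates of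
  \<open>calL\<close>\<close>

lemma mono_diff_PP:
  assumes "N > 0" "int a + int b + int (k * N) = n" "int N dvd int b - r"
  shows "\<exists>h\<in>Sect N (n - int N) r. zc ^ (a + k * N) * zb ^ b - zc ^ a * zb ^ (b + k * N) = PP N * h"
  using assms(2)
proof (induction k arbitrary: a)
  case 0 show ?case by (rule bexI[of _ 0]) auto
next
  case (Suc k)
  have "int (a + N) + int b + int (k * N) = n" using Suc(2) by simp
  from Suc(1)[OF this] obtain h where h: "h \<in> Sect N (n - int N) r"
    "zc ^ (a + N + k * N) * zb ^ b - zc ^ (a + N) * zb ^ (b + k * N) = PP N * h" by blast
  have "int (b + k * N) - r = (int b - r) + int k * int N" by simp
  then have "int N dvd int (b + k * N) - r" using assms(3) by (metis dvd_add dvd_triv_right)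
  then have "zc ^ a * zb ^ (b + k * N) \<in> Sect N (n - int N) r"
    using Suc(2) by (intro Sect_mono) auto
  then have "h + zc ^ a * zb ^ (b + k * N) \<in> Sect N (n - int N) r" using h(1) by (intro Sect_add)
  moreover have "zc ^ (a + Suc k * N) * zb ^ b - zc ^ a * zb ^ (b + Suc k * N)
      = PP N * (h + zc ^ a * zb ^ (b + k * N))"
    unfolding distrib_left h(2)[symmetric] by (simp add: PP_def power_add algebra_simps)
  ultimately show ?case by blast
qed

text \<open>Modulo P one has z^N = zb^N, so all monomials of a sector are congruent to a single one;
  the coefficient left over is the value at \<open>zc\<close> = \<open>zb\<close> = 1.\<close>

lemma Sect_divide_PP:
  assumes N: "N > 0" and X: "X \<in> Sect N n r" "evs 1 1 X = 0"
  shows "\<exists>h\<in>Sect N (n - int N) r. X = PP N * h"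
proof (cases "\<exists>a b. int a + int b = n \<and> int N dvd int b - r")
  case False
  then have "X = 0" using Sect_cf[OF X(1)] by (intro Sect_eqI[OF X(1)]) blast
  then show ?thesis by (intro bexI[of _ 0]) auto
next
  case True
  then obtain a0 b0 where 0: "int a0 + int b0 = n" "int N dvd int b0 - r" by blast
  have "\<exists>h\<in>Sect N (n - int N) r. X = const2 (evs 1 1 X) * (zc ^ a0 * zb ^ b0) + PP N * h"
    using X(1)
  proof (induction rule: Sect_induct)
    case zero show ?case by (rule bexI[of _ 0]) auto
  next
    case (add c f g)
    then obtain h k where hk: "h \<in> Sect N (n - int N) r" "k \<in> Sect N (n - int N) r"
      "f = const2 (evs 1 1 f) * (zc ^ a0 * zb ^ b0) + PP N * h"
      "g = const2 (evs 1 1 g) * (zc ^ a0 * zb ^ b0) + PP N * k" by blast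
    have "const2 c * f + g = const2 c * (const2 (evs 1 1 f) * (zc ^ a0 * zb ^ b0) + PP N * h)
      + (const2 (evs 1 1 g) * (zc ^ a0 * zb ^ b0) + PP N * k)"
      using hk(3,4) by simp
    also have "\<dots> = const2 (evs 1 1 (const2 c * f + g)) * (zc ^ a0 * zb ^ b0) + PP N * (const2 c * h + k)"
      by (simp add: const2_add const2_mult algebra_simps)
    finally show ?case using hk(1,2) by (blast intro: Sect_add Sect_scale)
  next
    case (mono a b)
    have ev: "const2 (evs 1 1 (zc ^ a * zb ^ b)) = 1" by simp
    have d: "int N dvd int b - int b0" using dvd_diff[OF mono(2) 0(2)] by simp
    consider k where "b = b0 + k * N" | k where "b0 = b + k * N"
    proof (cases "b0 \<le> b")
      case True
      then have "N dvd b - b0" using d by (metis int_dvd_int_iff of_nat_diff)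
      then obtain k where "b - b0 = N * k" by (auto elim: dvdE)
      then show thesis using True that(1)[of k] by (simp add: mult.commute)
    next
      case False
      then have "N dvd b0 - b" using d by (metis int_dvd_int_iff of_nat_diff dvd_diff_commute nat_le_linear)
      then obtain k where "b0 - b = N * k" by (auto elim: dvdE)
      then show thesis using False that(2)[of k] by (simp add: mult.commute)
    qed
    then show ?case
    proof cases
      case (1 k)
      then have a: "a0 = a + k * N" using 0 mono by linarith
      have "int a + int b0 + int (k * N) = n" using 0 a by simp
      from mono_diff_PP[OF N this 0(2)] obtain h where h: "h \<in> Sect N (n - int N) r"
        "zc ^ a0 * zb ^ b0 - zc ^ a * zb ^ b = PP N * h" unfolding 1 a by blast
      then have "zc ^ a * zb ^ b = 1 * (zc ^ a0 * zb ^ b0) + PP N * (- h)" by (simp add: algebra_simps)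
      then show ?thesis unfolding ev using Sect_minus[OF h(1)] by blast
    next
      case (2 k)
      then have a: "a = a0 + k * N" using 0 mono by linarith
      have "int a0 + int b + int (k * N) = n" using 0 a 2 by simp
      from mono_diff_PP[OF N this mono(2)] obtain h where h: "h \<in> Sect N (n - int N) r"
        "zc ^ a * zb ^ b - zc ^ a0 * zb ^ b0 = PP N * h" unfolding 2 a by blast
      then have "zc ^ a * zb ^ b = 1 * (zc ^ a0 * zb ^ b0) + PP N * h" by (simp add: algebra_simps)
      then show ?thesis unfolding ev using h(1) by blast
    qed
  qed
  then show ?thesis using X(2) by simp
qed

text \<open>At the point with both coordinates 1 the term with P drops out of
  \<open>RR N m f\<close>, and mN times the first moment of f remains. Quasi-invariance makes this
  zero, so the quotient by P is a polynomial.\<close>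

lemma calL_QI_step:
  assumes N: "N > 0" and f: "f \<in> Sect N n r" "QI m f"
  shows "\<exists>h\<in>Sect N (n - 2) (r - 1). PP N * h = 4 * RR N m f \<and> QI m h"
proof -
  have "evs 1 1 (RR N m f) = of_nat (m * N) * MM 1 f"
    by (simp add: RR_def MM_def delta_def PP_def)
  also have "\<dots> = 0" using f(2) by (cases "m = 0") (auto simp: QI_def)
  finally have "evs 1 1 (4 * RR N m f) = 0" by simp
  moreover have "4 * RR N m f \<in> Sect N (n + int N - 2) (r - 1)"
    using Sect_of_nat[OF RR_Sect[OF N f(1), of m], of 4] by simp
  ultimately obtain h where h: "h \<in> Sect N (n + int N - 2 - int N) (r - 1)" "4 * RR N m f = PP N * h"
    using Sect_divide_PP[OF N] by blast
  then have "h \<in> Sect N (n - 2) (r - 1)" by simp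
  moreover have "QI m h" by (rule QI_step[OF N Sect_HP[OF f(1)] f(2) h(2)[symmetric]])
  ultimately show ?thesis using h(2) by auto
qed

text \<open>\<open>calL\<close> as an operator on polynomials. The quotient is unique by
  \<open>Lp_eq\<close>; the value is arbitrary where none exists, which \<open>Lp_chain\<close>
  rules out along the iterates used.\<close>

definition Lp :: "nat \<Rightarrow> nat \<Rightarrow> poly2 \<Rightarrow> poly2" where
  "Lp N m f = (SOME h. PP N * h = 4 * RR N m f)"

lemma Lp_eq: "N > 0 \<Longrightarrow> PP N * h = 4 * RR N m f \<Longrightarrow> Lp N m f = h"
  unfolding Lp_def by (rule some_equality) (metis PP_nz mult_left_cancel)+

lemma Lp_chain:
  assumes N: "N > 0" and f: "f \<in> Sect N n r" "QI m f"
  shows "(Lp N m ^^ i) f \<in> Sect N (n - 2 * int i) (r - int i)" "QI m ((Lp N m ^^ i) f)"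
    "PP N * (Lp N m ^^ Suc i) f = 4 * RR N m ((Lp N m ^^ i) f)"
proof -
  have *: "g \<in> Sect N k s \<Longrightarrow> QI m g \<Longrightarrow> Lp N m g \<in> Sect N (k - 2) (s - 1) \<and> QI m (Lp N m g) \<and>
      PP N * Lp N m g = 4 * RR N m g" for g k s
    using calL_QI_step[OF N, of g k s m] Lp_eq[OF N, of _ m g] by auto
  have **: "(Lp N m ^^ i) f \<in> Sect N (n - 2 * int i) (r - int i) \<and> QI m ((Lp N m ^^ i) f)" for i
  proof (induction i)
    case (Suc i)
    then show ?case using *[of "(Lp N m ^^ i) f" "n - 2 * int i" "r - int i"] by (simp add: algebra_simps)
  qed (use f in simp)
  then show "(Lp N m ^^ i) f \<in> Sect N (n - 2 * int i) (r - int i)" "QI m ((Lp N m ^^ i) f)" by auto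
  show "PP N * (Lp N m ^^ Suc i) f = 4 * RR N m ((Lp N m ^^ i) f)"
    using **[of i] *[of "(Lp N m ^^ i) f" "n - 2 * int i" "r - int i"] by simp
qed

lemma calL_Lp:
  assumes N: "N > 0" and f: "f \<in> Sect N n r" "QI m f"
  shows "(calL N m ^^ i) (to_fract f) = to_fract ((Lp N m ^^ i) f)"
proof (induction i)
  case (Suc i)
  show ?case using Lp_chain(3)[OF assms, of i] by (simp add: Suc calL_eq_iff[OF N])
qed simp

section \<open>Vanishing from few monomials and many moments\<close>

lemma vandermonde:
  fixes c y :: "'b \<Rightarrow> complex"
  assumes "finite I" "inj_on c I" "card I \<le> n" and s: "\<And>s. s < n \<Longrightarrow> (\<Sum>i\<in>I. y i * c i ^ s) = 0" and k: "k \<in> I"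
  shows "y k = 0"
proof -
  \<comment> \<open>The Lagrange polynomial: it vanishes at every node but \<open>c k\<close>, and
    its degree is below the number of available power sums.\<close>
  define p where "p = (\<Prod>i\<in>I - {k}. [:- c i, 1:])"
  have "degree p = card (I - {k})"
    unfolding p_def by (subst degree_prod_eq_sum_degree) auto
  also have "\<dots> < card I" using assms(1) k by (intro psubset_card_mono) auto
  also note assms(3)
  finally have deg: "degree p < n" .
  have "(\<Sum>i\<in>I. y i * poly p (c i)) = (\<Sum>i\<in>I. \<Sum>s\<le>degree p. coeff p s * (y i * c i ^ s))"
    by (simp add: poly_altdef sum_distrib_left mult_ac)
  also have "\<dots> = (\<Sum>s\<le>degree p. coeff p s * (\<Sum>i\<in>I. y i * c i ^ s))"
    by (subst sum.swap) (simp add: sum_distrib_left)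
  also have "\<dots> = 0" using s deg by (intro sum.neutral) auto
  finally have "0 = (\<Sum>i\<in>I. y i * poly p (c i))" by simp
  also have "\<dots> = (\<Sum>i\<in>I. if i = k then y k * poly p (c k) else 0)"
  proof (intro sum.cong refl)
    fix i assume "i \<in> I"
    then have "poly p (c i) = 0" if "i \<noteq> k" unfolding p_def poly_prod using that assms(1) by (intro prod_zero) auto
    then show "y i * poly p (c i) = (if i = k then y k * poly p (c k) else 0)" by auto
  qed
  also have "\<dots> = y k * poly p (c k)" using assms(1) k by simp
  finally have "y k * poly p (c k) = 0" by simp
  moreover have "poly p (c k) \<noteq> 0"
    unfolding p_def poly_prod using assms(1,2) k by (subst prod_zero_iff) (auto dest: inj_onD)
  ultimately show ?thesis by simp
qed

lemma MM_expand:
  assumes "h \<in> Sect N n r"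
  shows "MM s h = (\<Sum>b | int b \<le> n \<and> int N dvd int b - r. cf (nat (n - int b)) b h * of_int (n - 2 * int b) ^ s)"
proof -
  have "MM s h = MM s (\<Sum>b | int b \<le> n \<and> int N dvd int b - r.
      const2 (cf (nat (n - int b)) b h) * (zc ^ nat (n - int b) * zb ^ b))"
    using Sect_expand[OF assms] by simp
  also have "\<dots> = (\<Sum>b | int b \<le> n \<and> int N dvd int b - r. cf (nat (n - int b)) b h * of_int (n - 2 * int b) ^ s)"
    unfolding MM_sum MM_scale MM_mono
  proof (intro sum.cong refl)
    fix b assume "b \<in> {b. int b \<le> n \<and> int N dvd int b - r}"
    then have "int (nat (n - int b)) - int b = n - 2 * int b" by simp
    then have "of_nat (nat (n - int b)) - of_nat b = (of_int (n - 2 * int b) :: complex)"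
      by (metis of_int_diff of_int_of_nat_eq)
    then show "cf (nat (n - int b)) b h * (of_nat (nat (n - int b)) - of_nat b) ^ s
      = cf (nat (n - int b)) b h * of_int (n - 2 * int b) ^ s" by (simp only:)
  qed
  finally show ?thesis .
qed

text \<open>With c = n - 2b the odd moments are power sums in the nodes c^2 with weights y c. The
  last assumption, that no monomial of the sector has its conjugate there, gives c \<noteq> 0 and
  distinct nodes, so m odd moments kill m coefficients.\<close>

lemma QI_few_terms:
  assumes h: "h \<in> Sect N n r" "QI m h"
    and card: "card {b. int b \<le> n \<and> int N dvd int b - r} \<le> m"
    and neq: "\<And>b b'. int N dvd int b - r \<Longrightarrow> int N dvd int b' - r \<Longrightarrow> int b + int b' \<noteq> n"
  shows "h = 0"
proof -
  define B where "B = {b. int b \<le> n \<and> int N dvd int b - r}"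
  define c :: "nat \<Rightarrow> complex" where "c b = of_int (n - 2 * int b)" for b
  define y where "y b = cf (nat (n - int b)) b h" for b
  have fin: "finite B" unfolding B_def by (rule finite_subset[of _ "{..nat n}"]) auto
  have M: "MM s h = (\<Sum>b\<in>B. y b * c b ^ s)" for s
    unfolding B_def y_def c_def by (rule MM_expand[OF h(1)])
  have nz: "c b \<noteq> 0" if "b \<in> B" for b
    using neq[of b b] that by (auto simp: c_def B_def simp del: of_int_diff)
  have "y b * c b = 0" if "b \<in> B" for b
  proof (rule vandermonde[of B "\<lambda>b. (c b)\<^sup>2" m "\<lambda>b. y b * c b", OF fin _ _ _ that])
    show "inj_on (\<lambda>b. (c b)\<^sup>2) B"
    proof
      fix a b assume ab: "a \<in> B" "b \<in> B" "(c a)\<^sup>2 = (c b)\<^sup>2"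
      then have "c a = c b \<or> c a = c b * -1" by (simp add: power2_eq_iff)
      then have "n - 2 * int a = n - 2 * int b \<or> n - 2 * int a = - (n - 2 * int b)"
        unfolding c_def mult_minus1_right by (simp only: of_int_eq_iff flip: of_int_minus)
      moreover have "int a + int b \<noteq> n" using neq ab by (auto simp: B_def)
      ultimately show "a = b" by auto
    qed
    show "card B \<le> m" using card by (simp add: B_def)
    fix s assume "s < m"
    then have "MM (2 * s + 1) h = 0" using h(2) by (intro QI_D) auto
    moreover have "c b ^ (2 * s + 1) = c b * (c b)\<^sup>2 ^ s" for b
      by (simp flip: power_mult)
    ultimately show "(\<Sum>b\<in>B. y b * c b * (c b)\<^sup>2 ^ s) = 0"
      unfolding M by (simp only: mult.assoc)
  qed
  then have "y b = 0" if "b \<in> B" for b using nz that by auto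
  then show ?thesis
    by (subst Sect_expand[OF h(1)]) (simp add: B_def y_def)
qed


subsection \<open>Self-adjointness modulo exact terms\<close>

text \<open>The angular part in Sturm-Liouville form, multiplied by P: formally
  \<open>Bop N m f\<close> is P times P^(2m) \<open>delta\<close> (P^(-2m) \<open>delta\<close> f),
  whence its symmetry for the weight P^(-2m).\<close>

definition Bop :: "nat \<Rightarrow> nat \<Rightarrow> poly2 \<Rightarrow> poly2" where
  "Bop N m f = PP N * delta (delta f) - of_nat (2 * m * N) * (QQ N * delta f)"

text \<open>The condition says that \<open>X/P\<^bsup>2m\<^esup> = delta (V/P\<^bsup>2m\<^esup>)\<close>, where \<open>P = PP N\<close>.\<close>

definition DD :: "nat \<Rightarrow> nat \<Rightarrow> poly2 set" where
  "DD N m = {X. \<exists>V. PP N * X = PP N * delta V - of_nat (2 * m * N) * (QQ N * V)}"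

lemma DD_0 [simp]: "0 \<in> DD N m"
  unfolding DD_def by (auto intro: exI[of _ 0])

lemma DD_add: "X \<in> DD N m \<Longrightarrow> Y \<in> DD N m \<Longrightarrow> X + Y \<in> DD N m"
proof -
  assume "X \<in> DD N m" "Y \<in> DD N m"
  then obtain V W where VW: "PP N * X = PP N * delta V - of_nat (2 * m * N) * (QQ N * V)"
    "PP N * Y = PP N * delta W - of_nat (2 * m * N) * (QQ N * W)" unfolding DD_def by blast
  have "PP N * (X + Y) = PP N * delta (V + W) - of_nat (2 * m * N) * (QQ N * (V + W))"
    unfolding distrib_left VW delta.add by (simp add: algebra_simps)
  then show ?thesis unfolding DD_def by blast
qed

lemma DD_scale: "X \<in> DD N m \<Longrightarrow> const2 c * X \<in> DD N m"
proof -
  assume "X \<in> DD N m"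
  then obtain V where V: "PP N * X = PP N * delta V - of_nat (2 * m * N) * (QQ N * V)"
    unfolding DD_def by blast
  have "PP N * (const2 c * X) = const2 c * (PP N * X)" by (simp only: mult_ac)
  also have "\<dots> = PP N * delta (const2 c * V) - of_nat (2 * m * N) * (QQ N * (const2 c * V))"
    unfolding V delta_scale by (simp only: right_diff_distrib mult_ac)
  finally show ?thesis unfolding DD_def by blast
qed

definition deq :: "nat \<Rightarrow> nat \<Rightarrow> poly2 \<Rightarrow> poly2 \<Rightarrow> bool" where
  "deq N m X Y \<longleftrightarrow> X - Y \<in> DD N m"

lemma deq_refl [simp]: "deq N m X X" by (simp add: deq_def)

lemma deq_trans [trans]: "deq N m X Y \<Longrightarrow> deq N m Y W \<Longrightarrow> deq N m X W"
  unfolding deq_def using DD_add[of "X - Y" N m "Y - W"] by simp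

lemma deq_scale: "deq N m X Y \<Longrightarrow> deq N m (const2 c * X) (const2 c * Y)"
  unfolding deq_def using DD_scale[of "X - Y" N m c] by (simp add: algebra_simps)

lemma deq_add: "deq N m X Y \<Longrightarrow> deq N m X' Y' \<Longrightarrow> deq N m (X + X') (Y + Y')"
  unfolding deq_def using DD_add[of "X - Y" N m "X' - Y'"] by (simp add: algebra_simps)

lemma Bop_pair:
  assumes "Bop N m f = PP N * f1" "Bop N m g = PP N * g1"
  shows "deq N m (g * f1) (f * g1)"
proof -
  have "PP N * (g * f1 - f * g1) = g * Bop N m f - f * Bop N m g"
    unfolding assms by (simp add: algebra_simps)
  \<comment> \<open>The Wronskian of f and g is the witness V.\<close>
  also have "\<dots> = PP N * delta (g * delta f - f * delta g)
      - of_nat (2 * m * N) * (QQ N * (g * delta f - f * delta g))"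
    unfolding Bop_def delta.diff delta.mult by (simp add: algebra_simps)
  finally show ?thesis unfolding deq_def DD_def by blast
qed

lemma Bop_eq:
  assumes "N > 0" "f \<in> HP n" "PP N * h = 4 * RR N m f"
  shows "Bop N m ((zc * zb) ^ i * f) = PP N * (const2 (lam N m n) * ((zc * zb) ^ i * f) - (zc * zb) ^ Suc i * h)"
proof -
  have d: "delta ((zc * zb) ^ i * g) = (zc * zb) ^ i * delta g" for g
    by (simp only: delta.mult delta_sigma mult_zero_left add_0_right)
  have "Bop N m ((zc * zb) ^ i * f) = (zc * zb) ^ i * Bop N m f"
    unfolding Bop_def d by (simp only: right_diff_distrib mult_ac)
  also have "Bop N m f = PP N * (const2 (lam N m n) * f) - zc * zb * (4 * RR N m f)"
    unfolding Bop_def RR_delta[OF assms(1,2)] by (simp add: algebra_simps)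
  finally show ?thesis unfolding assms(3)[symmetric] by (simp add: algebra_simps)
qed

section \<open>Pairing the iterates of \<open>calL\<close> with eigenfunctions\<close>

context
  fixes N m :: nat and f :: poly2 and n r :: int
  assumes N: "N > 0" and f: "f \<in> Sect N n r" "QI m f"
begin

text \<open>The i-th iterate as seen on the unit circle: the factor (z zb)^i is 1 there and restores
  the degree n.\<close>

definition XX :: "nat \<Rightarrow> poly2" where "XX i = (zc * zb) ^ i * (Lp N m ^^ i) f"

lemma XX_0: "XX 0 = f" by (simp add: XX_def)

lemma Bop_XX: "Bop N m (XX i) = PP N * (const2 (lam N m (n - 2 * int i)) * XX i - XX (Suc i))"
  unfolding XX_def
  by (rule Bop_eq[OF N Sect_HP[OF Lp_chain(1)[OF N f]] Lp_chain(3)[OF N f]])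

lemma XX_pair:
  assumes "Bop N m g = PP N * g1"
  shows "deq N m (g * XX (Suc i)) (const2 (lam N m (n - 2 * int i)) * (g * XX i) + const2 (-1) * (g1 * XX i))"
proof -
  let ?l = "const2 (lam N m (n - 2 * int i))"
  have "deq N m (XX i * g1) (g * (?l * XX i - XX (Suc i)))"
    by (rule Bop_pair[OF assms Bop_XX])
  then have "XX i * g1 - g * (?l * XX i - XX (Suc i)) \<in> DD N m" by (simp add: deq_def)
  also have "XX i * g1 - g * (?l * XX i - XX (Suc i)) = g * XX (Suc i) - (?l * (g * XX i) + const2 (-1) * (g1 * XX i))"
    by (simp add: const2_minus algebra_simps)
  finally show ?thesis by (simp add: deq_def)
qed

text \<open>By \<open>Bop_XX\<close> the passage from i to i + 1 is \<open>lam\<close> minus the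
  angular operator; moved to the other factor of the pairing, this operator becomes l.\<close>

lemma XX_eigen:
  assumes "Bop N m g = PP N * (const2 l * g)"
  shows "deq N m (g * XX k) (const2 (\<Prod>i<k. lam N m (n - 2 * int i) - l) * (g * f))"
proof (induction k)
  case 0 show ?case by (simp add: XX_0)
next
  case (Suc k)
  let ?l = "lam N m (n - 2 * int k)"
  have "deq N m (g * XX (Suc k)) (const2 ?l * (g * XX k) + const2 (-1) * ((const2 l * g) * XX k))"
    by (rule XX_pair[OF assms])
  also have "const2 ?l * (g * XX k) + const2 (-1) * ((const2 l * g) * XX k) = const2 (?l - l) * (g * XX k)"
    by (simp add: const2_minus const2_diff algebra_simps)
  also have "deq N m \<dots> (const2 (?l - l) * (const2 (\<Prod>i<k. lam N m (n - 2 * int i) - l) * (g * f)))"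
    by (rule deq_scale[OF Suc])
  finally show ?case by (simp add: const2_mult mult_ac)
qed

text \<open>At step i0 the term continuing the pairing of g gets the factor 0, and only the
  inhomogeneous term, a multiple of the pairing of \<rho> with f, remains. Afterwards it is merely
  multiplied by the later values of \<open>lam\<close>.\<close>

lemma XX_generalized:
  assumes g: "Bop N m g = PP N * (const2 c * \<rho>)" and \<rho>: "Bop N m \<rho> = 0"
    and i0: "lam N m (n - 2 * int i0) = 0" and k: "i0 < k"
  shows "deq N m (g * XX k) (const2 (- c * (\<Prod>i<i0. lam N m (n - 2 * int i))
    * (\<Prod>i\<in>{i0<..<k}. lam N m (n - 2 * int i))) * (\<rho> * f))"
proof -
  let ?A = "\<lambda>k. \<Prod>i<k. lam N m (n - 2 * int i)"
  have R: "deq N m (\<rho> * XX k) (const2 (?A k) * (\<rho> * f))" for k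
    using XX_eigen[of \<rho> 0 k] \<rho> by simp
  have step: "deq N m (g * XX (Suc i)) (const2 (lam N m (n - 2 * int i)) * (g * XX i) + const2 (- c * ?A i) * (\<rho> * f))" for i
  proof -
    have "deq N m (g * XX (Suc i)) (const2 (lam N m (n - 2 * int i)) * (g * XX i) + const2 (-1) * ((const2 c * \<rho>) * XX i))"
      by (rule XX_pair[OF g])
    also have "const2 (-1) * ((const2 c * \<rho>) * XX i) = const2 (- c) * (\<rho> * XX i)"
      by (simp add: const2_minus algebra_simps)
    also have "deq N m (const2 (lam N m (n - 2 * int i)) * (g * XX i) + const2 (- c) * (\<rho> * XX i))
       (const2 (lam N m (n - 2 * int i)) * (g * XX i) + const2 (- c) * (const2 (?A i) * (\<rho> * f)))"
      by (intro deq_add deq_scale R deq_refl)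
    finally show ?thesis by (simp only: const2_mult[of "- c"] mult.assoc)
  qed
  have "deq N m (g * XX (Suc i0 + j)) (const2 (- c * ?A i0 * (\<Prod>i\<in>{i0<..<Suc i0 + j}. lam N m (n - 2 * int i))) * (\<rho> * f))" for j
  proof (induction j)
    case 0
    have "{i0<..<Suc i0} = {}" by auto
    then show ?case using step[of i0] i0 by simp
  next
    case (Suc j)
    let ?k = "Suc i0 + j"
    \<comment> \<open>From here on the inhomogeneous term contains the zero factor with index
      i0.\<close>
    have A0: "?A ?k = 0" using i0 by (intro prod_zero) auto
    have s: "{i0<..<Suc i0 + Suc j} = insert ?k {i0<..<?k}" by auto
    have "deq N m (g * XX (Suc ?k)) (const2 (lam N m (n - 2 * int ?k)) * (g * XX ?k))"
      using step[of ?k] by (simp only: A0) simp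
    also have "deq N m \<dots> (const2 (lam N m (n - 2 * int ?k)) * (const2 (- c * ?A i0 * (\<Prod>i\<in>{i0<..<?k}. lam N m (n - 2 * int i))) * (\<rho> * f)))"
      by (rule deq_scale[OF Suc])
    also have "\<dots> = const2 (- c * ?A i0 * (\<Prod>i\<in>{i0<..<Suc i0 + Suc j}. lam N m (n - 2 * int i))) * (\<rho> * f)"
    proof -
      have "(\<Prod>i\<in>insert ?k {i0<..<?k}. lam N m (n - 2 * int i))
          = lam N m (n - 2 * int ?k) * (\<Prod>i\<in>{i0<..<?k}. lam N m (n - 2 * int i))"
        by (rule prod.insert) auto
      then show ?thesis unfolding s by (simp only: const2_mult mult_ac)
    qed
    finally show ?case by simp
  qed
  from this[of "k - Suc i0"] show ?thesis using k by simp
qed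

end

section \<open>From exactness with denominators to vanishing diagonal coefficients\<close>

lemma zc_dvdI:
  assumes "\<And>q. cf 0 q f = 0"
  shows "zc dvd f"
proof -
  have "\<exists>h g. f = zc * h + g \<and> (\<forall>a q. cf (Suc a) q g = 0)"
  proof (induction f rule: poly2_induct)
    case zero show ?case by (intro exI[of _ 0]) simp
  next
    case (add c f g)
    then obtain h1 g1 h2 g2 where "f = zc * h1 + g1" "g = zc * h2 + g2"
      and 0: "\<forall>a q. cf (Suc a) q g1 = 0" "\<forall>a q. cf (Suc a) q g2 = 0" by blast
    then have "const2 c * f + g = zc * (const2 c * h1 + h2) + (const2 c * g1 + g2)"
      by (simp add: algebra_simps)
    moreover have "\<forall>a q. cf (Suc a) q (const2 c * g1 + g2) = 0" using 0 by (simp add: cf_add cf_scale)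
    ultimately show ?case by blast
  next
    case (mono a b)
    show ?case
    proof (cases a)
      case 0
      have "zc ^ a * zb ^ b = zc * 0 + zc ^ a * zb ^ b \<and> (\<forall>a' q. cf (Suc a') q (zc ^ a * zb ^ b) = 0)"
        unfolding 0 cf_mono by simp
      then show ?thesis by blast
    next
      case (Suc k)
      then have "zc ^ a * zb ^ b = zc * (zc ^ k * zb ^ b) + 0 \<and> (\<forall>a' q. cf (Suc a') q 0 = 0)" by simp
      then show ?thesis by blast
    qed
  qed
  then obtain h g where f: "f = zc * h + g" "\<And>a q. cf (Suc a) q g = 0" by blast
  have "cf 0 q g = 0" for q
    using assms[of q] cf_zpow(1)[of 0 q 1 h] unfolding f(1) by (simp add: cf_add)
  then have "cf a q g = cf a q 0" for a q using f(2) by (cases a) auto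
  then have "g = 0" by (rule cf_eqI)
  then show ?thesis using f(1) by simp
qed

text \<open>At z = 0 the polynomial P becomes -zb^N. Hence in z W = P h the cofactor h is divisible
  by z, and one power of z cancels.\<close>

lemma PP_dvd_zc_cancel:
  assumes N: "N > 0"
  shows "PP N dvd zc ^ k * U \<Longrightarrow> PP N dvd U"
proof (induction k)
  case (Suc k)
  then obtain h where h: "zc * (zc ^ k * U) = PP N * h" by (auto elim: dvdE simp: mult.assoc)
  have "cf 0 q h = 0" for q
  proof -
    have "cf 0 (q + N) (zc ^ 1 * (zc ^ k * U)) = cf 0 (q + N) (zc ^ N * h) - cf 0 (q + N) (zb ^ N * h)"
      unfolding power_one_right h by (simp add: PP_def cf_diff[symmetric] algebra_simps)
    then show ?thesis unfolding cf_zpow using N by simp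
  qed
  then obtain h' where "h = zc * h'" using zc_dvdI[of h] by (blast elim: dvdE)
  with h have "zc * (zc ^ k * U) = zc * (PP N * h')" by (simp only: mult_ac)
  then have "zc ^ k * U = PP N * h'" by simp
  then show ?case using Suc(1) by simp
qed simp

lemma PP_dvd_QQ_cancel:
  assumes N: "N > 0" and "PP N dvd QQ N * U"
  shows "PP N dvd U"
proof -
  \<comment> \<open>Q + P = 2 z^N reduces the claim to cancelling powers of z.\<close>
  have "PP N dvd const2 (1/2) * (QQ N * U + PP N * U)"
    by (rule dvd_mult, rule dvd_add) (use assms(2) in auto)
  also have "const2 (1/2) * (QQ N * U + PP N * U) = (const2 (1/2) * 2) * (zc ^ N * U)"
    by (simp add: QQ_def PP_def algebra_simps)
  also have "\<dots> = zc ^ N * U" by (simp only: const2_half mult_1_left)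
  finally have "PP N dvd zc ^ N * U" .
  then show ?thesis by (rule PP_dvd_zc_cancel[OF N])
qed

text \<open>The pole of V/P^(2m) is spurious. If V = P^k U with k < 2m, the equation makes (2m - k)
  N Q U divisible by P, hence U as well, because Q can be cancelled. After 2m rounds the weight is
  gone.\<close>

lemma DD_exact:
  assumes N: "N > 0" and X: "PP N ^ (2 * m + 1) * y \<in> DD N m"
  shows "\<exists>U. y * PP N = delta U"
proof -
  obtain V where V: "PP N * (PP N ^ (2 * m + 1) * y) = PP N * delta V - of_nat (2 * m * N) * (QQ N * V)"
    using X unfolding DD_def by blast
  have eq: "PP N ^ k * (PP N ^ (2 * m + 2 - k) * y) = PP N ^ k * (PP N * delta U - of_nat ((2 * m - k) * N) * (QQ N * U))"
    if k: "k \<le> 2 * m" and U: "V = PP N ^ k * U" for k U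
  proof -
    have "PP N ^ k * (PP N ^ (2 * m + 2 - k) * y) = PP N * (PP N ^ (2 * m + 1) * y)"
      using k by (simp flip: power_Suc power_add mult.assoc)
    also have "\<dots> = PP N * delta (PP N ^ k * U) - of_nat (2 * m * N) * (QQ N * (PP N ^ k * U))"
      unfolding V U ..
    also have "PP N * delta (PP N ^ k * U) = PP N ^ k * (PP N * delta U) + of_nat (k * N) * (QQ N * (PP N ^ k * U))"
      unfolding delta.mult delta.power delta_PQ(1)[OF N] by (cases k) (simp_all add: algebra_simps)
    also have "2 * m * N = (2 * m - k) * N + k * N" using k by (simp flip: distrib_right)
    finally show ?thesis by (simp add: algebra_simps)
  qed
  have "k \<le> 2 * m \<Longrightarrow> PP N ^ k dvd V" for k
  proof (induction k)
    case (Suc k)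
    then obtain U where U: "V = PP N ^ k * U" by (auto elim: dvdE)
    have "PP N ^ (2 * m + 2 - k) * y = PP N * delta U - of_nat ((2 * m - k) * N) * (QQ N * U)"
      using eq[OF _ U] Suc(2) N by simp
    then have "of_nat ((2 * m - k) * N) * (QQ N * U) = PP N * delta U - PP N ^ (2 * m + 2 - k) * y"
      by (simp add: algebra_simps)
    moreover have "PP N ^ (2 * m + 2 - k) * y = PP N * (PP N ^ (2 * m + 1 - k) * y)"
      using Suc(2) by (simp add: Suc_diff_le)
    ultimately have "of_nat ((2 * m - k) * N) * (QQ N * U) = PP N * (delta U - PP N ^ (2 * m + 1 - k) * y)"
      by (simp only: right_diff_distrib)
    then have "PP N dvd of_nat ((2 * m - k) * N) * (QQ N * U)" by (metis dvd_triv_left)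
    then have "PP N dvd const2 (1 / of_nat ((2 * m - k) * N)) * (of_nat ((2 * m - k) * N) * (QQ N * U))"
      by (rule dvd_mult)
    also have "const2 (1 / of_nat ((2 * m - k) * N)) * (of_nat ((2 * m - k) * N) * (QQ N * U))
        = const2 (1 / of_nat ((2 * m - k) * N) * of_nat ((2 * m - k) * N)) * (QQ N * U)"
      by (simp only: const2_mult const2_of_nat mult.assoc)
    also have "1 / of_nat ((2 * m - k) * N) * of_nat ((2 * m - k) * N) = (1::complex)"
    proof -
      have "of_nat ((2 * m - k) * N) \<noteq> (0::complex)" using Suc(2) N by (simp only: of_nat_eq_0_iff) simp
      then show ?thesis by (simp only: times_divide_eq_left mult_1_left divide_self not_False_eq_True)
    qed
    finally have "PP N dvd QQ N * U" by simp
    then have "PP N dvd U" by (rule PP_dvd_QQ_cancel[OF N])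
    then show ?case unfolding U by (simp add: mult.commute mult_dvd_mono)
  qed simp
  then obtain U where U: "V = PP N ^ (2 * m) * U" by (blast elim: dvdE)
  have "PP N * (PP N * y) = PP N * delta U"
    using eq[OF _ U] N by (simp add: mult.assoc power2_eq_square)
  then have "PP N * y = delta U" by (simp only: mult_left_cancel[OF PP_nz[OF N]])
  then show ?thesis by (intro exI[of _ U]) (simp add: mult.commute)
qed

lemma cf_delta: "cf a a (delta U) = 0"
proof (induction U rule: poly2_induct)
  case (add c f g) then show ?case by (simp add: delta.add delta_scale cf_add cf_scale)
next
  case (mono p q) show ?case unfolding delta_mono cf_scale cf_mono by simp
qed simp

text \<open>\<open>delta\<close> multiplies z^p zb^q by p - q, so its image has no diagonal
  monomials.\<close>

lemma DD_diagonal: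
  assumes "N > 0" "PP N ^ (2 * m + 1) * y \<in> DD N m"
  shows "cf a a (y * PP N) = 0"
  using DD_exact[OF assms] cf_delta by metis

lemma cf_PP_binomial:
  assumes N: "N > 0"
  shows "cf (i * N) (k * N) (PP N ^ (i + k)) = (-1) ^ k * of_nat ((i + k) choose k)"
proof (induction "i + k" arbitrary: i k)
  case 0
  then show ?case using cf_mono[of 0 0 0 0] by simp
next
  case (Suc M)
  have e: "PP N ^ (i + k) = zc ^ N * PP N ^ M - zb ^ N * PP N ^ M"
    unfolding Suc(2)[symmetric] by (simp add: PP_def algebra_simps)
  have 1: "cf (i * N) (k * N) (zc ^ N * PP N ^ M) = (if i = 0 then 0 else (-1) ^ k * of_nat (M choose k))"
  proof (cases i)
    case (Suc i')
    then have "M = i' + k" using \<open>Suc M = i + k\<close> by simp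
    with Suc.hyps(1)[of i' k] Suc show ?thesis by (simp add: cf_zpow)
  qed (use N in \<open>simp add: cf_zpow\<close>)
  have 2: "cf (i * N) (k * N) (zb ^ N * PP N ^ M) = (if k = 0 then 0 else (-1) ^ (k - 1) * of_nat (M choose (k - 1)))"
  proof (cases k)
    case (Suc k')
    then have "M = i + k'" using \<open>Suc M = i + k\<close> by simp
    with Suc.hyps(1)[of i k'] Suc show ?thesis by (simp add: cf_zpow)
  qed (use N in \<open>simp add: cf_zpow\<close>)
  have iM: "i = 0 \<longleftrightarrow> k = Suc M" using Suc(2) by auto
  show ?case unfolding e cf_diff 1 2 unfolding Suc(2)[symmetric] iM
    by (cases k) (auto simp: binomial_eq_0 algebra_simps)
qed

text \<open>After the reduction the diagonal coefficient is, up to sign, the central binomial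
  coefficient of 2m + 2 over m + 1.\<close>

lemma DD_PP_power:
  assumes N: "N > 0"
  shows "(zc * zb) ^ e * PP N ^ (4 * m + 2) \<notin> DD N m"
proof
  assume "(zc * zb) ^ e * PP N ^ (4 * m + 2) \<in> DD N m"
  moreover have "(zc * zb) ^ e * PP N ^ (4 * m + 2) = PP N ^ (2 * m + 1) * ((zc * zb) ^ e * PP N ^ (2 * m + 1))"
    by (simp add: power_add mult_ac flip: power_add)
  ultimately have "cf (e + (m + 1) * N) (e + (m + 1) * N) ((zc * zb) ^ e * PP N ^ (2 * m + 1) * PP N) = 0"
    by (intro DD_diagonal[OF N, of m]) (simp only:)
  moreover have "(zc * zb) ^ e * PP N ^ (2 * m + 1) * PP N = zc ^ e * (zb ^ e * PP N ^ ((m + 1) + (m + 1)))"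
    by (simp add: power_mult_distrib mult_ac flip: power_Suc power_add mult_2)
  ultimately have "cf ((m + 1) * N) ((m + 1) * N) (PP N ^ ((m + 1) + (m + 1))) = 0"
    by (simp only: cf_zpow) simp
  then show False unfolding cf_PP_binomial[OF N] by (simp del: binomial_Suc_Suc)
qed


lemma MM_few_terms:
  assumes h: "h \<in> Sect N n r" and M: "\<And>s. s < k \<Longrightarrow> MM s h = 0"
    and T: "finite T" "card T \<le> k" "\<And>a b. cf a b h \<noteq> 0 \<Longrightarrow> b \<in> T"
  shows "h = 0"
proof -
  define B where "B = {b. int b \<le> n \<and> int N dvd int b - r}"
  define y where "y b = cf (nat (n - int b)) b h" for b
  have fin: "finite B" unfolding B_def by (rule finite_subset[of _ "{..nat n}"]) auto
  have y: "y b = 0" if "b \<in> B" for b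
  proof (cases "b \<in> T")
    case True
    show ?thesis
    proof (rule vandermonde[of "B \<inter> T" "\<lambda>b. of_int (n - 2 * int b)" k])
      show "card (B \<inter> T) \<le> k" using T(1,2) card_mono[of T "B \<inter> T"] by simp
      show "(\<Sum>b\<in>B \<inter> T. y b * of_int (n - 2 * int b) ^ s) = 0" if "s < k" for s
      proof -
        have "(\<Sum>b\<in>B \<inter> T. y b * of_int (n - 2 * int b) ^ s) = (\<Sum>b\<in>B. y b * of_int (n - 2 * int b) ^ s)"
          using fin T(3) by (intro sum.mono_neutral_left) (auto simp: y_def)
        also have "\<dots> = MM s h" unfolding B_def y_def by (rule MM_expand[OF h, symmetric])
        finally show ?thesis using M[OF that] by simp
      qed
    qed (use fin that True in \<open>auto simp: inj_on_def simp del: of_int_diff\<close>)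
  next
    case False
    then show ?thesis using T(3) by (auto simp: y_def)
  qed
  show ?thesis
    by (subst Sect_expand[OF h]) (use y in \<open>simp add: B_def y_def\<close>)
qed

lemma MM_tau: "MM s (tau f) = (-1) ^ s * MM s f"
proof (induction f rule: poly2_induct)
  case (add c f g)
  then show ?case unfolding tau_simps MM_add MM_scale by (simp add: algebra_simps)
next
  case (mono a b)
  have "tau (zc ^ a * zb ^ b) = zc ^ b * zb ^ a" by simp
  moreover have "(of_nat b - of_nat a) ^ s = (-1) ^ s * (of_nat a - of_nat b :: complex) ^ s"
    by (simp flip: power_mult_distrib)
  ultimately show ?case by (simp only: MM_mono)
qed simp

lemma cf_evs:
  assumes "f \<in> HP (int n)"
  shows "cf n 0 f = evs 1 0 f" "cf 0 n f = evs 0 1 f"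
proof -
  show "cf n 0 f = evs 1 0 f" using assms
    by (induction rule: Sect_induct) (auto simp: cf_add cf_scale cf_mono power_0_left)
  show "cf 0 n f = evs 0 1 f" using assms
    by (induction rule: Sect_induct) (auto simp: cf_add cf_scale cf_mono power_0_left)
qed

lemma deq_0_D:
  assumes "deq N m 0 (const2 c * Y)" "c \<noteq> 0"
  shows "Y \<in> DD N m"
proof -
  have "const2 (- (1 / c)) * (0 - const2 c * Y) \<in> DD N m"
    using assms(1) unfolding deq_def by (rule DD_scale)
  also have "const2 (- (1 / c)) * (0 - const2 c * Y) = const2 (1 / c * c) * Y"
    by (simp only: const2_minus const2_mult) (simp add: algebra_simps)
  finally show ?thesis using assms(2) by simp
qed

subsection \<open>The values of the map on the basis\<close>

context
  fixes N m j :: nat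
  assumes j: "0 < j" "j < N"
begin

lemma N_pos: "N > 0" using j by simp

lemma conj_range: "0 < N - j" "N - j < N" using j by auto

lemma qj_QI: "QI m (qj N m j)"
  by (rule QI_kernel[OF N_pos Sect_HP[OF qj_Sect] RR_qj[OF j]])

lemma qjP_Sect: "qj N m j * PP N ^ (2 * m + 1) \<in> Sect N (int (m * N + j + (2 * m + 1) * N)) 0"
  using Sect_mult[OF qj_Sect[of N m j] PP_power_Sect[of N "2 * m + 1"]] by simp

lemma qjP_QI: "QI m (qj N m j * PP N ^ (2 * m + 1))"
  using QI_PP_power[of m N "qj N m j"] by (simp only: mult.commute)

end

text \<open>Otherwise the two middle coefficients of x = q_j q_(N-j) agree, and the antisymmetric
  part y = x - \<open>tau x\<close> loses both. Its even moments vanish by antisymmetry and its odd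
  ones below 2m by quasi-invariance, which forces y = 0; but its coefficient at the pure power of z
  is 1.\<close>

lemma qj_pair_not_diagonal:
  assumes j: "0 < j" "j < N"
  shows "\<exists>a. cf a a (qj N m j * qj N m (N - j) * PP N) \<noteq> 0"
proof (rule ccontr)
  assume "\<not> ?thesis"
  then have diag: "cf a a (qj N m j * qj N m (N - j) * PP N) = 0" for a by blast
  note N = N_pos[OF j] and j' = conj_range[OF j]
  define x where "x = qj N m j * qj N m (N - j)"
  define n where "n = (2 * m + 1) * N"
  have nn: "m * N + j + (m * N + (N - j)) = n" using j by (simp add: n_def algebra_simps)
  have x: "x \<in> Sect N (int n) 0"
    using Sect_mult[OF qj_Sect[of N m j] qj_Sect[of N m "N - j"]] by (simp only: x_def nn flip: of_nat_add) simp
  have xQI: "QI m x" unfolding x_def by (rule QI_mult[OF qj_QI[OF j] qj_QI[OF j']])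
  have tx: "tau x \<in> Sect N (int n) 0"
    by (rule Sect_cong[OF _ tau_Sect[OF x]]) (simp add: n_def)
  define y where "y = x - tau x"
  have y: "y \<in> Sect N (int n) 0" unfolding y_def using x tx by (rule Sect_diff)
  have "cf (m * N) ((m + 1) * N) x = cf ((m + 1) * N) (m * N) x"
  proof -
    have "x * PP N = zc ^ N * x - zb ^ N * x" by (simp add: PP_def algebra_simps)
    then have "cf ((m + 1) * N) ((m + 1) * N) (x * PP N) = cf (m * N) ((m + 1) * N) x - cf ((m + 1) * N) (m * N) x"
      by (simp add: cf_diff cf_zpow)
    then show ?thesis using diag by (simp add: x_def)
  qed
  then have y0: "cf (m * N) ((m + 1) * N) y = 0" "cf ((m + 1) * N) (m * N) y = 0"
    by (simp_all add: y_def cf_diff cf_tau)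
  \<comment> \<open>Of the 2m + 2 possible exponents of zb, the multiples of N up to (2m+1)N, two
    are excluded; the 2m others face 2m + 1 moments.\<close>
  have "y = 0"
  proof (rule MM_few_terms[OF y, of "2 * m + 1" "(\<lambda>t. t * N) ` ({..2 * m + 1} - {m, m + 1})"])
    show "MM s y = 0" if "s < 2 * m + 1" for s
    proof (cases "even s")
      case False
      then have "s < 2 * m" using that by (cases "s = 2 * m") auto
      then show ?thesis using xQI False by (simp add: y_def MM_diff MM_tau QI_def)
    qed (simp add: y_def MM_diff MM_tau)
    have "card ((\<lambda>t. t * N) ` ({..2 * m + 1} - {m, m + 1})) \<le> card ({..2 * m + 1} - {m, m + 1})"
      by (rule card_image_le) simp
    also have "\<dots> = 2 * m" by (subst card_Diff_subset) auto
    finally show "card ((\<lambda>t. t * N) ` ({..2 * m + 1} - {m, m + 1})) \<le> 2 * m + 1" by simp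
    fix a b assume ab: "cf a b y \<noteq> 0"
    from Sect_cf[OF y ab] have "a + b = n" "N dvd b" by (auto simp: int_dvd_int_iff simp flip: of_nat_add)
    obtain t where "b = N * t" using \<open>N dvd b\<close> by (elim dvdE)
    then have t: "b = t * N" by (simp add: mult.commute)
    have "t * N \<le> (2 * m + 1) * N" using \<open>a + b = n\<close> by (simp add: t n_def)
    then have t': "t \<le> 2 * m + 1" using N by (simp only: mult_le_cancel2)
    have a: "a = (2 * m + 1 - t) * N"
      using \<open>a + b = n\<close> unfolding t n_def diff_mult_distrib by simp
    have "t \<noteq> m"
    proof
      assume "t = m"
      moreover then have "2 * m + 1 - t = m + 1" by simp
      ultimately show False using ab y0(2) unfolding a t by simp
    qed
    moreover have "t \<noteq> m + 1"
    proof
      assume "t = m + 1"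
      moreover then have "2 * m + 1 - t = m" by simp
      ultimately show False using ab y0(1) unfolding a t by simp
    qed
    ultimately show "b \<in> (\<lambda>t. t * N) ` ({..2 * m + 1} - {m, m + 1})" using t t' by auto
  qed simp
  have "cf n 0 y = evs 1 0 x - evs 0 1 x"
    using cf_evs[OF Sect_HP[OF x]] by (simp add: y_def cf_diff cf_tau)
  also have "evs 1 0 x = 1"
    using cf_qj(1)[OF j, of m] cf_qj(1)[OF j', of m]
      cf_evs(1)[OF Sect_HP[OF qj_Sect[of N m j]]] cf_evs(1)[OF Sect_HP[OF qj_Sect[of N m "N - j"]]]
    by (simp add: x_def)
  also have "evs 0 1 x = 0"
    using cf_qj(4)[OF j, of m] cf_evs(2)[OF Sect_HP[OF qj_Sect[of N m j]]] by (simp add: x_def)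
  finally show False using \<open>y = 0\<close> by simp
qed

text \<open>Pair with q_(N-j), whose degree is that of the final iterate. A zero iterate would make
  the product of eigenvalue differences times the pairing with f exact.\<close>

lemma Lp_qj_nonzero:
  assumes j: "0 < j" "j < N"
  shows "(Lp N m ^^ (m * N + j)) (qj N m j * PP N ^ (2 * m + 1)) \<noteq> 0"
proof
  note N = N_pos[OF j] and j' = conj_range[OF j]
  define f where "f = qj N m j * PP N ^ (2 * m + 1)"
  define g where "g = qj N m (N - j)"
  define d where "d = m * N + j"
  define n where "n = int (m * N + j + (2 * m + 1) * N)"
  define n' where "n' = int (m * N + (N - j))"
  assume "(Lp N m ^^ (m * N + j)) (qj N m j * PP N ^ (2 * m + 1)) = 0"
  then have 0: "XX N m f d = 0" unfolding XX_def[OF N qjP_Sect[OF j] qjP_QI[OF j], folded f_def] f_def d_def by simp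
  have g: "Bop N m g = PP N * (const2 (lam N m n') * g)"
    using Bop_eq[OF N, of g n' 0 m 0] Sect_HP[OF qj_Sect[of N m "N - j"]] RR_qj[OF j', of m]
    by (simp add: g_def n'_def)
  have fS: "f \<in> Sect N n 0" "QI m f" unfolding f_def n_def by (rule qjP_Sect[OF j], rule qjP_QI[OF j])
  have "deq N m (g * XX N m f d) (const2 (\<Prod>i<d. lam N m (n - 2 * int i) - lam N m n') * (g * f))"
    by (rule XX_eigen[OF N fS g])
  then have "deq N m 0 (const2 (\<Prod>i<d. lam N m (n - 2 * int i) - lam N m n') * (g * f))" by (simp add: 0)
  moreover have "(\<Prod>i<d. lam N m (n - 2 * int i) - lam N m n') \<noteq> 0"
  proof -
    have "lam N m (n - 2 * int i) - lam N m n' \<noteq> 0" if "i < d" for i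
    proof -
      have n': "n' = int m * int N + int N - int j" using j by (simp add: n'_def of_nat_diff)
      have n: "n = 3 * (int m * int N) + int N + int j" by (simp add: n_def algebra_simps)
      have i: "int i < int m * int N + int j" using that by (simp add: d_def flip: of_nat_mult of_nat_add)
      \<comment> \<open>Differences of the quadratic \<open>lam\<close> factor. The first factor is
        2(d - i), and both are positive for i < d.\<close>
      have "lam N m (n - 2 * int i) - lam N m n'
        = of_int ((n - 2 * int i - n') * (n - 2 * int i + n' - 2 * (int m * int N)))"
        unfolding lam_def of_int_diff[symmetric] by (rule arg_cong[of _ _ of_int]) (simp add: algebra_simps)
      moreover have "n - 2 * int i - n' > 0" using n n' i by linarith
      moreover have "n - 2 * int i + n' - 2 * (int m * int N) > 0" using n n' i j by linarith
      ultimately show ?thesis by (simp only: of_int_eq_0_iff) simp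
    qed
    then show ?thesis by (subst prod_zero_iff) auto
  qed
  ultimately have "g * f \<in> DD N m" by (rule deq_0_D)
  also have "g * f = PP N ^ (2 * m + 1) * (qj N m j * qj N m (N - j))"
    unfolding f_def g_def by (simp only: mult_ac)
  finally show False using DD_diagonal[OF N] qj_pair_not_diagonal[OF j] by blast
qed

theorem Lp_qj:
  assumes j: "0 < j" "j < N"
  obtains \<beta> where "\<beta> \<noteq> 0"
    "(Lp N m ^^ (m * N + j)) (qj N m j * PP N ^ (2 * m + 1)) = const2 \<beta> * tau (qj N m (N - j))"
proof -
  note N = N_pos[OF j] and j' = conj_range[OF j]
  define f where "f = qj N m j * PP N ^ (2 * m + 1)"
  define d where "d = m * N + j"
  have fS: "f \<in> Sect N (int (m * N + j + (2 * m + 1) * N)) 0" "QI m f"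
    unfolding f_def by (rule qjP_Sect[OF j], rule qjP_QI[OF j])
  note chain = Lp_chain[OF N fS]
  define p where "p = (Lp N m ^^ d) f"
  have deg: "int (m * N + j + (2 * m + 1) * N) - 2 * int d = int (m * N + (N - j))"
    using j by (simp add: d_def of_nat_diff algebra_simps)
  have p: "p \<in> Sect N (int (m * N + (N - j))) (- int d)"
    using chain(1)[of d] unfolding p_def deg by simp
  have "(Lp N m ^^ Suc d) f = 0"
  proof (rule QI_few_terms[OF chain(1,2)])
    let ?n = "int (m * N + j + (2 * m + 1) * N) - 2 * int (Suc d)" let ?r = "0 - int (Suc d)"
    have n: "?n = int m * int N + int N - int j - 2" using j deg by (simp add: of_nat_diff algebra_simps)
    have r: "int b - ?r = int b + 1 + int j + int m * int N" for b by (simp add: d_def)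
    have dv: "int N dvd int b - ?r \<longleftrightarrow> int N dvd int b + 1 + int j" for b
      unfolding r by (simp add: dvd_add_left_iff)
    show "int b + int b' \<noteq> ?n" if "int N dvd int b - ?r" "int N dvd int b' - ?r" for b b'
    proof
      assume s: "int b + int b' = ?n"
      have "int N dvd (int b + 1 + int j) + (int b' + 1 + int j)" using that dv by (blast intro: dvd_add)
      also have "(int b + 1 + int j) + (int b' + 1 + int j) = int j + int N * (int m + 1)"
        using s n by (simp add: algebra_simps)
      finally have "int N dvd int j" by (simp add: dvd_add_left_iff)
      then show False using j by (auto simp: int_dvd_int_iff dest: dvd_imp_le)
    qed
    let ?B = "{b. int b \<le> ?n \<and> int N dvd int b - ?r}"
    \<comment> \<open>One step below the final degree the exponents b satisfy b + 1 + j = tN with 0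
      < t < m + 1, which gives the m monomials.\<close>
    have "?B \<subseteq> (\<lambda>t. t * N - 1 - j) ` {1..m}"
    proof
      fix b assume b: "b \<in> ?B"
      then have "int N dvd int b + 1 + int j" using dv[of b] by blast
      moreover have "int (b + 1 + j) = int b + 1 + int j" by simp
      ultimately have "int N dvd int (b + 1 + j)" by (simp only:)
      then have "N dvd b + 1 + j" by (simp only: int_dvd_int_iff)
      then obtain t where "b + 1 + j = N * t" by (elim dvdE)
      then have t: "b + 1 + j = t * N" by (simp only: mult.commute)
      have "int b \<le> ?n" using b by blast
      then have "int (b + 1 + j) < int m * int N + int N" unfolding n by simp
      then have "int (b + 1 + j) < int ((m + 1) * N)" by (simp add: algebra_simps)
      then have "t * N < (m + 1) * N" unfolding t by (simp only: of_nat_less_iff)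
      then have "t < m + 1" by (simp only: mult_less_cancel2)
      moreover have "t \<noteq> 0" using t by (cases t) auto
      ultimately have "t \<in> {1..m}" by simp
      moreover have "b = t * N - 1 - j" using t by linarith
      ultimately show "b \<in> (\<lambda>t. t * N - 1 - j) ` {1..m}" by blast
    qed
    then have "card ?B \<le> card {1..m}" by (rule surj_card_le[rotated]) simp
    then show "card ?B \<le> m" by simp
  qed
  then have "4 * RR N m p = 0" using chain(3)[of d] by (simp add: p_def)
  then have "RR N m p = 0" by simp
  then obtain \<alpha> \<beta> where ab: "p = const2 \<alpha> * qj N m (N - j) + const2 \<beta> * tau (qj N m (N - j))"
    using kernel_mid[OF j' Sect_HP[OF p]] by blast
  have "cf (m * N + (N - j)) 0 p = \<alpha>"
    unfolding ab using cf_qj[OF j', of m] by (simp add: cf_add cf_scale cf_tau)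
  \<comment> \<open>The final iterate lies in the sector of exponents congruent to -j, which
    excludes the exponent 0 of zb and hence q_(N-j) itself.\<close>
  moreover have "cf (m * N + (N - j)) 0 p = 0"
  proof (rule ccontr)
    assume "cf (m * N + (N - j)) 0 p \<noteq> 0"
    then have "int N dvd int d" using Sect_cf[OF p] by fastforce
    then have "N dvd m * N + j" by (simp only: int_dvd_int_iff d_def)
    then have "N dvd j" by simp
    then show False using j by (auto dest: dvd_imp_le)
  qed
  ultimately have p': "p = const2 \<beta> * tau (qj N m (N - j))" using ab by simp
  have "p \<noteq> 0" unfolding p_def f_def d_def by (rule Lp_qj_nonzero[OF j])
  then have "\<beta> \<noteq> 0" using p' by auto
  then show ?thesis using p' that by (simp add: p_def f_def d_def)
qed

text \<open>In degree 2mN, the other root of \<open>lam\<close>, the series for \<open>ac\<close>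
  meets a zero denominator at k = m. The sum stopped at k = m - 1 solves the equation up to one
  monomial, and this defect makes G a partner of (z zb)^(mN), the constant 1 on the circle.\<close>

lemma generalized_eigenfunction:
  assumes N: "N > 0" and m: "m > 0"
  obtains G c where "c \<noteq> 0" "Bop N m G = PP N * (const2 c * (zc * zb) ^ (m * N))"
proof -
  define \<kappa> where "\<kappa> = (of_nat (m * N) + of_nat (m * N) - of_nat ((m - 1) * N)) * (of_nat (m - 1) - of_nat m) *
    of_nat N * ac N m (m * N) (m - 1)"
  define e where "e = m * N - 1"
  obtain k where k: "m = Suc k" using m by (cases m) auto
  have nj: "Suc i * N \<noteq> m * N" if "i < m - 1" for i
  proof -
    have "Suc i < m" using that by simp
    then have "Suc i * N < m * N" using N by (simp only: mult_less_cancel2)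
    then show ?thesis by (metis less_irrefl)
  qed
  have e1: "m * N + m * N - (m - 1) * N - 1 = N + e" "(m - 1) * N + N - 1 = e"
    using N unfolding e_def k by auto
  define g where "g = qs N m (m * N) (m - 1)"
  have Rg: "RR N m g = - const2 \<kappa> * (zc ^ (N + e) * zb ^ e)"
    using RR_qs[OF N, of "m * N" "m - 1" m] nj N m unfolding g_def \<kappa>_def e1 by simp
  define G where "G = g + tau g"
  \<comment> \<open>Adding the reflected sum antisymmetrizes the leftover monomial z^(N+e) zb^e into
    P (z zb)^e, so that division by P is possible.\<close>
  have RG: "RR N m G = PP N * (const2 (- \<kappa>) * (zc * zb) ^ e)"
    unfolding G_def RR_add RR_tau Rg
    by (simp add: PP_def power_add power_mult_distrib const2_minus algebra_simps)
  have "g \<in> HP (int (m * N + m * N))" unfolding g_def by (rule Sect_HP[OF qs_Sect]) simp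
  then have GH: "G \<in> HP (int (m * N + m * N))" unfolding G_def by (intro Sect_add tau_HP)
  have l0: "lam N m (int (m * N + m * N)) = 0" by (simp add: lam_def)
  have "PP N * (const2 (4 * - \<kappa>) * (zc * zb) ^ e) = 4 * RR N m G"
    unfolding RG const2_mult[of 4] const2_numeral by (simp only: mult_ac)
  from Bop_eq[OF N GH this, of 0] have "Bop N m G = PP N * (- (zc * zb * (const2 (4 * - \<kappa>) * (zc * zb) ^ e)))"
    unfolding l0 by simp
  also have "zc * zb * (const2 (4 * - \<kappa>) * (zc * zb) ^ e) = const2 (4 * - \<kappa>) * (zc * zb) ^ Suc e"
    by (simp only: power_Suc mult_ac)
  also have "Suc e = m * N" using m N by (simp add: e_def)
  finally have B: "Bop N m G = PP N * (const2 (4 * \<kappa>) * (zc * zb) ^ (m * N))"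
    by (simp add: const2_minus)
  have "ac N m (m * N) (m - 1) \<noteq> 0" using N m by (intro ac_nz nj) auto
  moreover have "of_nat (m * N) + of_nat (m * N) - of_nat ((m - 1) * N) \<noteq> (0::complex)"
  proof -
    have "(m - 1) * N \<noteq> m * N + m * N" using N unfolding k by simp
    then show ?thesis by (metis of_nat_add of_nat_eq_iff right_minus_eq)
  qed
  moreover have "of_nat (m - 1) - of_nat m \<noteq> (0::complex)" using m unfolding k by simp
  ultimately have "4 * \<kappa> \<noteq> 0" unfolding \<kappa>_def using N by simp
  then show ?thesis using B that by blast
qed

text \<open>The result has degree 0, so it is a constant, and only c \<noteq> 0 is at stake.\<close>

theorem Lp_w:
  assumes N: "N > 0"
  obtains c where "c \<noteq> 0"
    "(Lp N m ^^ ((2 * m + 1) * N)) (PP N ^ (2 * m + 1) * PP N ^ (2 * m + 1)) = const2 c"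
proof -
  define f where "f = PP N ^ (2 * m + 1) * PP N ^ (2 * m + 1)"
  define d where "d = (2 * m + 1) * N"
  have fp: "f = PP N ^ (4 * m + 2)" by (simp add: f_def flip: power_add)
  have fS: "f \<in> Sect N (int (2 * d)) 0"
    using PP_power_Sect[of N "4 * m + 2"] by (simp add: fp d_def algebra_simps)
  have fQ: "QI m f" unfolding f_def by (rule QI_PP_power)
  have "(Lp N m ^^ d) f \<in> Sect N (int (2 * d) - 2 * int d) (0 - int d)"
    by (rule Lp_chain(1)[OF N fS fQ])
  then have "(Lp N m ^^ d) f \<in> HP 0" using Sect_HP by simp
  from HP_0[OF this] obtain c where c: "(Lp N m ^^ d) f = const2 c" by blast
  have "c \<noteq> 0"
  proof
    assume "c = 0"
    then have X0: "XX N m f d = 0" using c by (simp add: XX_def[OF N fS fQ])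
    \<comment> \<open>For i < d the degree 2d - 2i is positive, so only the root 2mN counts. It is
      met at i = (m+1)N, which is below d exactly when m > 0.\<close>
    have lam0: "lam N m (int (2 * d) - 2 * int i) = 0 \<longleftrightarrow> i = (m + 1) * N" if "i < d" for i
    proof -
      have "lam N m (int (2 * d) - 2 * int i) = 0 \<longleftrightarrow>
        int (2 * d) - 2 * int i - 2 * int m * int N = 0"
        unfolding lam_def of_int_eq_0_iff mult_eq_0_iff using that by auto
      also have "\<dots> \<longleftrightarrow> int i = int ((m + 1) * N)" by (auto simp: d_def algebra_simps)
      finally show ?thesis by (simp only: of_nat_eq_iff)
    qed
    show False
    proof (cases "m = 0")
      case True
      have "Bop N m 1 = PP N * (const2 0 * 1)" by (simp add: Bop_def)
      from XX_eigen[OF N fS fQ this, of d]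
      have "deq N m 0 (const2 (\<Prod>i<d. lam N m (int (2 * d) - 2 * int i)) * f)" by (simp add: X0)
      moreover have "(\<Prod>i<d. lam N m (int (2 * d) - 2 * int i)) \<noteq> 0"
        using lam0 True by (subst prod_zero_iff) (auto simp: d_def)
      ultimately have "f \<in> DD N m" by (rule deq_0_D)
      then show False using DD_PP_power[OF N, of 0 m] by (simp add: fp)
    next
      case False
      then obtain G c where G: "c \<noteq> 0" "Bop N m G = PP N * (const2 c * (zc * zb) ^ (m * N))"
        using generalized_eigenfunction[OF N, of m] by blast
      have \<rho>: "Bop N m ((zc * zb) ^ (m * N)) = 0" by (simp add: Bop_def delta_sigma)
      let ?i = "(m + 1) * N"
      have id: "?i < d" using False N by (simp add: d_def)
      have "lam N m (int (2 * d) - 2 * int ?i) = 0" using lam0[OF id] by simp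
      from XX_generalized[OF N fS fQ G(2) \<rho> this id]
      have "deq N m 0 (const2 (- c * (\<Prod>i<?i. lam N m (int (2 * d) - 2 * int i))
        * (\<Prod>i\<in>{?i<..<d}. lam N m (int (2 * d) - 2 * int i))) * ((zc * zb) ^ (m * N) * f))" by (simp add: X0)
      moreover have "- c * (\<Prod>i<?i. lam N m (int (2 * d) - 2 * int i))
        * (\<Prod>i\<in>{?i<..<d}. lam N m (int (2 * d) - 2 * int i)) \<noteq> 0"
      proof -
        have "lam N m (int (2 * d) - 2 * int i) \<noteq> 0" if "i < ?i \<or> i \<in> {?i<..<d}" for i
          using lam0[of i] that id by auto
        then have "(\<Prod>i<?i. lam N m (int (2 * d) - 2 * int i)) \<noteq> 0"
          "(\<Prod>i\<in>{?i<..<d}. lam N m (int (2 * d) - 2 * int i)) \<noteq> 0"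
          by (simp_all only: prod_zero_iff finite_lessThan finite_greaterThanLessThan) auto
        then show ?thesis using G(1) by simp
      qed
      ultimately have "(zc * zb) ^ (m * N) * f \<in> DD N m" by (rule deq_0_D)
      then show False using DD_PP_power[OF N, of "m * N" m] by (simp add: fp)
    qed
  qed
  then show ?thesis using c that by (simp add: f_def d_def)
qed


subsection \<open>The linear map on the basis of \<open>m\<close>-harmonic polynomials\<close>

text \<open>The functionals l form a dual system to e and so provide both expansion and
  independence; in these coordinates \<phi> is a permutation matrix with nonzero weights.\<close>

lemma linear_permutation_bij:
  fixes e :: "'i \<Rightarrow> poly2" and \<phi> :: "poly2 \<Rightarrow> rat2"
  assumes fin: "finite I"
    and l: "\<And>i c f g. l i (const2 c * f + g) = c * l i f + (l i g :: complex)"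
    and le: "\<And>i k. i \<in> I \<Longrightarrow> k \<in> I \<Longrightarrow> l i (e k) = (if i = k then 1 else 0)"
    and \<sigma>: "bij_betw \<sigma> I I" and c: "\<And>i. i \<in> I \<Longrightarrow> c i \<noteq> 0"
    and \<phi>: "\<And>a f g. \<phi> (const2 a * f + g) = K a * \<phi> f + \<phi> g"
    and \<phi>e: "\<And>i. i \<in> I \<Longrightarrow> \<phi> (e i) = K (c i) * to_fract (e (\<sigma> i))"
  shows "bij_betw \<phi> (poly2.span (e ` I)) (to_fract ` poly2.span (e ` I))"
proof -
  let ?H = "poly2.span (e ` I)"
  have l0: "l i 0 = 0" for i using l[of i 1 0 0] by simp
  have \<phi>0: "\<phi> 0 = 0" using \<phi>[of "-1" 0 0] by (simp add: const2_minus)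
  have lsum: "l i (\<Sum>k\<in>J. const2 (a k) * f k) = (\<Sum>k\<in>J. a k * l i (f k))" for i a f and J :: "'i set"
    by (induction J rule: infinite_finite_induct) (simp_all add: l l0)
  have \<phi>sum: "\<phi> (\<Sum>k\<in>J. const2 (a k) * f k) = (\<Sum>k\<in>J. K (a k) * \<phi> (f k))" for a f and J :: "'i set"
    by (induction J rule: infinite_finite_induct) (simp_all add: \<phi> \<phi>0)
  have expand: "q = (\<Sum>i\<in>I. const2 (l i q) * e i)" if "q \<in> ?H" for q
    using that
  proof (induction rule: poly2.span_induct_alt)
    case base show ?case by (simp add: l0)
  next
    case (step c x y)
    then obtain k where k: "k \<in> I" "x = e k" by auto
    have "(\<Sum>i\<in>I. const2 (l i (const2 c * x + y)) * e i)
        = const2 c * (\<Sum>i\<in>I. const2 (l i x) * e i) + (\<Sum>i\<in>I. const2 (l i y) * e i)"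
      unfolding l const2_add const2_mult distrib_right sum.distrib sum_distrib_left mult.assoc ..
    also have "(\<Sum>i\<in>I. const2 (l i x) * e i) = (\<Sum>i\<in>I. if i = k then e k else 0)"
      unfolding k(2) using k(1) by (intro sum.cong) (auto simp: le)
    also have "\<dots> = x" using fin k by simp
    finally show ?case using step(2) by simp
  qed
  have inH: "(\<Sum>i\<in>I. const2 (a i) * e (\<tau> i)) \<in> ?H" if "\<And>i. i \<in> I \<Longrightarrow> \<tau> i \<in> I" for a \<tau>
    using that by (intro poly2.span_sum poly2.span_scale poly2.span_base) auto
  have \<sigma>I: "\<sigma> i \<in> I" if "i \<in> I" for i using \<sigma> that by (auto simp: bij_betw_def)
  have \<phi>q: "\<phi> q = to_fract (\<Sum>i\<in>I. const2 (l i q * c i) * e (\<sigma> i))" if "q \<in> ?H" for q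
  proof -
    have "\<phi> q = (\<Sum>i\<in>I. K (l i q) * \<phi> (e i))" by (subst expand[OF that]) (rule \<phi>sum)
    also have "\<dots> = (\<Sum>i\<in>I. to_fract (const2 (l i q * c i) * e (\<sigma> i)))"
      by (intro sum.cong refl) (simp add: \<phi>e const2_mult mult.assoc)
    finally show ?thesis by simp
  qed
  have lq: "l (\<sigma> k) (\<Sum>i\<in>I. const2 (a i) * e (\<sigma> i)) = a k" if "k \<in> I" for a k
  proof -
    have "l (\<sigma> k) (\<Sum>i\<in>I. const2 (a i) * e (\<sigma> i)) = (\<Sum>i\<in>I. if i = k then a k else 0)"
      unfolding lsum using that \<sigma>I le \<sigma> by (intro sum.cong) (auto simp: bij_betw_def dest: inj_onD)
    then show ?thesis using fin that by simp
  qed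
  show ?thesis
  proof (rule bij_betwI')
    fix p q assume pq: "p \<in> ?H" "q \<in> ?H"
    show "(\<phi> p = \<phi> q) = (p = q)"
    proof
      assume "\<phi> p = \<phi> q"
      then have eq: "(\<Sum>i\<in>I. const2 (l i p * c i) * e (\<sigma> i)) = (\<Sum>i\<in>I. const2 (l i q * c i) * e (\<sigma> i))"
        using \<phi>q[OF pq(1)] \<phi>q[OF pq(2)] by (simp only: to_fract_eq_iff)
      have "l k p = l k q" if "k \<in> I" for k
        using arg_cong[OF eq, of "l (\<sigma> k)"] that c[OF that] by (simp add: lq)
      then have "(\<Sum>i\<in>I. const2 (l i p) * e i) = (\<Sum>i\<in>I. const2 (l i q) * e i)" by simp
      then show "p = q" using expand pq by metis
    qed simp
  next
    fix q assume "q \<in> ?H"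
    then show "\<phi> q \<in> to_fract ` ?H"
      unfolding \<phi>q[OF \<open>q \<in> ?H\<close>] by (intro imageI inH \<sigma>I)
  next
    fix y assume "y \<in> to_fract ` ?H"
    then obtain p where p: "p \<in> ?H" "y = to_fract p" by auto
    define q where "q = (\<Sum>i\<in>I. const2 (l (\<sigma> i) p / c i) * e i)"
    have "q \<in> ?H" unfolding q_def using inH[of "\<lambda>i. i"] by simp
    moreover have "\<phi> q = y"
    proof -
      have "\<phi> q = (\<Sum>i\<in>I. K (l (\<sigma> i) p / c i) * \<phi> (e i))" unfolding q_def by (rule \<phi>sum)
      also have "\<dots> = (\<Sum>i\<in>I. to_fract (const2 (l (\<sigma> i) p) * e (\<sigma> i)))"
      proof (intro sum.cong refl)
        fix i assume i: "i \<in> I"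
        have "K (l (\<sigma> i) p / c i) * (K (c i) * to_fract (e (\<sigma> i))) = K (l (\<sigma> i) p / c i * c i) * to_fract (e (\<sigma> i))"
          by (simp only: K_simps mult.assoc)
        then show "K (l (\<sigma> i) p / c i) * \<phi> (e i) = to_fract (const2 (l (\<sigma> i) p) * e (\<sigma> i))"
          using i c[OF i] by (simp add: \<phi>e)
      qed
      also have "\<dots> = (\<Sum>i\<in>I. to_fract (const2 (l i p) * e i))"
        by (rule sum.reindex_bij_betw[OF \<sigma>])
      also have "\<dots> = to_fract p"
        unfolding to_fract_sum[symmetric] expand[OF p(1), symmetric] ..
      finally show ?thesis using p by simp
    qed
    ultimately show "\<exists>x\<in>?H. y = \<phi> x" by auto
  qed
qed

context
  fixes N m :: nat
  assumes N: "N > 0"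
begin

text \<open>Signed indices from -N + 1 to N make conjugation a sign change for 0 < |t| < N and give
  the permutation a uniform description.\<close>

definition bas :: "int \<Rightarrow> poly2" where
  "bas t = (if t = 0 then 1 else if t = int N then PP N ^ (2 * m + 1)
     else if t > 0 then qj N m (nat t) else tau (qj N m (nat (- t))))"

definition basdeg :: "int \<Rightarrow> nat" where
  "basdeg t = (if t = 0 then 0 else if t = int N then (2 * m + 1) * N else m * N + nat \<bar>t\<bar>)"

text \<open>The coefficient of the pure power of z, or of zb for negative t: these functionals are
  dual to \<open>bas\<close>.\<close>

definition lead :: "int \<Rightarrow> poly2 \<Rightarrow> complex" where
  "lead t f = (if t < 0 then cf 0 (basdeg t) f else cf (basdeg t) 0 f)"

text \<open>An involution of the index set; dual indices have degrees with sum (2m+1)N.\<close>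

definition dual_ix :: "int \<Rightarrow> int" where "dual_ix t = (if t > 0 then t - int N else t + int N)"

abbreviation Ix :: "int set" where "Ix \<equiv> {- int N<..int N}"

lemma bas_HP: "bas t \<in> HP (int (basdeg t))"
  using Sect_z(3)[of "Suc 0"] Sect_HP[OF PP_power_Sect[of N "2 * m + 1"]]
    Sect_HP[OF qj_Sect[of N m "nat t"]] tau_HP[OF Sect_HP[OF qj_Sect[of N m "nat (- t)"]]]
  by (auto simp: bas_def basdeg_def)

lemma lead_linear: "lead t (const2 c * f + g) = c * lead t f + lead t g"
  by (simp add: lead_def cf_add cf_scale)

lemma lead_bas:
  assumes "s \<in> Ix" "t \<in> Ix"
  shows "lead s (bas t) = (if s = t then 1 else 0)"
proof (cases "basdeg s = basdeg t")
  case False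
  then have "lead s (bas t) = 0" using Sect_cf[OF bas_HP[of t]] unfolding lead_def by fastforce
  then show ?thesis using False by auto
next
  case True
  \<comment> \<open>The top degree is at least mN + N, hence above all middle degrees mN + |t|;
    equal degrees then leave only conjugate pairs to distinguish.\<close>
  have "int N + int m * int N \<le> int ((2 * m + 1) * N)" by (simp add: algebra_simps)
  then have "s = t \<or> s = - t \<and> \<bar>s\<bar> < int N \<and> s \<noteq> 0"
    using True assms N unfolding basdeg_def by (auto split: if_splits simp flip: of_nat_mult; linarith)
  moreover have "lead t (bas t) = 1"
  proof -
    consider "t = 0" | "t = int N" | "0 < t" "t < int N" | "t < 0" "- t < int N" using assms by force
    then show ?thesis
    proof cases
      case 1 then show ?thesis using cf_mono[of 0 0 0 0] by (simp add: lead_def bas_def basdeg_def)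
    next
      case 2 then show ?thesis using cf_PP_power[OF N, of "2 * m + 1"] N by (simp add: lead_def bas_def basdeg_def)
    next
      case 3 then show ?thesis using cf_qj(1)[of "nat t" N m] by (simp add: lead_def bas_def basdeg_def)
    next
      case 4 then show ?thesis using cf_qj(1)[of "nat (- t)" N m] by (simp add: lead_def bas_def basdeg_def cf_tau)
    qed
  qed
  moreover have "lead s (bas (- s)) = 0" if "\<bar>s\<bar> < int N" "s \<noteq> 0"
    using cf_qj(4)[of "nat \<bar>s\<bar>" N m] that
    by (cases "s < 0") (auto simp: lead_def bas_def basdeg_def cf_tau)
  ultimately show ?thesis by auto
qed

lemma dual_ix_bij: "bij_betw dual_ix Ix Ix"
  by (rule bij_betwI[of _ _ _ dual_ix]) (auto simp: dual_ix_def)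

lemma subspace_harmonics: "poly2.subspace (harmonics N m)"
proof (rule poly2.subspaceI)
  show "0 \<in> harmonics N m" by (simp add: harmonics_iff[OF N])
  show "x + y \<in> harmonics N m" if "x \<in> harmonics N m" "y \<in> harmonics N m" for x y
    using that by (simp add: harmonics_iff[OF N] calL_add distrib_left calL_pow_add)
  show "const2 c * x \<in> harmonics N m" if "x \<in> harmonics N m" for c x
  proof -
    have "to_fract (QQ N * (const2 c * x)) = K c * to_fract (QQ N * x)" by (simp add: mult_ac)
    then show ?thesis using that
      unfolding harmonics_iff[OF N] by (simp only: to_fract_mult[of "const2 c"] calL_scale calL_pow_scale) simp
  qed
qed

lemma harmonic_hom_iff:
  assumes "f \<in> HP (int n)"
  shows "f \<in> harmonics N m \<longleftrightarrow> RR N m f = 0 \<and> (m * N < n \<and> n < m * N + N \<or> tt N f = 0)"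
  unfolding harmonics_components[OF N] using hom_part_eq[OF assms] by auto

lemma bas_harmonic:
  assumes "t \<in> Ix" shows "bas t \<in> harmonics N m"
proof -
  consider "t = 0" | "t = int N" | "0 < t" "t < int N" | "t < 0" "- t < int N" using assms by force
  then show ?thesis
    unfolding harmonic_hom_iff[OF bas_HP]
  proof cases
    case 1 then show "RR N m (bas t) = 0 \<and> (m * N < basdeg t \<and> basdeg t < m * N + N \<or> tt N (bas t) = 0)"
      by (simp add: bas_def RR_def tt_def)
  next
    case 2 then show "RR N m (bas t) = 0 \<and> (m * N < basdeg t \<and> basdeg t < m * N + N \<or> tt N (bas t) = 0)"
      using RR_PP_power[OF N, of m] tt_PP_power[of N "2 * m + 1"] N by (simp add: bas_def)
  next
    case 3 then show "RR N m (bas t) = 0 \<and> (m * N < basdeg t \<and> basdeg t < m * N + N \<or> tt N (bas t) = 0)"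
      using RR_qj[of "nat t" N m] by (simp add: bas_def basdeg_def nat_less_iff)
  next
    case 4 then show "RR N m (bas t) = 0 \<and> (m * N < basdeg t \<and> basdeg t < m * N + N \<or> tt N (bas t) = 0)"
      using RR_qj[of "nat (- t)" N m] by (simp add: bas_def basdeg_def RR_tau nat_less_iff)
  qed
qed

theorem harmonics_span: "harmonics N m = poly2.span (bas ` Ix)"
proof
  show "poly2.span (bas ` Ix) \<subseteq> harmonics N m"
    using bas_harmonic subspace_harmonics by (intro poly2.span_minimal) auto
  show "harmonics N m \<subseteq> poly2.span (bas ` Ix)"
  proof
    fix q assume q: "q \<in> harmonics N m"
    have "hom_part k q \<in> poly2.span (bas ` Ix)" for k
    proof -
      define f where "f = hom_part k q"
      have fH: "f \<in> HP (int k)" unfolding f_def by (rule hom_part_HP)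
      have R: "RR N m f = 0" and t: "m * N < k \<and> k < m * N + N \<or> tt N f = 0"
        using q unfolding harmonics_components[OF N] f_def by auto
      have B: "const2 c * bas i \<in> poly2.span (bas ` Ix)" if "i \<in> Ix" for c i
        using that by (intro poly2.span_scale poly2.span_base) auto
      consider j where "0 < j" "j < N" "k = m * N + j" | "tt N f = 0" "k = 0" | "tt N f = 0" "k = (2 * m + 1) * N"
        | "tt N f = 0" "k \<noteq> 0" "k \<noteq> (2 * m + 1) * N"
        using t by (metis add_less_cancel_left less_add_same_cancel1 less_imp_add_positive)
      then have "f \<in> poly2.span (bas ` Ix)"
      proof cases
        case (1 j)
        then obtain a b where "f = const2 a * qj N m j + const2 b * tau (qj N m j)"
          using kernel_mid[of j N f m] fH R by metis
        also have "\<dots> = const2 a * bas (int j) + const2 b * bas (- int j)"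
          using 1 by (simp add: bas_def)
        finally show ?thesis using 1 by (auto intro!: poly2.span_add B)
      next
        case 2
        then have "f = const2 (cf 0 0 f) * bas 0" using HP_0[of f] fH by (simp add: bas_def)
        then show ?thesis using B[of 0] N by (metis greaterThanAtMost_iff of_nat_0_le_iff neg_less_0_iff_less of_nat_0_less_iff)
      next
        case 3
        then have "f = const2 (cf ((2 * m + 1) * N) 0 f) * PP N ^ (2 * m + 1)"
          using fH by (intro kernel_top[OF N]) auto
        also have "PP N ^ (2 * m + 1) = bas (int N)" using N by (simp add: bas_def)
        finally have "f = const2 (cf ((2 * m + 1) * N) 0 f) * bas (int N)" .
        moreover have "const2 (cf ((2 * m + 1) * N) 0 f) * bas (int N) \<in> poly2.span (bas ` Ix)"
          using N by (intro B) auto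
        ultimately show ?thesis by simp
      next
        case 4
        then have "f = 0" by (intro kernel_generic[OF N fH R])
        then show ?thesis by (simp add: poly2.span_zero)
      qed
      then show ?thesis by (simp add: f_def)
    qed
    then have "(\<Sum>k | hom_part k q \<noteq> 0. hom_part k q) \<in> poly2.span (bas ` Ix)"
      by (intro poly2.span_sum)
    then show "q \<in> poly2.span (bas ` Ix)" by (simp only: sum_hom_parts)
  qed
qed

lemma calL_w: "calL N m (to_fract (w_poly N m)) = 0"
proof -
  obtain c where "w_poly N m = const2 c * PP N ^ (2 * m + 1)" using w_poly_eq[OF N] by metis
  then have "RR N m (w_poly N m) = 0" by (simp only: RR_scale RR_PP_power[OF N] mult_zero_right)
  then show ?thesis by (simp add: calL_eq_0_iff[OF N])
qed

lemma hom_part_linear: "hom_part d (const2 c * f + g) = const2 c * hom_part d f + hom_part d g"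
  by (rule cf_eqI) (simp add: cf_hom_part cf_add cf_scale)

lemma pi_map_linear: "pi_map N m (const2 a * f + g) = K a * pi_map N m f + pi_map N m g"
proof -
  let ?w = "to_fract (w_poly N m)" and ?L = "calL N m"
  let ?S = "{d. hom_part d f \<noteq> 0} \<union> {d. hom_part d g \<noteq> 0} \<union> {d. hom_part d (const2 a * f + g) \<noteq> 0}"
  have chi: "pi_map N m q = (\<Sum>d\<in>?S. K (1 / (2 ^ d * fact d)) * (?L ^^ d) (to_fract (hom_part d q) * ?w))"
    if "q \<in> {f, g, const2 a * f + g}" for q
    unfolding pi_map_def using that finite_hom_parts by (intro chi_kernel[OF calL_w]) auto
  have "(?L ^^ d) (to_fract (hom_part d (const2 a * f + g)) * ?w)
      = K a * (?L ^^ d) (to_fract (hom_part d f) * ?w) + (?L ^^ d) (to_fract (hom_part d g) * ?w)" for d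
    unfolding hom_part_linear to_fract_add to_fract_mult distrib_right mult.assoc calL_pow_add calL_pow_scale ..
  then show ?thesis
    by (simp add: chi distrib_left sum.distrib sum_distrib_left mult_ac)
qed

lemma pi_map_hom:
  assumes q: "q \<in> HP (int d)"
  obtains c where "c \<noteq> 0" "pi_map N m q = K c * (calL N m ^^ d) (to_fract (q * PP N ^ (2 * m + 1)))"
proof -
  obtain c where c: "c \<noteq> 0" "w_poly N m = const2 c * PP N ^ (2 * m + 1)" by (rule w_poly_eq[OF N])
  have w: "to_fract q * to_fract (w_poly N m) = K c * to_fract (q * PP N ^ (2 * m + 1))"
    unfolding c(2) to_fract_mult by (simp only: mult_ac)
  have "pi_map N m q = K (1 / (2 ^ d * fact d)) * (calL N m ^^ d) (to_fract q * to_fract (w_poly N m))"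
    unfolding pi_map_def chi_hom[OF q] ad_funpow_kernel[OF calL_w] ..
  also have "\<dots> = K (1 / (2 ^ d * fact d) * c) * (calL N m ^^ d) (to_fract (q * PP N ^ (2 * m + 1)))"
    unfolding w calL_pow_scale K_simps(2) mult.assoc ..
  finally show ?thesis using c(1) by (intro that[of "1 / (2 ^ d * fact d) * c"]) auto
qed

lemma calL_pow_tau:
  assumes "f \<in> Sect N n r" "QI m f"
  shows "(calL N m ^^ i) (to_fract (tau f)) = to_fract (tau ((Lp N m ^^ i) f))"
proof (induction i)
  case (Suc i)
  have "PP N * tau ((Lp N m ^^ Suc i) f) = - tau (PP N * (Lp N m ^^ Suc i) f)" by simp
  also have "\<dots> = 4 * RR N m (tau ((Lp N m ^^ i) f))"
    unfolding Lp_chain(3)[OF N assms] RR_tau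
    by (simp add: tau_of_nat[of 4, simplified])
  finally show ?case by (simp add: Suc calL_eq_iff[OF N])
qed simp

theorem pi_map_bas:
  assumes "t \<in> Ix"
  shows "\<exists>c. c \<noteq> 0 \<and> pi_map N m (bas t) = K c * to_fract (bas (dual_ix t))"
proof -
  obtain c where c: "c \<noteq> 0" "pi_map N m (bas t) = K c * (calL N m ^^ basdeg t) (to_fract (bas t * PP N ^ (2 * m + 1)))"
    by (rule pi_map_hom[OF bas_HP])
  have "\<exists>b. b \<noteq> 0 \<and> (calL N m ^^ basdeg t) (to_fract (bas t * PP N ^ (2 * m + 1))) = K b * to_fract (bas (dual_ix t))"
  proof -
    consider "t = 0" | "t = int N" | "0 < t" "t < int N" | "t < 0" "- t < int N" using assms by force
    then show ?thesis
    proof cases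
      case 1
      then show ?thesis using N by (intro exI[of _ 1]) (simp add: bas_def basdeg_def dual_ix_def)
    next
      case 2
      obtain b where b: "b \<noteq> 0" "(Lp N m ^^ ((2 * m + 1) * N)) (PP N ^ (2 * m + 1) * PP N ^ (2 * m + 1)) = const2 b"
        by (rule Lp_w[OF N])
      have "PP N ^ (2 * m + 1) * PP N ^ (2 * m + 1) \<in> Sect N (int ((2 * m + 1) * N) + int ((2 * m + 1) * N)) (0 + 0)"
        by (intro Sect_mult PP_power_Sect)
      note calL_Lp[OF N this QI_PP_power, of "(2 * m + 1) * N"]
      moreover have "bas t = PP N ^ (2 * m + 1)" "basdeg t = (2 * m + 1) * N" "bas (dual_ix t) = 1"
        using 2 N by (simp_all add: bas_def basdeg_def dual_ix_def)
      ultimately show ?thesis using b by (intro exI[of _ b]) simp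
    next
      case 3
      define j where "j = nat t"
      have j: "0 < j" "j < N" "t = int j" using 3 by (auto simp: j_def)
      obtain b where b: "b \<noteq> 0" "(Lp N m ^^ (m * N + j)) (qj N m j * PP N ^ (2 * m + 1)) = const2 b * tau (qj N m (N - j))"
        by (rule Lp_qj[OF j(1,2)])
      have "bas t = qj N m j" "basdeg t = m * N + j" using j by (simp_all add: bas_def basdeg_def)
      moreover have "bas (dual_ix t) = tau (qj N m (N - j))"
        using j by (simp add: bas_def dual_ix_def nat_diff_distrib)
      ultimately show ?thesis using b calL_Lp[OF N qjP_Sect[OF j(1,2)] qjP_QI[OF j(1,2)], of "m * N + j"]
        by (intro exI[of _ b]) simp
    next
      case 4
      define j where "j = nat (- t)"
      have j: "0 < j" "j < N" "t = - int j" using 4 by (auto simp: j_def)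
      obtain b where b: "b \<noteq> 0" "(Lp N m ^^ (m * N + j)) (qj N m j * PP N ^ (2 * m + 1)) = const2 b * tau (qj N m (N - j))"
        by (rule Lp_qj[OF j(1,2)])
      have "bas t = tau (qj N m j)" "basdeg t = m * N + j" using j by (simp_all add: bas_def basdeg_def)
      moreover have "bas (dual_ix t) = qj N m (N - j)"
      proof -
        have "dual_ix t = int (N - j)" "N - j \<noteq> 0" "N - j \<noteq> N" using j by (simp_all add: dual_ix_def)
        moreover have "bas (int k) = qj N m k" if "k \<noteq> 0" "k \<noteq> N" for k
          using that by (simp add: bas_def)
        ultimately show ?thesis by (simp only: not_False_eq_True)
      qed
      \<comment> \<open>P is odd under \<open>tau\<close>, and 2m + 1 is odd; this is the sign in
        the witness \<open>- b\<close>.\<close>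
      moreover have "to_fract (tau (qj N m j) * PP N ^ (2 * m + 1)) = K (-1) * to_fract (tau (qj N m j * PP N ^ (2 * m + 1)))"
        by (simp add: K_simps const2_minus)
      ultimately show ?thesis using b calL_pow_tau[OF qjP_Sect[OF j(1,2)] qjP_QI[OF j(1,2)], of "m * N + j"]
        by (intro exI[of _ "- b"]) (simp only: calL_pow_scale, simp add: const2_minus)
    qed
  qed
  then obtain b where "b \<noteq> 0" "(calL N m ^^ basdeg t) (to_fract (bas t * PP N ^ (2 * m + 1))) = K b * to_fract (bas (dual_ix t))" by blast
  then show ?thesis using c by (intro exI[of _ "c * b"]) (simp add: K_simps const2_mult mult.assoc)
qed

end

theorem theorem11:
  fixes N m :: nat
  assumes "N \<ge> 2"
  shows "linear_iso_between scale_poly2 scale_rat2 (pi_map N m)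
           (harmonics N m) (to_fract ` harmonics N m)"
proof -
  have N: "N > 0" using assms by simp
  have "\<forall>t. \<exists>c. t \<in> {- int N<..int N} \<longrightarrow> c \<noteq> 0 \<and> pi_map N m (bas N m t) = K c * to_fract (bas N m (dual_ix N t))"
    using pi_map_bas[OF N] by blast
  then obtain c where c: "\<And>t. t \<in> {- int N<..int N} \<Longrightarrow>
      c t \<noteq> 0 \<and> pi_map N m (bas N m t) = K (c t) * to_fract (bas N m (dual_ix N t))"
    by metis
  have bij: "bij_betw (pi_map N m) (harmonics N m) (to_fract ` harmonics N m)"
    unfolding harmonics_span[OF N]
    by (rule linear_permutation_bij[where c = c, OF _ lead_linear[OF N, of m] lead_bas[OF N, of _ _ m]
          dual_ix_bij[OF N] _ pi_map_linear[OF N]]) (use c in auto)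
  have sub: "poly2.subspace (harmonics N m)" by (rule subspace_harmonics[OF N])
  have sub': "rat2.subspace (to_fract ` harmonics N m)"
  proof (rule rat2.subspaceI)
    show "0 \<in> to_fract ` harmonics N m"
      using poly2.subspace_0[OF sub] by (metis image_eqI to_fract_0)
    show "x + y \<in> to_fract ` harmonics N m" if "x \<in> to_fract ` harmonics N m" "y \<in> to_fract ` harmonics N m" for x y
      using that poly2.subspace_add[OF sub] by (auto simp flip: to_fract_add)
    show "K a * x \<in> to_fract ` harmonics N m" if "x \<in> to_fract ` harmonics N m" for a x
      using that poly2.subspace_scale[OF sub] by (auto simp flip: to_fract_mult)
  qed
  have add: "pi_map N m (u + v) = pi_map N m u + pi_map N m v" for u v
    using pi_map_linear[OF N, of m 1 u v] by simp
  have scale: "pi_map N m (const2 a * v) = K a * pi_map N m v" for a v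
    using pi_map_linear[OF N, of m a v 0] pi_map_linear[OF N, of m "-1" 0 0] by (simp add: const2_minus)
  show ?thesis
    unfolding linear_iso_between_def using sub sub' bij add scale by blast
qed

end
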